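(* Let $\bar M=\mathbb P_S\times_{h_S}\mathbb R$ be the Schwarzschild spacetime of dimension $m+1$, with $m\ge3$. Let $\psi:M\to\bar M$ be a spacelike hypersurface such that $\pi=\pi_{\mathbb P_S}\circ\psi:M\to\mathbb P_S$ is a covering map. (a) If $$\liminf_{\substack{\rho(\pi(x))\to+\infty\\ x\in M}}H(x)>0,$$ then $\psi(M)$ is not contained in any lower half-space of the form $\mathbb P_S\times(-\infty,t_0]$, $t_0\in\mathbb R$. (b) If $$\limsup_{\substack{\rho(\pi(x))\to+\infty\\ x\in M}}H(x)<0,$$ then $\psi(M)$ is not contained in any upper half-space of the form $\mathbb P_S\times[t_0,+\infty)$, $t_0\in\mathbb R$.
   Context: All manifolds are smooth and connected. The Schwarzschild spacetime of dimension $m+1$ with mass parameter $\mu>0$ is $\mathbb P_S\times\mathbb R$ with the Lorentzian metric $\bar g=\pi_{\mathbb P_S}^*\sigma_S-(h_S\circ\pi_{\mathbb P_S})^2\pi_{\mathbb R}^*(dt^2)$, where $\pi_{\mathbb P_S},\pi_{\mathbb R}$ are the projections and $$(\mathbb P_S,\sigma_S)=\Big((\rho_S,+\infty)\times\mathbb S^{m-1},\ \frac{d\rho^2}{V(\rho)}+\rho^2\langle\,,\rangle_{\mathbb S^{m-1}}\Big),\quad V(\rho)=1-2\mu\rho^{2-m},\quad h_S=\sqrt{V(\rho)},$$ with $\rho$ the standard coordinate on $(\rho_S,+\infty)$, $\rho_S=(2\mu)^{1/(m-2)}$, and $\langle\,,\rangle_{\mathbb S^{m-1}}$ the standard round metric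 of the unit sphere. A spacelike hypersurface is a smooth immersion $\psi:M\to\bar M$ of a connected $m$-dimensional manifold $M$ such that $g=\psi^*\bar g$ is a Riemannian metric. $N$ is the unique unit timelike normal field along $\psi$ with $\bar g(N,\partial_t)<0$. The mean curvature function $H$ in the direction of $N$ is defined by: the mean curvature vector (i.e. $\frac1m\mathrm{trace}_g$ of the second fundamental tensor) equals $HN$; equivalently $H=\frac1m\sum_i\bar g(\bar\nabla_{E_i}N,E_i)$ for a local $g$-orthonormal frame $\{E_i\}$. The liminf in (a) is $\lim_{s\to+\infty}\inf\{H(x):x\in M,\ \rho(\pi(x))\ge s\}$, and the limsup in (b) is defined analogously with sup. *)

theory Defs
  imports "HOL-Analysis.Analysis"
begin

section \<open>Smooth maps and smooth manifolds\<close>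

text \<open>Intended for open sets only.\<close>

primrec Ck_on :: "nat \<Rightarrow> 'v::real_normed_vector set \<Rightarrow> ('v \<Rightarrow> 'w::real_normed_vector) \<Rightarrow> bool" where
  "Ck_on 0 S f \<longleftrightarrow> continuous_on S f"
| "Ck_on (Suc k) S f \<longleftrightarrow>
     (\<forall>x\<in>S. f differentiable at x) \<and>
     (\<forall>v. Ck_on k S (\<lambda>x. frechet_derivative f (at x) v))"

definition smooth_on :: "'v::real_normed_vector set \<Rightarrow> ('v \<Rightarrow> 'w::real_normed_vector) \<Rightarrow> bool" where
  "smooth_on S f \<longleftrightarrow> (\<forall>k. Ck_on k S f)"

definition second_countable_space :: "'a topology \<Rightarrow> bool" where
  "second_countable_space X \<longleftrightarrow>
     (\<exists>\<B>. countable \<B> \<and> (\<forall>B\<in>\<B>. openin X B) \<and>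
          (\<forall>W. openin X W \<longrightarrow> (\<exists>\<C>\<subseteq>\<B>. \<Union>\<C> = W)))"

text \<open>
  A manifold is a set \<open>M\<close> with its subspace topology and a (not necessarily maximal) smooth
  atlas, whose elements are pairs of a chart domain and a chart map into the Euclidean space
  \<open>'e\<close>; the dimension of \<open>M\<close> is \<open>DIM('e)\<close>.
\<close>

definition smooth_manifold ::
    "'a::topological_space set \<Rightarrow> ('a set \<times> ('a \<Rightarrow> 'e::euclidean_space)) set \<Rightarrow> bool" where
  "smooth_manifold M \<A> \<longleftrightarrow>
     Hausdorff_space (top_of_set M) \<and> second_countable_space (top_of_set M) \<and>
     (\<Union>(U, \<phi>)\<in>\<A>. U) = M \<and>
     (\<forall>(U, \<phi>)\<in>\<A>. openin (top_of_set M) U \<and> open (\<phi> ` U) \<and>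
        homeomorphism U (\<phi> ` U) \<phi> (inv_into U \<phi>)) \<and>
     (\<forall>(U, \<phi>)\<in>\<A>. \<forall>(W, \<kappa>)\<in>\<A>. smooth_on (\<phi> ` (U \<inter> W)) (\<kappa> \<circ> inv_into U \<phi>))"

section \<open>The Schwarzschild spacetime\<close>

text \<open>
  The unit sphere of dimension \<open>m - 1\<close> is \<open>sphere 0 1\<close> in a Euclidean space \<open>'e\<close> with
  \<open>DIM('e) = m\<close>, so that the spacetime is an embedded submanifold of \<open>(\<real> \<times> 'e) \<times> \<real>\<close>.
  Its tangent vectors at \<open>((\<rho>, \<theta>), t)\<close> are the \<open>((a, w), \<tau>)\<close> with \<open>w\<close> orthogonal to \<open>\<theta>\<close>;
  the metrics below are meant for such vectors.
\<close>

definition schw_radius :: "nat \<Rightarrow> real \<Rightarrow> real" where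
  "schw_radius m \<mu> = (2 * \<mu>) powr (1 / (real m - 2))"

definition schw_V :: "nat \<Rightarrow> real \<Rightarrow> real \<Rightarrow> real" where
  "schw_V m \<mu> \<rho> = 1 - 2 * \<mu> * \<rho> powr (2 - real m)"

definition schw_h :: "nat \<Rightarrow> real \<Rightarrow> real \<Rightarrow> real" where
  "schw_h m \<mu> \<rho> = sqrt (schw_V m \<mu> \<rho>)"

definition schw_base :: "real \<Rightarrow> (real \<times> 'e::euclidean_space) set" where
  "schw_base \<mu> = {schw_radius DIM('e) \<mu> <..} \<times> sphere 0 1"

definition schw_base_metric ::
    "real \<Rightarrow> real \<times> 'e::euclidean_space \<Rightarrow> real \<times> 'e \<Rightarrow> real \<times> 'e \<Rightarrow> real" where
  "schw_base_metric \<mu> p u v =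
     fst u * fst v / schw_V DIM('e) \<mu> (fst p) + (fst p)\<^sup>2 * (snd u \<bullet> snd v)"

definition schw_metric ::
    "real \<Rightarrow> (real \<times> 'e::euclidean_space) \<times> real \<Rightarrow> (real \<times> 'e) \<times> real \<Rightarrow> (real \<times> 'e) \<times> real \<Rightarrow> real" where
  "schw_metric \<mu> p u v =
     schw_base_metric \<mu> (fst p) (fst u) (fst v)
     - (schw_h DIM('e) \<mu> (fst (fst p)))\<^sup>2 * (snd u * snd v)"

text \<open>
  The spacetime has a global chart onto the open set of all \<open>(y, t)\<close> with
  \<open>norm y > schw_radius DIM('e) \<mu>\<close>, given by polar coordinates. It is used to compute covariant
  derivatives: \<open>schw_metric_coord\<close> is the metric in this chart, i.e. its pullback
  under the inverse \<open>schw_param\<close> of \<open>schw_chart\<close>.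
\<close>

definition schw_chart :: "(real \<times> 'e::euclidean_space) \<times> real \<Rightarrow> 'e \<times> real" where
  "schw_chart p = (fst (fst p) *\<^sub>R snd (fst p), snd p)"

definition schw_param :: "'e::euclidean_space \<times> real \<Rightarrow> (real \<times> 'e) \<times> real" where
  "schw_param q = ((norm (fst q), fst q /\<^sub>R norm (fst q)), snd q)"

definition schw_metric_coord ::
    "real \<Rightarrow> 'e::euclidean_space \<times> real \<Rightarrow> 'e \<times> real \<Rightarrow> 'e \<times> real \<Rightarrow> real" where
  "schw_metric_coord \<mu> q u v =
     schw_metric \<mu> (schw_param q)
       (frechet_derivative schw_param (at q) u) (frechet_derivative schw_param (at q) v)"

lemma schw_param_chart:
  fixes p :: "(real \<times> 'e::euclidean_space) \<times> real"
  assumes "p \<in> schw_base \<mu> \<times> UNIV" "\<mu> > 0"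
  shows "schw_param (schw_chart p) = p"
proof -
  obtain \<rho> \<theta> t where p: "p = ((\<rho>, \<theta>), t)"
    by (metis prod.exhaust)
  have "schw_radius DIM('e) \<mu> > 0"
    using assms(2) by (simp add: schw_radius_def)
  moreover have "schw_radius DIM('e) \<mu> < \<rho>" "norm \<theta> = 1"
    using assms(1) by (simp_all add: p schw_base_def)
  ultimately have "\<rho> > 0" "norm \<theta> = 1"
    by linarith+
  then show ?thesis
    by (simp add: p schw_param_def schw_chart_def)
qed

lemma schw_chart_param:
  fixes q :: "'e::euclidean_space \<times> real"
  assumes "schw_radius DIM('e) \<mu> < norm (fst q)" "\<mu> > 0"
  shows "schw_param q \<in> schw_base \<mu> \<times> UNIV" "schw_chart (schw_param q) = q"
proof -
  have "schw_radius DIM('e) \<mu> > 0"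
    using assms(2) by (simp add: schw_radius_def)
  then have "norm (fst q) > 0"
    using assms(1) by linarith
  then show "schw_param q \<in> schw_base \<mu> \<times> UNIV" "schw_chart (schw_param q) = q"
    using assms(1) by (simp_all add: schw_param_def schw_chart_def schw_base_def)
qed

section \<open>Levi-Civita connection in coordinates\<close>

text \<open>
  \<open>G q u v\<close> is a (pseudo-)Riemannian metric on an open set of a Euclidean space.
  \<open>christoffel G q u v\<close> is the Levi-Civita derivative at \<open>q\<close> of the constant vector field \<open>v\<close> in
  the direction \<open>u\<close>, determined by the Koszul formula for constant (hence commuting) fields.
\<close>

definition christoffel :: "('v::euclidean_space \<Rightarrow> 'v \<Rightarrow> 'v \<Rightarrow> real) \<Rightarrow> 'v \<Rightarrow> 'v \<Rightarrow> 'v \<Rightarrow> 'v" where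
  "christoffel G q u v =
     (THE w. \<forall>z. 2 * G q w z =
        frechet_derivative (\<lambda>r. G r v z) (at q) u
        + frechet_derivative (\<lambda>r. G r u z) (at q) v
        - frechet_derivative (\<lambda>r. G r u v) (at q) z)"

text \<open>
  Covariant derivative at \<open>y\<close>, in the direction \<open>e\<close>, of a vector field \<open>X\<close> along a map \<open>f\<close>.
\<close>

definition cov_deriv_along ::
    "('v::euclidean_space \<Rightarrow> 'v \<Rightarrow> 'v \<Rightarrow> real) \<Rightarrow> ('e::euclidean_space \<Rightarrow> 'v) \<Rightarrow> ('e \<Rightarrow> 'v) \<Rightarrow> 'e \<Rightarrow> 'e \<Rightarrow> 'v" where
  "cov_deriv_along G f X y e =
     frechet_derivative X (at y) e
     + christoffel G (f y) (frechet_derivative f (at y) e) (X y)"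

section \<open>Spacelike hypersurfaces and their mean curvature\<close>

text \<open>Positive definiteness of the induced metric implies that \<open>\<psi>\<close> is an immersion.\<close>

definition spacelike_hypersurface ::
    "real \<Rightarrow> 'a::topological_space set \<Rightarrow> ('a set \<times> ('a \<Rightarrow> 'e::euclidean_space)) set \<Rightarrow>
     ('a \<Rightarrow> (real \<times> 'e) \<times> real) \<Rightarrow> bool" where
  "spacelike_hypersurface \<mu> M \<A> \<psi> \<longleftrightarrow>
     smooth_manifold M \<A> \<and> connected M \<and> \<psi> ` M \<subseteq> schw_base \<mu> \<times> UNIV \<and>
     (\<forall>(U, \<phi>)\<in>\<A>. smooth_on (\<phi> ` U) (\<psi> \<circ> inv_into U \<phi>) \<and>
        (\<forall>y\<in>\<phi> ` U. \<forall>e. e \<noteq> 0 \<longrightarrow>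
           (let d = frechet_derivative (\<psi> \<circ> inv_into U \<phi>) (at y) e
            in schw_metric \<mu> (\<psi> (inv_into U \<phi> y)) d d > 0)))"

text \<open>
  In the next three definitions \<open>f\<close> is a local parametrization of a hypersurface. The vector
  \<open>(0, 1)\<close> is the coordinate field \<open>\<partial>\<^sub>t\<close> in \<open>schw_chart\<close>.
\<close>

definition unit_normal ::
    "real \<Rightarrow> ('e::euclidean_space \<Rightarrow> 'e \<times> real) \<Rightarrow> 'e \<Rightarrow> 'e \<times> real" where
  "unit_normal \<mu> f y =
     (THE n. (\<forall>e. schw_metric_coord \<mu> (f y) n (frechet_derivative f (at y) e) = 0) \<and>
             schw_metric_coord \<mu> (f y) n n = - 1 \<and>
             schw_metric_coord \<mu> (f y) n (0, 1) < 0)"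

definition orthonormal_frame_at ::
    "real \<Rightarrow> ('e::euclidean_space \<Rightarrow> 'e \<times> real) \<Rightarrow> 'e \<Rightarrow> ('e \<Rightarrow> 'e) \<Rightarrow> bool" where
  "orthonormal_frame_at \<mu> f y E \<longleftrightarrow>
     (\<forall>b\<in>Basis. \<forall>c\<in>Basis.
        schw_metric_coord \<mu> (f y)
          (frechet_derivative f (at y) (E b)) (frechet_derivative f (at y) (E c))
        = (if b = c then 1 else 0))"

text \<open>\<open>Basis\<close> serves as an index set with \<open>DIM('e)\<close> elements; the choice of frame is immaterial.\<close>

definition mean_curvature_param :: "real \<Rightarrow> ('e::euclidean_space \<Rightarrow> 'e \<times> real) \<Rightarrow> 'e \<Rightarrow> real" where
  "mean_curvature_param \<mu> f y =
     (let E = (SOME E. orthonormal_frame_at \<mu> f y E)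
      in (\<Sum>b\<in>Basis. schw_metric_coord \<mu> (f y)
            (cov_deriv_along (schw_metric_coord \<mu>) f (unit_normal \<mu> f) y (E b))
            (frechet_derivative f (at y) (E b))) / real DIM('e))"

text \<open>The choice of the chart around \<open>x\<close> is immaterial.\<close>

definition mean_curvature ::
    "real \<Rightarrow> ('a set \<times> ('a \<Rightarrow> 'e::euclidean_space)) set \<Rightarrow> ('a \<Rightarrow> (real \<times> 'e) \<times> real) \<Rightarrow> 'a \<Rightarrow> real" where
  "mean_curvature \<mu> \<A> \<psi> x =
     (let (U, \<phi>) = (SOME c. c \<in> \<A> \<and> x \<in> fst c)
      in mean_curvature_param \<mu> (schw_chart \<circ> \<psi> \<circ> inv_into U \<phi>) (\<phi> x))"

section \<open>Limits at infinity\<close>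

text \<open>The infima and suprema are taken in the extended reals, since \<open>H\<close> may be unbounded.\<close>

definition liminf_end :: "'a set \<Rightarrow> ('a \<Rightarrow> real) \<Rightarrow> ('a \<Rightarrow> real) \<Rightarrow> ereal" where
  "liminf_end M r H = Lim at_top (\<lambda>s. INF x\<in>{x\<in>M. r x \<ge> s}. ereal (H x))"

definition limsup_end :: "'a set \<Rightarrow> ('a \<Rightarrow> real) \<Rightarrow> ('a \<Rightarrow> real) \<Rightarrow> ereal" where
  "limsup_end M r H = Lim at_top (\<lambda>s. SUP x\<in>{x\<in>M. r x \<ge> s}. ereal (H x))"

end

theory Submission
  imports Defs "HOL-Probability.Discrete_Topology"
begin

text \<open>
  The theorem follows from the maximum principle, applied with a radial barrier. Consider case (a); the
  other one follows by reversing time. Since the sphere of dimension \<open>m - 1 \<ge> 2\<close> is simply connected,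
  the covering has a global section (\<open>covering_space_section\<close>), whose image in spacetime is the graph of
  a function \<open>u\<close> on the whole base. Suppose that \<open>H \<ge> c > 0\<close> for \<open>\<rho> \<ge> s\<close> and that \<open>u\<close> is bounded above.

  For a radial function \<open>\<phi>(\<rho>)\<close> with \<open>S = V\<^sup>2\<phi>' / sqrt (V - V\<^sup>3\<phi>'\<^sup>2)\<close>, the mean curvature of the graph,
  multiplied by \<open>m\<close>, is \<open>S' + (m - 1) S / \<rho>\<close>. Choosing \<open>S = \<epsilon> (\<rho> - s) - Q\<close> with \<open>0 < \<epsilon> < c\<close> and \<open>Q\<close> large gives
  a spacelike graph of mean curvature less than \<open>c\<close> that rises to infinity as \<open>\<rho>\<close> does, but starts at
  \<open>\<rho> = s\<close> falling almost at the speed of light (\<open>radial_barrier_exists\<close>). The difference \<open>u - \<phi>\<close> tends to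
  \<open>-\<infinity>\<close> at infinity. It does not attain its maximum over \<open>\<rho> \<ge> s\<close> on the sphere \<open>\<rho> = s\<close>, because \<open>u\<close>,
  being spacelike, falls along a radial segment strictly less than a light ray, hence less than \<open>\<phi>\<close> if
  \<open>Q\<close> is large enough. So it has an interior maximum, where the hypersurface touches a translate of
  the barrier from below; there its mean curvature is at most that of the barrier
  (\<open>mean_curvature_contact\<close>), hence less than \<open>c\<close>, which is a contradiction.

  The comparison at the point of contact is the second derivative test for \<open>t - \<phi>(\<rho>)\<close> along the
  hypersurface. The differential of this function at the point is a multiple of the normal, so its
  Hessian along the hypersurface involves the second fundamental form
  (\<open>G_cov_deriv_normal\<close>), and the trace over an orthonormal frame yields the mean curvature.
\<close>

section \<open>Sections of covering maps\<close>

lemma covering_space_homeomorphic_base: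
  assumes cov: "covering_space C p S" and hom: "homeomorphism S S' h k"
  shows "covering_space C (h \<circ> p) S'"
  unfolding covering_space_def
proof (intro conjI ballI)
  have S: "p ` C = S" and contp: "continuous_on C p"
    using cov by (auto simp: covering_space_def)
  show "continuous_on C (h \<circ> p)"
    using contp hom S by (intro continuous_on_compose) (auto simp: homeomorphism_def)
  show "(h \<circ> p) ` C = S'"
    using hom S by (metis homeomorphism_def image_comp)
  fix y assume "y \<in> S'"
  then have ky: "k y \<in> S" and hk: "h (k y) = y"
    using hom by (auto simp: homeomorphism_def)
  then obtain T v where T: "k y \<in> T" "openin (top_of_set S) T" and v: "\<Union>v = C \<inter> p -` T"
    "\<forall>u\<in>v. openin (top_of_set C) u" "pairwise disjnt v" "\<forall>u\<in>v. \<exists>q. homeomorphism u T p q"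
    using cov unfolding covering_space_def by meson
  have TS: "T \<subseteq> S"
    using T(2) openin_imp_subset by blast
  have inj: "inj_on h S"
    using hom by (metis homeomorphism_def inj_on_def)
  have homT: "homeomorphism T (h ` T) h k"
    by (rule homeomorphism_of_subsets[OF hom]) (use TS hom in \<open>auto simp: homeomorphism_def\<close>)
  show "\<exists>T'. y \<in> T' \<and> openin (top_of_set S') T' \<and>
          (\<exists>v. \<Union>v = C \<inter> (h \<circ> p) -` T' \<and> (\<forall>u\<in>v. openin (top_of_set C) u) \<and>
               pairwise disjnt v \<and> (\<forall>u\<in>v. \<exists>q. homeomorphism u T' (h \<circ> p) q))"
  proof (intro exI conjI)
    show "y \<in> h ` T"
      using T(1) hk by force
    show "openin (top_of_set S') (h ` T)"
      by (rule homeomorphism_imp_open_map[OF hom T(2)])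
    show "\<Union>v = C \<inter> (h \<circ> p) -` (h ` T)"
      using v(1) S TS inj by (auto simp: inj_on_def) blast
    show "\<forall>u\<in>v. \<exists>q. homeomorphism u (h ` T) (h \<circ> p) q"
      using v(4) homeomorphism_compose homT by blast
  qed (use v in auto)
qed

text \<open>
  Together with \<open>covering_space_embeds_in_normed_space\<close>, this extends the lifting theorems from total
  spaces inside a normed vector space to arbitrary Hausdorff ones, for a base that is a proper open
  subset of a normed vector space.
\<close>

lemma covering_space_homeomorphic_total:
  assumes cov: "covering_space C p S" and hom: "homeomorphism C C' h k"
  shows "covering_space C' (p \<circ> k) S"
  unfolding covering_space_def
proof (intro conjI ballI)
  have S: "p ` C = S" and contp: "continuous_on C p"
    using cov by (auto simp: covering_space_def)
  show "continuous_on C' (p \<circ> k)"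
    using contp hom by (intro continuous_on_compose) (auto simp: homeomorphism_def)
  show "(p \<circ> k) ` C' = S"
    using hom S by (metis homeomorphism_def image_comp)
  fix y assume "y \<in> S"
  then obtain T v where T: "y \<in> T" "openin (top_of_set S) T" and v: "\<Union>v = C \<inter> p -` T"
    "\<forall>u\<in>v. openin (top_of_set C) u" "pairwise disjnt v" "\<forall>u\<in>v. \<exists>q. homeomorphism u T p q"
    using cov unfolding covering_space_def by meson
  have sub: "u \<subseteq> C" if "u \<in> v" for u
    using that v(2) openin_imp_subset by blast
  have kh: "k (h x) = x" if "x \<in> C" for x
    using hom that by (simp add: homeomorphism_def)
  have homu: "homeomorphism (h ` u) u k h" if "u \<in> v" for u
  proof (rule homeomorphism_of_subsets[OF homeomorphism_symD[OF hom]])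
    show "h ` u \<subseteq> C'"
      using sub[OF that] hom by (auto simp: homeomorphism_def)
    show "k ` h ` u = u"
      using sub[OF that] kh by force
  qed (use sub that in auto)
  show "\<exists>T. y \<in> T \<and> openin (top_of_set S) T \<and>
          (\<exists>v. \<Union>v = C' \<inter> (p \<circ> k) -` T \<and> (\<forall>u\<in>v. openin (top_of_set C') u) \<and>
               pairwise disjnt v \<and> (\<forall>u\<in>v. \<exists>q. homeomorphism u T (p \<circ> k) q))"
  proof (intro exI conjI)
    have "\<Union>((`) h ` v) = h ` (C \<inter> p -` T)"
      using v(1) by blast
    also have "\<dots> = C' \<inter> (p \<circ> k) -` T"
    proof (intro set_eqI iffI)
      fix z assume "z \<in> C' \<inter> (p \<circ> k) -` T"
      then have "h (k z) = z" "k z \<in> C \<inter> p -` T"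
        using hom by (auto simp: homeomorphism_def)
      then show "z \<in> h ` (C \<inter> p -` T)"
        by (metis imageI)
    qed (use hom kh in \<open>auto simp: homeomorphism_def\<close>)
    finally show "\<Union>((`) h ` v) = C' \<inter> (p \<circ> k) -` T" .
    show "\<forall>u\<in>(`) h ` v. openin (top_of_set C') u"
      using v(2) homeomorphism_imp_open_map[OF hom] by blast
    have inj: "inj_on h C"
      by (metis inj_onI kh)
    show "pairwise disjnt ((`) h ` v)"
    proof (clarsimp simp: pairwise_def)
      fix a b assume ab: "a \<in> v" "b \<in> v" "h ` a \<noteq> h ` b"
      then have "disjnt a b"
        using v(3) by (metis pairwiseD)
      then show "disjnt (h ` a) (h ` b)"
        using inj sub ab by (metis disjnt_def image_empty inj_on_image_Int)
    qed
    show "\<forall>u\<in>(`) h ` v. \<exists>q. homeomorphism u T (p \<circ> k) q"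
      using v(4) homu homeomorphism_compose by blast
  qed (use T in auto)
qed

text \<open>
  Two lifts agree on an open set because the map is locally injective, and on a closed set because
  the total space is Hausdorff.
\<close>

lemma local_injection_lift_unique:
  assumes C: "Hausdorff_space (top_of_set C)"
    and loc: "\<And>x. x \<in> C \<Longrightarrow> \<exists>W. x \<in> W \<and> openin (top_of_set C) W \<and> inj_on p W"
    and D: "connected D"
    and g: "continuous_on D g" "g \<in> D \<rightarrow> C"
    and g': "continuous_on D g'" "g' \<in> D \<rightarrow> C"
    and eq: "\<And>y. y \<in> D \<Longrightarrow> p (g y) = p (g' y)"
    and a: "a \<in> D" "g a = g' a" and y: "y \<in> D"
  shows "g y = g' y"
proof -
  define K where "K = {y \<in> D. g y = g' y}"
  have "closedin (top_of_set D) {y \<in> topspace (top_of_set D). g y = g' y}"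
    by (rule closedin_continuous_maps_eq[OF C]) (use g g' in \<open>auto simp: continuous_map_in_subtopology\<close>)
  then have "closedin (top_of_set D) K"
    by (simp add: K_def)
  moreover have "openin (top_of_set D) K"
  proof (subst openin_subopen, intro ballI)
    fix b assume "b \<in> K"
    then have b: "b \<in> D" "g b = g' b"
      by (auto simp: K_def)
    then obtain W where W: "g b \<in> W" "openin (top_of_set C) W" "inj_on p W"
      using loc g(2) by (meson PiE)
    have "openin (top_of_set D) (D \<inter> g -` W \<inter> (D \<inter> g' -` W))"
      by (intro openin_Int continuous_openin_preimage[OF _ _ W(2)] g g')
    moreover have "b \<in> D \<inter> g -` W \<inter> (D \<inter> g' -` W)"
      using b W by auto
    moreover have "D \<inter> g -` W \<inter> (D \<inter> g' -` W) \<subseteq> K"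
      using W(3) eq by (auto simp: K_def inj_on_def)
    ultimately show "\<exists>T. openin (top_of_set D) T \<and> b \<in> T \<and> T \<subseteq> K"
      by blast
  qed
  ultimately have "K = {} \<or> K = D"
    using D unfolding connected_clopen by blast
  then show ?thesis
    using a y by (auto simp: K_def)
qed

text \<open>
  To embed the total space, record for each point and each sheet how deep inside the
  sheet the point lies, the depth being measured in the base. There may be uncountably many sheets,
  but all these functions are locally 1-Lipschitz along the covering map, with a neighbourhood that
  works for all of them, so together they form a continuous map into a space of bounded functions
  with the supremum norm. The set of indices carries the discrete topology, so that every bounded
  function on it is a \<open>bcontfun\<close>.
\<close>

definition is_sheet :: "'a::topological_space set \<Rightarrow> ('a \<Rightarrow> 'b::topological_space) \<Rightarrow> 'a set \<Rightarrow> bool" where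
  "is_sheet C p W \<longleftrightarrow> openin (top_of_set C) W \<and> open (p ` W) \<and> (\<exists>q. homeomorphism W (p ` W) p q)"

text \<open>Truncation at 1 makes the depth a bounded function of the sheet.\<close>

definition sheet_depth :: "'a::topological_space set \<Rightarrow> ('a \<Rightarrow> 'b::metric_space) \<Rightarrow> 'a \<Rightarrow> 'a set \<Rightarrow> real" where
  "sheet_depth C p x W = (if x \<in> W \<and> is_sheet C p W then min 1 (infdist (p x) (- p ` W)) else 0)"

definition sheet_embedding ::
    "'a::topological_space set \<Rightarrow> ('a \<Rightarrow> 'b::metric_space) \<Rightarrow> 'a \<Rightarrow> 'b \<times> ('a set discrete \<Rightarrow>\<^sub>C real)" where
  "sheet_embedding C p x = (p x, Bcontfun (\<lambda>i. sheet_depth C p x (of_discrete i)))"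

lemma apply_snd_sheet_embedding:
  "apply_bcontfun (snd (sheet_embedding C p x)) i = sheet_depth C p x (of_discrete i)"
proof -
  have "(\<lambda>i. sheet_depth C p x (of_discrete i)) \<in> bcontfun"
  proof -
    have "\<bar>sheet_depth C p x W\<bar> \<le> 1" for W
      using infdist_nonneg[of "p x" "- p ` W"] by (auto simp: sheet_depth_def)
    then have "bounded (range (\<lambda>i. sheet_depth C p x (of_discrete i)))"
      by (auto simp: bounded_iff)
    moreover have "continuous_on UNIV (\<lambda>i. sheet_depth C p x (of_discrete i))"
      by (simp add: continuous_on_open_vimage open_discrete)
    ultimately show ?thesis
      by (simp add: bcontfun_def)
  qed
  then show ?thesis
    by (simp add: sheet_embedding_def Bcontfun_inverse)
qed

lemma small_sheet_exists:
  fixes p :: "'a::topological_space \<Rightarrow> 'b::topological_space"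
  assumes cov: "covering_space C p S" and S: "open S"
    and B: "openin (top_of_set C) B" "x \<in> B"
  obtains W where "is_sheet C p W" "x \<in> W" "W \<subseteq> B"
proof -
  have "x \<in> C"
    using B openin_imp_subset by blast
  then obtain T u q where T: "x \<in> T" "openin (top_of_set C) T" "p x \<in> u" "openin (top_of_set S) u"
    "homeomorphism T u p q"
    using covering_space_local_homeomorphism[OF cov] by metis
  have o: "openin (top_of_set C) (T \<inter> B)"
    using T B by blast
  then have "openin (top_of_set T) (T \<inter> B)"
    by (metis T(2) inf.cobounded1 openin_imp_subset openin_subset_trans)
  then have "openin (top_of_set u) (p ` (T \<inter> B))"
    using T(5) homeomorphism_imp_open_map by blast
  then have "open (p ` (T \<inter> B))"
    using T(4) S by (meson openin_open_eq openin_trans)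
  moreover have "homeomorphism (T \<inter> B) (p ` (T \<inter> B)) p q"
    by (rule homeomorphism_of_subsets[OF T(5)]) (use T(5) in \<open>auto simp: homeomorphism_def\<close>)
  ultimately have "is_sheet C p (T \<inter> B)"
    using o by (auto simp: is_sheet_def)
  then show ?thesis
    using that T(1) B(2) by blast
qed

lemma sheet_depth_pos:
  fixes p :: "'a::topological_space \<Rightarrow> 'b::metric_space"
  assumes "covering_space C p S" "S \<noteq> UNIV" "is_sheet C p W"
  shows "0 < sheet_depth C p x W \<longleftrightarrow> x \<in> W"
proof
  assume "x \<in> W"
  have "W \<subseteq> C"
    using assms(3) openin_imp_subset by (auto simp: is_sheet_def)
  then have "- p ` W \<noteq> {}"
    using assms(1,2) covering_space_imp_surjective by blast
  moreover have "closed (- p ` W)"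
    using assms(3) by (simp add: is_sheet_def closed_def)
  ultimately have "0 < infdist (p x) (- p ` W)"
    using \<open>x \<in> W\<close> infdist_pos_not_in_closed by blast
  then show "0 < sheet_depth C p x W"
    using assms \<open>x \<in> W\<close> by (simp add: sheet_depth_def)
qed (auto simp: sheet_depth_def split: if_splits)

text \<open>
  The only critical case is that of two nearby points \<open>a\<close>, \<open>b\<close> of which only \<open>a\<close> lies in the sheet \<open>W\<close>.
  If \<open>a\<close> were deeper in \<open>W\<close> than the distance of their projections, then the inverse of the covering
  map on \<open>W\<close> and the one on a fixed sheet \<open>W0\<close> around \<open>x\<^sub>0\<close> would both be defined on a convex set
  containing both projections. They agree at the projection of \<open>a\<close>, hence at that of \<open>b\<close>, which puts
  \<open>b\<close> into \<open>W\<close>.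
\<close>

lemma sheet_depth_locally_Lipschitz:
  fixes p :: "'a::topological_space \<Rightarrow> 'b::real_normed_vector"
  assumes cov: "covering_space C p S" and S: "open S" and C: "Hausdorff_space (top_of_set C)"
    and x0: "x\<^sub>0 \<in> C"
  obtains U where "openin (top_of_set C) U" "x\<^sub>0 \<in> U"
    "\<And>x W. x \<in> U \<Longrightarrow> \<bar>sheet_depth C p x W - sheet_depth C p x\<^sub>0 W\<bar> \<le> dist (p x) (p x\<^sub>0)"
proof -
  obtain W0 where W0: "is_sheet C p W0" "x\<^sub>0 \<in> W0" "W0 \<subseteq> C"
    by (rule small_sheet_exists[OF cov S openin_subtopology_self x0])
  then obtain q0 where q0: "homeomorphism W0 (p ` W0) p q0"
    by (auto simp: is_sheet_def)
  obtain \<delta> where \<delta>: "\<delta> > 0" "ball (p x\<^sub>0) \<delta> \<subseteq> p ` W0"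
    using W0 unfolding is_sheet_def by (meson imageI openE)
  define U where "U = W0 \<inter> (C \<inter> p -` ball (p x\<^sub>0) \<delta>)"
  have contp: "continuous_on C p"
    using cov covering_space_imp_continuous by blast
  have oU: "openin (top_of_set C) U"
    unfolding U_def
    by (intro openin_Int continuous_openin_preimage_gen contp) (use W0 in \<open>auto simp: is_sheet_def\<close>)
  have W0C: "W0 \<subseteq> C"
    using W0 openin_imp_subset by (auto simp: is_sheet_def)
  have loc: "\<exists>W. x \<in> W \<and> openin (top_of_set C) W \<and> inj_on p W" if x: "x \<in> C" for x
  proof -
    obtain W where W: "is_sheet C p W" "x \<in> W" "W \<subseteq> C"
      by (rule small_sheet_exists[OF cov S openin_subtopology_self x])
    then obtain q where "homeomorphism W (p ` W) p q"
      by (auto simp: is_sheet_def)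
    then have "inj_on p W"
      by (metis homeomorphism_apply1 inj_on_def)
    then show ?thesis
      using W by (auto simp: is_sheet_def)
  qed
  have key: "b \<in> W" if ab: "a \<in> U" "b \<in> U" and W: "is_sheet C p W" "a \<in> W"
      and d: "dist (p a) (p b) < infdist (p a) (- p ` W)" for a b W
  proof -
    obtain q where q: "homeomorphism W (p ` W) p q"
      using W by (auto simp: is_sheet_def)
    have WC: "W \<subseteq> C"
      using W openin_imp_subset by (auto simp: is_sheet_def)
    define D where "D = ball (p a) (infdist (p a) (- p ` W)) \<inter> ball (p x\<^sub>0) \<delta>"
    have "infdist (p a) (- p ` W) \<le> dist (p a) z" if "z \<notin> p ` W" for z
      using that by (intro infdist_le) auto
    then have DW: "D \<subseteq> p ` W"
      unfolding D_def by force
    have D0: "D \<subseteq> p ` W0"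
      using \<delta> by (auto simp: D_def)
    have pq: "p (q y) = y" "p (q0 y) = y" "q y \<in> W" "q0 y \<in> W0" if "y \<in> D" for y
    proof -
      have "y \<in> p ` W" "y \<in> p ` W0"
        using that DW D0 by auto
      then show "p (q y) = y" "p (q0 y) = y" "q y \<in> W" "q0 y \<in> W0"
        using q q0 by (auto simp: homeomorphism_def)
    qed
    have pa: "p a \<in> D" and pb: "p b \<in> D"
      using ab d zero_le_dist[of "p a" "p b"] by (auto simp: D_def U_def simp del: zero_le_dist)
    have "q (p b) = q0 (p b)"
    proof (rule local_injection_lift_unique[OF C, where p = p and D = D and a = "p a"])
      show "\<exists>W. x \<in> W \<and> openin (top_of_set C) W \<and> inj_on p W" if "x \<in> C" for x
        using loc that .
      show "connected D"
        by (auto simp: D_def intro!: convex_connected convex_Int)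
      show "continuous_on D q" "continuous_on D q0"
        using q q0 DW D0 by (auto simp: homeomorphism_def intro: continuous_on_subset)
      show "q \<in> D \<rightarrow> C" "q0 \<in> D \<rightarrow> C"
        using pq WC W0C by auto
      have "q (p a) = a" "q0 (p a) = a"
        using q q0 W(2) ab by (auto simp: homeomorphism_def U_def)
      then show "q (p a) = q0 (p a)"
        by simp
    qed (use pa pb pq in auto)
    also have "\<dots> = b"
      using q0 ab by (auto simp: homeomorphism_def U_def)
    finally show "b \<in> W"
      using pq(3)[OF pb] by simp
  qed
  have x0U: "x\<^sub>0 \<in> U"
    using W0 x0 \<delta> by (auto simp: U_def)
  have le: "sheet_depth C p a W \<le> sheet_depth C p b W + dist (p a) (p b)" if "a \<in> U" "b \<in> U" for a b W
  proof (cases "is_sheet C p W \<and> a \<in> W")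
    case True
    show ?thesis
    proof (cases "b \<in> W")
      case b: True
      have "infdist (p a) (- p ` W) \<le> infdist (p b) (- p ` W) + dist (p a) (p b)"
        by (rule infdist_triangle)
      then show ?thesis
        using True b zero_le_dist[of "p a" "p b"] unfolding sheet_depth_def min_def
        by (auto simp del: zero_le_dist)
    next
      case False
      then have "infdist (p a) (- p ` W) \<le> dist (p a) (p b)"
        using key[OF that, of W] True by force
      then show ?thesis
        using True False by (auto simp: sheet_depth_def)
    qed
  qed (auto simp: sheet_depth_def infdist_nonneg)
  show ?thesis
  proof
    show "\<bar>sheet_depth C p x W - sheet_depth C p x\<^sub>0 W\<bar> \<le> dist (p x) (p x\<^sub>0)" if "x \<in> U" for x W
      using le[OF that x0U, of W] le[OF x0U that, of W] by (simp add: dist_commute)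
  qed (use oU x0U in auto)
qed

text \<open>
  The positivity sets of the depth functions are the sheets, and small sheets form a basis of the
  topology; this makes the embedding injective and open onto its image.
\<close>

lemma covering_space_embeds_in_normed_space:
  fixes p :: "'a::topological_space \<Rightarrow> 'b::real_normed_vector"
  assumes cov: "covering_space C p S" and S: "open S" "S \<noteq> UNIV"
    and C: "Hausdorff_space (top_of_set C)"
  obtains k where
    "homeomorphism C (sheet_embedding C p ` C) (sheet_embedding C p) k"
proof -
  let ?\<Phi> = "sheet_embedding C p"
  have contp: "continuous_on C p"
    using cov covering_space_imp_continuous by blast
  have cont2: "continuous_on C (\<lambda>x. snd (?\<Phi> x))"
    unfolding continuous_on_def
  proof (intro ballI tendstoI)
    fix x0 and e :: real assume x0: "x0 \<in> C" and e: "0 < e"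
    obtain U where U: "openin (top_of_set C) U" "x0 \<in> U"
      "\<And>x W. x \<in> U \<Longrightarrow> \<bar>sheet_depth C p x W - sheet_depth C p x0 W\<bar> \<le> dist (p x) (p x0)"
      using sheet_depth_locally_Lipschitz[OF cov S(1) C x0] by metis
    obtain U' where U': "open U'" "U = C \<inter> U'"
      using U(1) by (auto simp: openin_open)
    have "eventually (\<lambda>x. dist (p x) (p x0) < e) (at x0 within C)"
      using contp x0 e by (auto simp: continuous_on_def dest!: tendstoD)
    moreover have "eventually (\<lambda>x. x \<in> U' \<and> x \<in> C) (at x0 within C)"
      using U U' by (auto simp: eventually_at_topological)
    ultimately show "eventually (\<lambda>x. dist (snd (?\<Phi> x)) (snd (?\<Phi> x0)) < e) (at x0 within C)"
    proof eventually_elim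
      case (elim x)
      have "dist (snd (?\<Phi> x)) (snd (?\<Phi> x0)) \<le> dist (p x) (p x0)"
        by (rule dist_bound) (use U(3) U' elim in \<open>auto simp: apply_snd_sheet_embedding dist_real_def\<close>)
      then show ?case
        using elim by simp
    qed
  qed
  have "?\<Phi> = (\<lambda>x. (p x, snd (?\<Phi> x)))"
    by (auto simp: sheet_embedding_def)
  then have cont: "continuous_on C ?\<Phi>"
    using continuous_on_Pair[OF contp cont2] by metis
  have snd_iff: "x' \<in> W" if "is_sheet C p W" "x \<in> W" "?\<Phi> x = ?\<Phi> x'" for W x x'
    using sheet_depth_pos[OF cov S(2) that(1)] that apply_snd_sheet_embedding
    by (metis discrete_inverse UNIV_I)
  have inj: "inj_on ?\<Phi> C"
  proof (rule inj_onI)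
    fix x x' assume x: "x \<in> C" "x' \<in> C" "?\<Phi> x = ?\<Phi> x'"
    obtain W where W: "is_sheet C p W" "x \<in> W" "W \<subseteq> C"
      by (rule small_sheet_exists[OF cov S(1) openin_subtopology_self x(1)])
    then have "x' \<in> W" "p x = p x'"
      using snd_iff x by (auto simp: sheet_embedding_def)
    then show "x = x'"
      using W unfolding is_sheet_def homeomorphism_def by metis
  qed
  have "openin (top_of_set (?\<Phi> ` C)) (?\<Phi> ` B)" if B: "openin (top_of_set C) B" for B
  proof (subst openin_subopen, intro ballI)
    fix z assume "z \<in> ?\<Phi> ` B"
    then obtain x where x: "x \<in> B" "z = ?\<Phi> x"
      by blast
    obtain W where W: "is_sheet C p W" "x \<in> W" "W \<subseteq> B"
      using small_sheet_exists[OF cov S(1) B x(1)] by blast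

    let ?O = "{z :: 'b \<times> ('a set discrete \<Rightarrow>\<^sub>C real). 0 < apply_bcontfun (snd z) (discrete W)}"
    have c: "continuous_on UNIV (\<lambda>g :: 'a set discrete \<Rightarrow>\<^sub>C real. apply_bcontfun g (discrete W))"
      unfolding continuous_on_iff by (meson dist_fun_lt_imp_dist_val_lt)
    have "continuous_on UNIV (\<lambda>z :: 'b \<times> ('a set discrete \<Rightarrow>\<^sub>C real). apply_bcontfun (snd z) (discrete W))"
      by (rule continuous_on_compose2[OF c]) (auto intro: continuous_intros)
    then have "open ?O"
      by (intro open_Collect_less) (auto intro: continuous_intros)
    moreover have "?\<Phi> y \<in> ?O \<longleftrightarrow> y \<in> W" for y
      using sheet_depth_pos[OF cov S(2) W(1)] by (simp add: apply_snd_sheet_embedding discrete_inverse)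
    ultimately have "openin (top_of_set (?\<Phi> ` C)) (?\<Phi> ` C \<inter> ?O)" "z \<in> ?\<Phi> ` C \<inter> ?O"
      "?\<Phi> ` C \<inter> ?O \<subseteq> ?\<Phi> ` B"
      using W x openin_imp_subset[OF B] by auto
    then show "\<exists>T. openin (top_of_set (?\<Phi> ` C)) T \<and> z \<in> T \<and> T \<subseteq> ?\<Phi> ` B"
      by blast
  qed
  then show ?thesis
    using homeomorphism_injective_open_map[OF cont refl inj] that by blast
qed

theorem covering_space_section:
  fixes p :: "'a::topological_space \<Rightarrow> 'b::real_normed_vector"
  assumes cov: "covering_space C p S" and S: "open S" "S \<noteq> UNIV" "simply_connected S"
    and C: "Hausdorff_space (top_of_set C)"
  obtains g where "continuous_on S g" "g \<in> S \<rightarrow> C" "\<And>y. y \<in> S \<Longrightarrow> p (g y) = y"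
proof -
  let ?C = "sheet_embedding C p ` C"
  obtain k where k: "homeomorphism C ?C (sheet_embedding C p) k"
    using covering_space_embeds_in_normed_space[OF cov S(1,2) C] by blast
  obtain g where g: "continuous_on S g" "g \<in> S \<rightarrow> ?C" "\<And>y. y \<in> S \<Longrightarrow> (p \<circ> k) (g y) = id y"
    using covering_space_lift[OF covering_space_homeomorphic_total[OF cov k] S(3), of id]
      open_imp_locally_path_connected[OF S(1)] by (metis continuous_on_id' eq_id_iff id_apply Pi_I)
  show ?thesis
  proof
    have "continuous_on (g ` S) k"
      using k g(2) by (auto simp: homeomorphism_def intro: continuous_on_subset)
    then show "continuous_on S (k \<circ> g)"
      using g(1) continuous_on_compose by blast
    have kC: "k ` ?C = C"
      using k by (simp add: homeomorphism_def)
    show "k \<circ> g \<in> S \<rightarrow> C"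
    proof
      fix y assume "y \<in> S"
      then have "k (g y) \<in> k ` ?C"
        by (intro imageI funcset_mem[OF g(2)])
      then show "(k \<circ> g) y \<in> C"
        unfolding kC by simp
    qed
  qed (use g(3) in auto)
qed

section \<open>The metric in the global chart\<close>

lemma schw_radius_pos: "\<mu> > 0 \<Longrightarrow> schw_radius m \<mu> > 0"
  by (simp add: schw_radius_def)

lemma schw_V_bounds:
  assumes "\<mu> > 0" "m \<ge> 3" "schw_radius m \<mu> < r"
  shows "0 < schw_V m \<mu> r" "schw_V m \<mu> r < 1"
proof -
  have r: "r > 0"
    using assms schw_radius_pos[of \<mu> m] by linarith
  have m: "real m - 2 > 0"
    using assms by simp
  have "2 * \<mu> = schw_radius m \<mu> powr (real m - 2)"
    using m assms by (simp add: schw_radius_def powr_powr)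
  also have "\<dots> < r powr (real m - 2)"
    using assms m schw_radius_pos[of \<mu> m] by (intro powr_less_mono2) auto
  finally have "2 * \<mu> * r powr (2 - real m) < r powr (real m - 2) * r powr (2 - real m)"
    using r by (intro mult_strict_right_mono) auto
  also have "\<dots> = 1"
    using r by (simp flip: powr_add)
  finally show "0 < schw_V m \<mu> r"
    by (simp add: schw_V_def)
  show "schw_V m \<mu> r < 1"
    using r assms by (simp add: schw_V_def)
qed

definition schw_V' :: "nat \<Rightarrow> real \<Rightarrow> real \<Rightarrow> real" where
  "schw_V' m \<mu> r = - 2 * \<mu> * ((2 - real m) * r powr (1 - real m))"

lemma schw_V_has_derivative:
  assumes "r > 0"
  shows "(schw_V m \<mu> has_real_derivative schw_V' m \<mu> r) (at r)"
proof -
  have e: "2 - real m - 1 = 1 - real m"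
    by simp
  have "((\<lambda>r. 1 - 2 * \<mu> * r powr (2 - real m)) has_real_derivative
      (0 - 2 * \<mu> * ((2 - real m) * r powr (2 - real m - 1)))) (at r)"
    by (intro DERIV_diff DERIV_const DERIV_cmult has_real_derivative_powr assms)
  then show ?thesis
    unfolding e by (simp add: schw_V_def[abs_def] schw_V'_def)
qed

text \<open>
  In the chart the metric is the flat Riemannian metric corrected in the radial direction, minus
  \<open>V dt\<^sup>2\<close>. The correction is \<open>schw_A\<close> times the square of the form \<open>r dr\<close>, which is
  easier to differentiate than \<open>dr\<close> because its coefficients are linear in the position vector.
\<close>

definition schw_A :: "nat \<Rightarrow> real \<Rightarrow> real \<Rightarrow> real" where
  "schw_A m \<mu> r = (1 / schw_V m \<mu> r - 1) / r\<^sup>2"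

definition schw_A' :: "nat \<Rightarrow> real \<Rightarrow> real \<Rightarrow> real" where
  "schw_A' m \<mu> r = - schw_V' m \<mu> r / ((schw_V m \<mu> r)\<^sup>2 * r\<^sup>2) - 2 * schw_A m \<mu> r / r"

lemma schw_A_has_derivative:
  assumes "r > 0" "schw_V m \<mu> r \<noteq> 0"
  shows "(schw_A m \<mu> has_real_derivative schw_A' m \<mu> r) (at r)"
proof -
  have "((\<lambda>r. (inverse (schw_V m \<mu> r) - 1) / r ^ 2) has_real_derivative
      ((- (inverse (schw_V m \<mu> r) * schw_V' m \<mu> r * inverse (schw_V m \<mu> r)) - 0) * r ^ 2
        - (inverse (schw_V m \<mu> r) - 1) * (real 2 * r ^ (2 - Suc 0))) / (r ^ 2 * r ^ 2)) (at r)"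
    by (intro DERIV_divide DERIV_diff DERIV_const DERIV_inverse' schw_V_has_derivative DERIV_pow)
      (use assms in auto)
  also have "((- (inverse (schw_V m \<mu> r) * schw_V' m \<mu> r * inverse (schw_V m \<mu> r)) - 0) * r ^ 2
        - (inverse (schw_V m \<mu> r) - 1) * (real 2 * r ^ (2 - Suc 0))) / (r ^ 2 * r ^ 2) = schw_A' m \<mu> r"
    using assms by (simp add: schw_A'_def schw_A_def field_simps power2_eq_square)
  finally show ?thesis
    by (simp add: schw_A_def[abs_def] inverse_eq_divide)
qed

lemma norm_along_has_derivative:
  fixes f :: "'d::real_normed_vector \<Rightarrow> 'e::real_inner"
  assumes f: "(f has_derivative f') (at z)" and "f z \<noteq> 0"
  shows "((\<lambda>z. norm (f z)) has_derivative (\<lambda>h. (f z \<bullet> f' h) / norm (f z))) (at z)"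
  using has_derivative_compose[OF f has_derivative_norm[OF assms(2)]]
  by (simp add: sgn_div_norm inner_commute divide_inverse mult.commute)

lemma schw_param_has_derivative:
  fixes q :: "'e::euclidean_space \<times> real"
  assumes y0: "fst q \<noteq> 0"
  shows "(schw_param has_derivative
      (\<lambda>h. (((fst q \<bullet> fst h) / norm (fst q),
            fst h /\<^sub>R norm (fst q) - ((fst q \<bullet> fst h) / norm (fst q) ^ 3) *\<^sub>R fst q), snd h))) (at q)"
proof -
  let ?r = "norm (fst q)" and ?y = "fst q"
  have fst1: "(fst has_derivative fst) (at q)"
    by (rule has_derivative_fst[OF has_derivative_ident])
  have nrm: "((\<lambda>q. norm (fst q)) has_derivative (\<lambda>h. (?y \<bullet> fst h) / ?r)) (at q)"
    by (rule norm_along_has_derivative[OF fst1 y0])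
  have inv: "((\<lambda>q. inverse (norm (fst q))) has_derivative
      (\<lambda>h. - (inverse ?r * ((?y \<bullet> fst h) / ?r) * inverse ?r))) (at q)"
    by (rule has_derivative_compose[OF nrm has_derivative_inverse']) (use assms in simp)
  have "(schw_param has_derivative (\<lambda>h. (((?y \<bullet> fst h) / ?r,
      inverse ?r *\<^sub>R fst h + (- (inverse ?r * ((?y \<bullet> fst h) / ?r) * inverse ?r)) *\<^sub>R ?y), snd h))) (at q)"
    unfolding schw_param_def[abs_def]
    by (intro has_derivative_Pair nrm has_derivative_scaleR inv fst1 has_derivative_snd has_derivative_ident)
  moreover have "- (inverse ?r * (x / ?r) * inverse ?r) = - (x / ?r ^ 3)" for x
    by (simp add: field_simps power3_eq_cube)
  ultimately show ?thesis
    by simp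
qed

lemma schw_metric_coord_eq:
  fixes q u v :: "'e::euclidean_space \<times> real"
  assumes "\<mu> > 0" "DIM('e) \<ge> 3" "schw_radius DIM('e) \<mu> < norm (fst q)"
  shows "schw_metric_coord \<mu> q u v =
    fst u \<bullet> fst v + schw_A DIM('e) \<mu> (norm (fst q)) * (fst q \<bullet> fst u) * (fst q \<bullet> fst v)
    - schw_V DIM('e) \<mu> (norm (fst q)) * (snd u * snd v)"
proof -
  let ?r = "norm (fst q)" and ?y = "fst q"
  have r: "?r > 0"
    using assms schw_radius_pos[of \<mu> "DIM('e)"] by linarith
  then have y0: "?y \<noteq> 0"
    by auto
  note V = schw_V_bounds[OF assms]
  note der = schw_param_has_derivative[OF y0]
  have fd: "frechet_derivative schw_param (at q) h =
      (((?y \<bullet> fst h) / ?r, fst h /\<^sub>R ?r - ((?y \<bullet> fst h) / ?r ^ 3) *\<^sub>R ?y), snd h)" for h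
    by (subst frechet_derivative_at[OF der, symmetric]) (rule refl)
  have sq: "?y \<bullet> ?y = ?r\<^sup>2"
    by (simp add: dot_square_norm)
  have inn: "(c *\<^sub>R a - s *\<^sub>R ?y) \<bullet> (c *\<^sub>R b - t *\<^sub>R ?y)
      = c * c * (a \<bullet> b) - c * t * (?y \<bullet> a) - s * c * (?y \<bullet> b) + s * t * ?r\<^sup>2" for a b c s t
    by (simp add: inner_diff_left inner_diff_right sq inner_commute algebra_simps)
  have alg: "n\<^sup>2 * (inverse n * inverse n * ab - inverse n * (t / n ^ 3) * s - s / n ^ 3 * inverse n * t
      + s / n ^ 3 * (t / n ^ 3) * n\<^sup>2) = ab - s * t / n\<^sup>2" if "n > 0" for n ab s t :: real
  proof -
    have e: "n * inverse n = 1"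
      using that by simp
    have "n\<^sup>2 * (i * i * ab - i * (t * i ^ 3) * s - s * i ^ 3 * i * t + s * i ^ 3 * (t * i ^ 3) * n\<^sup>2)
        = (n * i)\<^sup>2 * ab - 2 * ((n * i)\<^sup>2 * i\<^sup>2 * (s * t)) + (n * i) ^ 4 * i\<^sup>2 * (s * t)" for i
      by (simp add: algebra_simps power2_eq_square power3_eq_cube power4_eq_xxxx)
    from this[of "inverse n"]
    have "n\<^sup>2 * (inverse n * inverse n * ab - inverse n * (t * inverse n ^ 3) * s - s * inverse n ^ 3 * inverse n * t
      + s * inverse n ^ 3 * (t * inverse n ^ 3) * n\<^sup>2) = ab - s * t * (inverse n)\<^sup>2"
      unfolding e by simp
    then show ?thesis
      by (simp add: divide_inverse power_inverse)
  qed
  have sphere: "?r\<^sup>2 * ((fst u /\<^sub>R ?r - ((?y \<bullet> fst u) / ?r ^ 3) *\<^sub>R ?y) \<bullet> (fst v /\<^sub>R ?r - ((?y \<bullet> fst v) / ?r ^ 3) *\<^sub>R ?y))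
      = fst u \<bullet> fst v - (?y \<bullet> fst u) * (?y \<bullet> fst v) / ?r\<^sup>2"
    unfolding inn by (rule alg[OF r])
  have h2: "(schw_h DIM('e) \<mu> ?r)\<^sup>2 = schw_V DIM('e) \<mu> ?r"
    using V by (simp add: schw_h_def)
  have alg2: "s / n * (t / n) / V + (ab - s * t / n\<^sup>2) - V * w = ab + (1 / V - 1) / n\<^sup>2 * s * t - V * w"
    if "n > 0" "V > 0" for n V s t ab w :: real
    using that by (simp add: field_simps power2_eq_square)
  show ?thesis
    unfolding schw_metric_coord_def schw_metric_def schw_base_metric_def fd schw_param_def fst_conv snd_conv
      sphere h2 schw_A_def by (rule alg2[OF r V(1)])
qed

text \<open>The derivative of the metric coefficients \<open>G r u v\<close> at \<open>r = q\<close> in the direction \<open>h\<close>.\<close>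

definition dmetric :: "real \<Rightarrow> 'e::euclidean_space \<times> real \<Rightarrow> 'e \<times> real \<Rightarrow> 'e \<times> real \<Rightarrow> 'e \<times> real \<Rightarrow> real" where
  "dmetric \<mu> q h u v =
     (let m = DIM('e); y = fst q; r = norm y in
       schw_A' m \<mu> r * ((y \<bullet> fst h) / r) * (y \<bullet> fst u) * (y \<bullet> fst v)
       + schw_A m \<mu> r * ((fst h \<bullet> fst u) * (y \<bullet> fst v) + (y \<bullet> fst u) * (fst h \<bullet> fst v))
       - schw_V' m \<mu> r * ((y \<bullet> fst h) / r) * (snd u * snd v))"

lemma metric_along_has_derivative:
  fixes f X Y :: "'d::real_normed_vector \<Rightarrow> 'e::euclidean_space \<times> real"
  assumes "\<mu> > 0" "DIM('e) \<ge> 3" "schw_radius DIM('e) \<mu> < norm (fst (f z))"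
    and f: "(f has_derivative f') (at z)"
    and X: "(X has_derivative X') (at z)" and Y: "(Y has_derivative Y') (at z)"
  shows "((\<lambda>z. schw_metric_coord \<mu> (f z) (X z) (Y z)) has_derivative
     (\<lambda>h. dmetric \<mu> (f z) (f' h) (X z) (Y z) + schw_metric_coord \<mu> (f z) (X' h) (Y z)
          + schw_metric_coord \<mu> (f z) (X z) (Y' h))) (at z)"
proof -
  let ?m = "DIM('e)"
  let ?r = "norm (fst (f z))"
  have r: "?r > 0"
    using assms schw_radius_pos[of \<mu> ?m] by linarith
  then have y0: "fst (f z) \<noteq> 0"
    by auto
  note V = schw_V_bounds[OF assms(1-3)]
  have f1: "((\<lambda>z. fst (f z)) has_derivative (\<lambda>h. fst (f' h))) (at z)"
    using f by (rule has_derivative_fst)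
  note XY = has_derivative_fst[OF X] has_derivative_fst[OF Y] has_derivative_snd[OF X] has_derivative_snd[OF Y]
  have nrm: "((\<lambda>z. norm (fst (f z))) has_derivative (\<lambda>h. (fst (f z) \<bullet> fst (f' h)) / ?r)) (at z)"
    by (rule norm_along_has_derivative[OF f1 y0])
  have dA: "((\<lambda>z. schw_A ?m \<mu> (norm (fst (f z)))) has_derivative
      (\<lambda>h. schw_A' ?m \<mu> ?r * ((fst (f z) \<bullet> fst (f' h)) / ?r))) (at z)"
    using has_derivative_compose[OF nrm schw_A_has_derivative[OF r, of ?m \<mu>, unfolded has_field_derivative_def]] V
    by simp
  have dV: "((\<lambda>z. schw_V ?m \<mu> (norm (fst (f z)))) has_derivative
      (\<lambda>h. schw_V' ?m \<mu> ?r * ((fst (f z) \<bullet> fst (f' h)) / ?r))) (at z)"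
    using has_derivative_compose[OF nrm schw_V_has_derivative[OF r, of ?m \<mu>, unfolded has_field_derivative_def]]
    by simp
  have ev: "eventually (\<lambda>z. schw_radius ?m \<mu> < norm (fst (f z))) (at z)"
  proof -
    have "((\<lambda>z. norm (fst (f z))) \<longlongrightarrow> norm (fst (f z))) (at z)"
      using has_derivative_continuous[OF nrm] by (simp add: continuous_within)
    then show ?thesis
      using assms(3) order_tendstoD(1) by blast
  qed
  have "((\<lambda>z. fst (X z) \<bullet> fst (Y z)
      + schw_A ?m \<mu> (norm (fst (f z))) * (fst (f z) \<bullet> fst (X z)) * (fst (f z) \<bullet> fst (Y z))
      - schw_V ?m \<mu> (norm (fst (f z))) * (snd (X z) * snd (Y z))) has_derivative
     (\<lambda>h. dmetric \<mu> (f z) (f' h) (X z) (Y z) + schw_metric_coord \<mu> (f z) (X' h) (Y z)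
          + schw_metric_coord \<mu> (f z) (X z) (Y' h))) (at z)"
    by (rule has_derivative_eq_rhs, rule has_derivative_diff[OF has_derivative_add[OF
          has_derivative_inner[OF XY(1,2)] has_derivative_mult[OF has_derivative_mult[OF dA
          has_derivative_inner[OF f1 XY(1)]] has_derivative_inner[OF f1 XY(2)]]]
          has_derivative_mult[OF dV has_derivative_mult[OF XY(3,4)]]])
      (simp add: fun_eq_iff schw_metric_coord_eq[OF assms(1-3)] dmetric_def Let_def algebra_simps)
  then show ?thesis
    by (rule has_derivative_transform_eventually)
      (use ev in \<open>auto simp: schw_metric_coord_eq assms(1-3) elim!: eventually_mono\<close>)
qed

lemma metric_linear:
  fixes q :: "'e::euclidean_space \<times> real"
  assumes "\<mu> > 0" "DIM('e) \<ge> 3" "schw_radius DIM('e) \<mu> < norm (fst q)"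
  shows "linear (schw_metric_coord \<mu> q u)" "linear (\<lambda>u. schw_metric_coord \<mu> q u v)"
  by (intro linearI; simp add: schw_metric_coord_eq[OF assms] algebra_simps)+

text \<open>Nondegeneracy, in the form of the Riesz representation needed by the Koszul formula.\<close>

lemma metric_represents_linear_functional:
  fixes q :: "'e::euclidean_space \<times> real"
  assumes "\<mu> > 0" "DIM('e) \<ge> 3" "schw_radius DIM('e) \<mu> < norm (fst q)"
    and L: "linear L"
  shows "\<exists>!w. \<forall>z. schw_metric_coord \<mu> q w z = L z"
proof -
  let ?y = "fst q" and ?r = "norm (fst q)" and ?m = "DIM('e)"
  have r: "?r > 0"
    using assms schw_radius_pos[of \<mu> ?m] by linarith
  note V = schw_V_bounds[OF assms(1-3)]
  define T where "T w = (fst w + (schw_A ?m \<mu> ?r * (?y \<bullet> fst w)) *\<^sub>R ?y, - schw_V ?m \<mu> ?r * snd w)" for w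
  have GT: "schw_metric_coord \<mu> q w z = T w \<bullet> z" for w z
    by (simp add: schw_metric_coord_eq[OF assms(1-3)] T_def inner_prod_def algebra_simps)
  have linT: "linear T"
    unfolding T_def by (intro linearI) (auto simp: algebra_simps)
  have "w = 0" if "T w = 0" for w
  proof -
    have w2: "snd w = 0" and e: "fst w + (schw_A ?m \<mu> ?r * (?y \<bullet> fst w)) *\<^sub>R ?y = 0"
      using that V by (auto simp: T_def prod_eq_iff)
    have "?y \<bullet> (fst w + (schw_A ?m \<mu> ?r * (?y \<bullet> fst w)) *\<^sub>R ?y) = (?y \<bullet> fst w) * (1 + schw_A ?m \<mu> ?r * ?r\<^sup>2)"
      by (simp add: inner_add_right dot_square_norm algebra_simps)
    also have "1 + schw_A ?m \<mu> ?r * ?r\<^sup>2 = 1 / schw_V ?m \<mu> ?r"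
      using r by (simp add: schw_A_def)
    finally have "?y \<bullet> fst w = 0"
      using e V by simp
    then show "w = 0"
      using e w2 by (simp add: prod_eq_iff)
  qed
  then have inj: "inj T"
    using linT linear_injective_0 by blast
  then have "surj T"
    using linT linear_injective_imp_surjective by blast
  obtain l where l: "\<And>z. L z = l \<bullet> z"
    using L by (metis adjoint_works inner_commute inner_real_def mult.right_neutral)
  obtain w where w: "T w = l"
    using \<open>surj T\<close> by (metis surjD)
  show ?thesis
  proof (rule ex1I[of _ w])
    show "\<forall>z. schw_metric_coord \<mu> q w z = L z"
      by (simp add: GT w l)
    fix w' assume "\<forall>z. schw_metric_coord \<mu> q w' z = L z"
    then have "\<forall>z. T w' \<bullet> z = T w \<bullet> z"
      unfolding GT w l .
    then have "T w' = T w"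
      by (rule vector_eq_rdot[THEN iffD1])
    then show "w' = w"
      using inj by (simp add: inj_eq)
  qed
qed

lemma frechet_derivative_metric:
  fixes q :: "'e::euclidean_space \<times> real"
  assumes "\<mu> > 0" "DIM('e) \<ge> 3" "schw_radius DIM('e) \<mu> < norm (fst q)"
  shows "frechet_derivative (\<lambda>r. schw_metric_coord \<mu> r u v) (at q) h = dmetric \<mu> q h u v"
proof -
  have z: "schw_metric_coord \<mu> q 0 w = 0" "schw_metric_coord \<mu> q w 0 = 0" for w
    using metric_linear[OF assms] linear_0 by blast+
  have "((\<lambda>r. schw_metric_coord \<mu> r u v) has_derivative (\<lambda>h. dmetric \<mu> q h u v)) (at q)"
    using metric_along_has_derivative[OF assms has_derivative_ident has_derivative_const has_derivative_const, of u v]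
    by (simp add: z)
  then show ?thesis
    using frechet_derivative_at by metis
qed

text \<open>
  Only scalar products with the Christoffel symbols are ever needed, so the defining Koszul formula
  suffices and no symbol is computed.
\<close>

lemma metric_christoffel:
  fixes q :: "'e::euclidean_space \<times> real"
  assumes "\<mu> > 0" "DIM('e) \<ge> 3" "schw_radius DIM('e) \<mu> < norm (fst q)"
  shows "2 * schw_metric_coord \<mu> q (christoffel (schw_metric_coord \<mu>) q u v) z =
    dmetric \<mu> q u v z + dmetric \<mu> q v u z - dmetric \<mu> q z u v"
proof -
  define L where "L z = (dmetric \<mu> q u v z + dmetric \<mu> q v u z - dmetric \<mu> q z u v) / 2" for z
  have "linear L"
    unfolding L_def dmetric_def Let_def by (intro linearI) (simp_all add: algebra_simps add_divide_distrib diff_divide_distrib)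
  then have "\<exists>!w. \<forall>z. schw_metric_coord \<mu> q w z = L z"
    by (rule metric_represents_linear_functional[OF assms])
  then have "\<exists>!w. \<forall>z. 2 * schw_metric_coord \<mu> q w z =
    dmetric \<mu> q u v z + dmetric \<mu> q v u z - dmetric \<mu> q z u v"
    by (simp add: L_def field_simps)
  from theI'[OF this] show ?thesis
    unfolding christoffel_def frechet_derivative_metric[OF assms] by blast
qed

section \<open>The unit normal of a spacelike hypersurface\<close>

text \<open>
  At a common zero, the product rule needs differentiability of one factor and only continuity of
  the other.
\<close>

lemma has_derivative_vanishing_product:
  fixes q D :: "'d::real_normed_vector \<Rightarrow> 'e::real_inner"
  assumes q: "(q \<longlongrightarrow> 0) (at z\<^sub>0)" and D: "D differentiable at z\<^sub>0" "D z\<^sub>0 = 0"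
  shows "((\<lambda>z. q z \<bullet> D z) has_derivative (\<lambda>_. 0)) (at z\<^sub>0)"
proof -
  obtain D' where D': "(D has_derivative D') (at z\<^sub>0)"
    using D(1) by (auto simp: differentiable_def)
  then have bl: "bounded_linear D'"
    and lim: "((\<lambda>z. norm (D z - D z\<^sub>0 - D' (z - z\<^sub>0)) / norm (z - z\<^sub>0)) \<longlongrightarrow> 0) (at z\<^sub>0)"
    by (auto simp: has_derivative_iff_norm)
  obtain K where K: "\<And>h. norm (D' h) \<le> norm h * K"
    using bounded_linear.bounded[OF bl] by blast
  have "eventually (\<lambda>z. norm (D z - D z\<^sub>0 - D' (z - z\<^sub>0)) / norm (z - z\<^sub>0) < 1) (at z\<^sub>0)"
    using lim by (rule order_tendstoD(2)) simp
  then have ev: "eventually (\<lambda>z. norm (q z \<bullet> D z) / norm (z - z\<^sub>0) \<le> norm (q z) * (1 + K)) (at z\<^sub>0)"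
    using eventually_at_ball'[OF zero_less_one, of z\<^sub>0 UNIV]
  proof eventually_elim
    case (elim z)
    then have pos: "norm (z - z\<^sub>0) > 0"
      by auto
    then have "norm (D z - D' (z - z\<^sub>0)) \<le> norm (z - z\<^sub>0)"
      using elim D(2) by (simp add: divide_simps)
    then have "norm (D z) \<le> norm (z - z\<^sub>0) * (1 + K)"
      using K[of "z - z\<^sub>0"] norm_triangle_sub[of "D z" "D' (z - z\<^sub>0)"] by (simp add: algebra_simps)
    then have "norm (q z) * norm (D z) \<le> norm (q z) * (norm (z - z\<^sub>0) * (1 + K))"
      by (rule mult_left_mono) simp
    then have "norm (q z \<bullet> D z) \<le> norm (q z) * (1 + K) * norm (z - z\<^sub>0)"
      using Cauchy_Schwarz_ineq2[of "q z" "D z"] by (simp add: mult_ac)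
    then show ?case
      using pos by (simp add: divide_simps)
  qed
  have lim0: "((\<lambda>z. norm (q z) * (1 + K)) \<longlongrightarrow> 0) (at z\<^sub>0)"
    using tendsto_mult_right[OF tendsto_norm[OF q], of "1 + K"] by simp
  have "((\<lambda>z. norm (q z \<bullet> D z) / norm (z - z\<^sub>0)) \<longlongrightarrow> 0) (at z\<^sub>0)"
    by (rule tendsto_sandwich[OF _ ev tendsto_const lim0]) simp
  then show ?thesis
    by (simp add: has_derivative_iff_norm D(2))
qed

text \<open>
  The solution \<open>p\<close> of a linear system inherits differentiability from the coefficients. Tested against
  preimages of basis vectors under \<open>A z\<^sub>0\<close>, the system reads \<open>q \<bullet> b = r b - q \<bullet> D b\<close> for the increment
  \<open>q\<close> of \<open>p\<close>, where \<open>r b\<close> and \<open>D b\<close> are differentiable and vanish at \<open>z\<^sub>0\<close>. This first shows that \<open>q\<close>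
  tends to 0, whereupon the last term has derivative 0.
\<close>

lemma linear_system_solution_differentiable:
  fixes A :: "'d::real_normed_vector \<Rightarrow> 'e::euclidean_space \<Rightarrow> 'e" and p :: "'d \<Rightarrow> 'e"
  assumes lin: "linear (A z\<^sub>0)" "inj (A z\<^sub>0)"
    and dA: "\<And>e. (\<lambda>z. A z e) differentiable at z\<^sub>0"
    and da: "\<And>e. (\<lambda>z. a z e) differentiable at z\<^sub>0"
    and eq: "eventually (\<lambda>z. \<forall>e. p z \<bullet> A z e = a z e) (nhds z\<^sub>0)"
  shows "p differentiable at z\<^sub>0"
proof -
  obtain g where g: "\<And>w. A z\<^sub>0 (g w) = w"
    using linear_injective_imp_surjective[OF lin] by (metis surj_f_inv_f)
  define D where "D b z = A z (g b) - b" for b z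
  define r where "r b z = a z (g b) - p z\<^sub>0 \<bullet> A z (g b)" for b z
  define q where "q z = p z - p z\<^sub>0" for z
  have eq0: "p z\<^sub>0 \<bullet> A z\<^sub>0 e = a z\<^sub>0 e" for e
    using eq by (auto dest: eventually_nhds_x_imp_x)
  have D0: "D b z\<^sub>0 = 0" and r0: "r b z\<^sub>0 = 0" for b
    by (simp_all add: D_def r_def g eq0[symmetric])
  have dD: "D b differentiable at z\<^sub>0" and dr: "r b differentiable at z\<^sub>0" for b
    unfolding D_def[abs_def] r_def[abs_def]
    by (intro differentiable_diff differentiable_const dA da differentiable_inner)+
  have contD: "(D b \<longlongrightarrow> 0) (at z\<^sub>0)" and contr: "(r b \<longlongrightarrow> 0) (at z\<^sub>0)" for b
    using differentiable_imp_continuous_within[OF dD[of b]] differentiable_imp_continuous_within[OF dr[of b]]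
    by (simp_all add: continuous_within D0 r0)
  have qb: "eventually (\<lambda>z. \<forall>b. q z \<bullet> b = r b z - q z \<bullet> D b z) (nhds z\<^sub>0)"
    using eq
  proof eventually_elim
    case (elim z)
    then have "r b z = q z \<bullet> A z (g b)" for b
      by (simp add: r_def q_def inner_diff_left)
    then show ?case
      by (simp add: D_def inner_diff_right)
  qed
  have q_lim: "(q \<longlongrightarrow> 0) (at z\<^sub>0)"
  proof (rule Lim_null_comparison)
    have "((\<lambda>z. \<Sum>b\<in>Basis. norm (D b z)) \<longlongrightarrow> (\<Sum>b\<in>(Basis :: 'e set). 0)) (at z\<^sub>0)"
      by (intro tendsto_sum tendsto_norm_zero contD)
    then have "eventually (\<lambda>z. (\<Sum>b\<in>Basis. norm (D b z)) < 1/2) (at z\<^sub>0)"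
      by (rule order_tendstoD(2)) simp
    moreover have "eventually (\<lambda>z. \<forall>b. q z \<bullet> b = r b z - q z \<bullet> D b z) (at z\<^sub>0)"
      using qb by (simp add: eventually_nhds_conv_at)
    ultimately show "eventually (\<lambda>z. norm (q z) \<le> 2 * (\<Sum>b\<in>Basis. norm (r b z))) (at z\<^sub>0)"
    proof eventually_elim
      case (elim z)
      have "norm (q z) \<le> (\<Sum>b\<in>Basis. \<bar>q z \<bullet> b\<bar>)"
        by (rule norm_le_l1)
      also have "\<dots> \<le> (\<Sum>b\<in>Basis. norm (r b z) + norm (q z) * norm (D b z))"
      proof (rule sum_mono)
        fix b :: 'e
        have "q z \<bullet> b = r b z - q z \<bullet> D b z"
          using elim by blast
        then have "\<bar>q z \<bullet> b\<bar> \<le> \<bar>r b z\<bar> + \<bar>q z \<bullet> D b z\<bar>"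
          by simp
        then show "\<bar>q z \<bullet> b\<bar> \<le> norm (r b z) + norm (q z) * norm (D b z)"
          using Cauchy_Schwarz_ineq2[of "q z" "D b z"] by simp
      qed
      also have "\<dots> = (\<Sum>b\<in>Basis. norm (r b z)) + norm (q z) * (\<Sum>b\<in>Basis. norm (D b z))"
        by (simp add: sum.distrib sum_distrib_left)
      also have "\<dots> \<le> (\<Sum>b\<in>Basis. norm (r b z)) + norm (q z) * (1/2)"
        using elim by (intro add_left_mono mult_left_mono) auto
      finally show ?case
        by simp
    qed
    have "((\<lambda>z. 2 * (\<Sum>b\<in>Basis. norm (r b z))) \<longlongrightarrow> 2 * (\<Sum>b\<in>(Basis :: 'e set). 0)) (at z\<^sub>0)"
      by (intro tendsto_mult_left tendsto_sum tendsto_norm_zero contr)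
    then show "((\<lambda>z. 2 * (\<Sum>b\<in>(Basis :: 'e set). norm (r b z))) \<longlongrightarrow> 0) (at z\<^sub>0)"
      by simp
  qed
  have "(\<lambda>z. q z \<bullet> b) differentiable at z\<^sub>0" for b
  proof -
    have "(\<lambda>z. q z \<bullet> D b z) differentiable at z\<^sub>0"
      by (rule differentiableI[OF has_derivative_vanishing_product[OF q_lim dD D0]])
    then have "(\<lambda>z. r b z - q z \<bullet> D b z) differentiable at z\<^sub>0"
      by (intro differentiable_diff dr)
    then obtain f' where f': "((\<lambda>z. r b z - q z \<bullet> D b z) has_derivative f') (at z\<^sub>0)"
      unfolding differentiable_def by blast
    have "eventually (\<lambda>z. r b z - q z \<bullet> D b z = q z \<bullet> b) (nhds z\<^sub>0)"
      using qb by (rule eventually_mono) (rule sym, erule spec)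
    note e = this[unfolded eventually_nhds_conv_at]
    have "((\<lambda>z. q z \<bullet> b) has_derivative f') (at z\<^sub>0)"
      by (rule has_derivative_transform_eventually[OF f' conjunct1[OF e] conjunct2[OF e] UNIV_I])
    then show ?thesis
      by (rule differentiableI)
  qed
  then have "q differentiable at z\<^sub>0"
    by (subst differentiable_componentwise_within) blast
  then have "(\<lambda>z. q z + p z\<^sub>0) differentiable at z\<^sub>0"
    by (intro differentiable_add differentiable_const)
  then show ?thesis
    by (simp add: q_def)
qed

text \<open>A local parametrization, in the global chart, with the regularity that mean curvature involves.\<close>

locale spacelike_patch =
  fixes \<mu> :: real and f :: "'e::euclidean_space \<Rightarrow> 'e \<times> real" and \<Omega> :: "'e set"
  assumes mu: "\<mu> > 0" and dim: "DIM('e) \<ge> 3" and open_dom: "open \<Omega>"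
    and exterior: "\<And>z. z \<in> \<Omega> \<Longrightarrow> schw_radius DIM('e) \<mu> < norm (fst (f z))"
    and differentiable: "\<And>z. z \<in> \<Omega> \<Longrightarrow> f differentiable at z"
    and twice_differentiable:
      "\<And>z e. z \<in> \<Omega> \<Longrightarrow> (\<lambda>z. frechet_derivative f (at z) e) differentiable at z"
    and spacelike: "\<And>z e. z \<in> \<Omega> \<Longrightarrow> e \<noteq> 0 \<Longrightarrow>
      0 < schw_metric_coord \<mu> (f z) (frechet_derivative f (at z) e) (frechet_derivative f (at z) e)"
begin

abbreviation "G \<equiv> schw_metric_coord \<mu>"
abbreviation "D z e \<equiv> frechet_derivative f (at z) e"
abbreviation "r z \<equiv> norm (fst (f z))"
abbreviation "V z \<equiv> schw_V DIM('e) \<mu> (r z)"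

lemma has_derivative_D: "z \<in> \<Omega> \<Longrightarrow> (f has_derivative D z) (at z)"
  using differentiable frechet_derivative_works by blast

lemma linear_D: "z \<in> \<Omega> \<Longrightarrow> linear (D z)"
  using has_derivative_D has_derivative_linear by blast

lemma r_pos: "z \<in> \<Omega> \<Longrightarrow> r z > 0"
  using exterior[of z] schw_radius_pos[OF mu, of "DIM('e)"] by linarith

lemmas V_bounds = schw_V_bounds[OF mu dim exterior]
lemmas G_eq = schw_metric_coord_eq[OF mu dim exterior]

text \<open>
  Spacelike tangent spaces contain no nonzero multiples of \<open>\<partial>\<^sub>t\<close>, so the hypersurface is locally a graph over
  the base; \<open>slope\<close> is the differential of that graph.
\<close>

lemma linear_fst_D: "z \<in> \<Omega> \<Longrightarrow> linear (\<lambda>e. fst (D z e))"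
  using linear_compose[OF linear_D linear_fst] by (simp add: o_def)

lemma inj_fst_D:
  assumes z: "z \<in> \<Omega>"
  shows "inj (\<lambda>e. fst (D z e))"
  unfolding linear_injective_0[OF linear_fst_D[OF z]]
proof (intro allI impI, rule ccontr)
  fix e assume e: "fst (D z e) = 0" "e \<noteq> 0"
  have "0 < G (f z) (D z e) (D z e)"
    using spacelike z e by blast
  also have "\<dots> = - (V z * (snd (D z e))\<^sup>2)"
    using e by (simp add: G_eq[OF z] power2_eq_square)
  also have "\<dots> \<le> 0"
    using V_bounds[OF z] by simp
  finally show False
    by simp
qed

lemma fst_D_surj:
  assumes z: "z \<in> \<Omega>"
  obtains e where "fst (D z e) = w"
  using linear_injective_imp_surjective[OF linear_fst_D[OF z] inj_fst_D[OF z]] by (metis surjD)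

definition slope :: "'e \<Rightarrow> 'e" where
  "slope z = (SOME p. \<forall>e. snd (D z e) = p \<bullet> fst (D z e))"

lemma snd_D:
  assumes z: "z \<in> \<Omega>"
  shows "snd (D z e) = slope z \<bullet> fst (D z e)"
proof -
  obtain g where g: "linear g" "\<And>e. g (fst (D z e)) = e"
    using linear_injective_isomorphism[OF linear_fst_D[OF z] inj_fst_D[OF z]] by metis
  have "linear (\<lambda>w. snd (D z (g w)))"
    using linear_compose[OF linear_compose[OF g(1) linear_D[OF z]] linear_snd] by (simp add: o_def)
  then have "snd (D z (g w)) * 1 = w \<bullet> adjoint (\<lambda>w. snd (D z (g w))) 1" for w
    using adjoint_works[of "\<lambda>w. snd (D z (g w))" w 1] by (metis inner_commute inner_real_def)
  then have "\<forall>e. snd (D z e) = adjoint (\<lambda>w. snd (D z (g w))) 1 \<bullet> fst (D z e)"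
    using g(2) by (metis inner_commute mult.right_neutral)
  then have "\<forall>e. snd (D z e) = slope z \<bullet> fst (D z e)"
    unfolding slope_def by (rule someI)
  then show ?thesis
    by blast
qed

lemma slope_differentiable:
  assumes z: "z \<in> \<Omega>"
  shows "slope differentiable at z"
proof (rule linear_system_solution_differentiable)
  fix e
  obtain D' where D': "((\<lambda>z. D z e) has_derivative D') (at z)"
    using twice_differentiable[OF z, of e] by (auto simp: differentiable_def)
  show "(\<lambda>z. fst (D z e)) differentiable at z" "(\<lambda>z. snd (D z e)) differentiable at z"
    using has_derivative_fst[OF D'] has_derivative_snd[OF D'] by (auto simp: differentiable_def)
next
  show "eventually (\<lambda>z. \<forall>e. slope z \<bullet> fst (D z e) = snd (D z e)) (nhds z)"
    using eventually_nhds_in_open[OF open_dom z] by eventually_elim (simp add: snd_D)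
qed (use linear_fst_D[OF z] inj_fst_D[OF z] in auto)

text \<open>
  \<open>gradient\<close> is the gradient of the graph function with respect to the base metric. The future normal
  is proportional to \<open>h\<^sup>2\<close> times this gradient plus \<open>\<partial>\<^sub>t\<close>; the factor \<open>h\<^sup>2 = V\<close> comes from the
  length of \<open>\<partial>\<^sub>t\<close>.
\<close>

definition gradient :: "'e \<Rightarrow> 'e" where
  "gradient z = slope z - ((1 - V z) * (fst (f z) \<bullet> slope z) / (r z)\<^sup>2) *\<^sub>R fst (f z)"

definition normal_dir :: "'e \<Rightarrow> 'e \<times> real" where
  "normal_dir z = (V z *\<^sub>R gradient z, 1)"

definition normal :: "'e \<Rightarrow> 'e \<times> real" where
  "normal z = (1 / sqrt (V z - (V z)\<^sup>2 * (slope z \<bullet> gradient z))) *\<^sub>R normal_dir z"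

lemma inner_gradient:
  assumes z: "z \<in> \<Omega>"
  shows "fst (f z) \<bullet> gradient z = V z * (fst (f z) \<bullet> slope z)"
  using r_pos[OF z] by (simp add: gradient_def inner_diff_right dot_square_norm) (simp add: algebra_simps)

lemma base_metric_gradient:
  assumes z: "z \<in> \<Omega>"
  shows "gradient z \<bullet> w + schw_A DIM('e) \<mu> (r z) * (fst (f z) \<bullet> gradient z) * (fst (f z) \<bullet> w) = slope z \<bullet> w"
  using V_bounds[OF z] unfolding inner_gradient[OF z]
  by (simp add: gradient_def schw_A_def inner_diff_left algebra_simps diff_divide_distrib)

lemma G_normal_dir:
  assumes z: "z \<in> \<Omega>"
  shows "G (f z) (normal_dir z) w = V z * (slope z \<bullet> fst w - snd w)"
proof -
  have "G (f z) (normal_dir z) w = V z * (gradient z \<bullet> fst w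
      + schw_A DIM('e) \<mu> (r z) * (fst (f z) \<bullet> gradient z) * (fst (f z) \<bullet> fst w)) - V z * snd w"
    by (simp add: G_eq[OF z] normal_dir_def algebra_simps)
  then show ?thesis
    unfolding base_metric_gradient[OF z] by (simp add: algebra_simps)
qed

text \<open>
  The gradient lifts to a tangent vector, which is spacelike; this bounds the slope below that of
  light rays and makes \<open>normal_dir\<close> timelike.
\<close>

lemma slope_gradient_bound:
  assumes z: "z \<in> \<Omega>"
  shows "V z * (slope z \<bullet> gradient z) < 1"
proof (cases "gradient z = 0")
  case False
  obtain e where e: "fst (D z e) = gradient z"
    using fst_D_surj[OF z] by blast
  then have "e \<noteq> 0"
    using False linear_0[OF linear_fst_D[OF z]] by auto
  then have "0 < G (f z) (D z e) (D z e)"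
    using spacelike z by blast
  also have "\<dots> = (slope z \<bullet> gradient z) * (1 - V z * (slope z \<bullet> gradient z))"
    unfolding G_eq[OF z] e snd_D[OF z] base_metric_gradient[OF z] by (simp add: algebra_simps)
  finally have pos: "0 < (slope z \<bullet> gradient z) * (1 - V z * (slope z \<bullet> gradient z))" .
  show ?thesis
  proof (rule ccontr)
    assume n: "\<not> V z * (slope z \<bullet> gradient z) < 1"
    then have "0 < V z * (slope z \<bullet> gradient z)"
      by simp
    then have "0 < slope z \<bullet> gradient z"
      using V_bounds[OF z] by (simp add: zero_less_mult_iff)
    then show False
      using pos n by (simp add: zero_less_mult_iff)
  qed
qed simp

lemma normal_dir_timelike:
  assumes z: "z \<in> \<Omega>"
  shows "0 < V z - (V z)\<^sup>2 * (slope z \<bullet> gradient z)"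
proof -
  have "V z * (V z * (slope z \<bullet> gradient z)) < V z * 1"
    using slope_gradient_bound[OF z] V_bounds[OF z] by (intro mult_strict_left_mono)
  then show ?thesis
    by (simp add: power2_eq_square mult.assoc)
qed

lemma G_linear:
  assumes z: "z \<in> \<Omega>"
  shows "G (f z) (u + u') v = G (f z) u v + G (f z) u' v" "G (f z) (c *\<^sub>R u) v = c * G (f z) u v"
    "G (f z) u (v + v') = G (f z) u v + G (f z) u v'" "G (f z) u (c *\<^sub>R v) = c * G (f z) u v"
    "G (f z) (u - u') v = G (f z) u v - G (f z) u' v"
  by (simp_all add: G_eq[OF z] algebra_simps)

text \<open>
  Uniqueness: subtracting from a candidate the multiple of \<open>normal_dir\<close> with the same \<open>\<partial>\<^sub>t\<close>-component
  leaves a vector orthogonal to the tangent space and to \<open>\<partial>\<^sub>t\<close>, which together span everything.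
\<close>

lemma unit_normal_eq:
  assumes z: "z \<in> \<Omega>"
  shows "unit_normal \<mu> f z = normal z"
  unfolding unit_normal_def
proof (rule the_equality)
  define \<kappa> where "\<kappa> = V z - (V z)\<^sup>2 * (slope z \<bullet> gradient z)"
  have k: "\<kappa> > 0"
    using normal_dir_timelike[OF z] by (simp add: \<kappa>_def)
  have normal: "normal z = (1 / sqrt \<kappa>) *\<^sub>R normal_dir z"
    by (simp add: normal_def \<kappa>_def)
  note V = V_bounds[OF z]
  have nn: "G (f z) (normal_dir z) (normal_dir z) = - \<kappa>"
    by (simp add: G_normal_dir[OF z]) (simp add: normal_dir_def \<kappa>_def power2_eq_square algebra_simps)
  have nnc: "G (f z) (c *\<^sub>R normal_dir z) (c *\<^sub>R normal_dir z) = - (c\<^sup>2 * \<kappa>)" for c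
    by (simp add: G_linear[OF z] nn power2_eq_square)
  have nD: "G (f z) (normal_dir z) (D z e) = 0" for e
    by (simp add: G_normal_dir[OF z] snd_D[OF z])
  have nt: "G (f z) (normal_dir z) (0, 1) = - V z"
    by (simp add: G_normal_dir[OF z])
  show "(\<forall>e. G (f z) (normal z) (D z e) = 0) \<and> G (f z) (normal z) (normal z) = - 1 \<and>
      G (f z) (normal z) (0, 1) < 0"
  proof (intro conjI allI)
    show "G (f z) (normal z) (normal z) = - 1"
      unfolding normal nnc using k by (simp add: power_divide)
    show "G (f z) (normal z) (0, 1) < 0"
      unfolding normal G_linear[OF z] nt using k V by simp
  qed (simp add: normal G_linear[OF z] nD)
  fix n assume n: "(\<forall>e. G (f z) n (D z e) = 0) \<and> G (f z) n n = - 1 \<and> G (f z) n (0, 1) < 0"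
  define d where "d = n - snd n *\<^sub>R normal_dir z"
  have Gt: "G (f z) u (0, 1) = - V z * snd u" for u
    by (simp add: G_eq[OF z])
  have "G (f z) d w = 0" for w
  proof -
    obtain e where e: "fst (D z e) = fst w"
      using fst_D_surj[OF z] by blast
    then have w: "w = D z e + (snd w - snd (D z e)) *\<^sub>R (0, 1)"
      by (simp add: prod_eq_iff)
    have "G (f z) d (D z e) = 0"
      using n nD by (simp add: d_def G_linear[OF z])
    moreover have "G (f z) d (0, 1) = 0"
      by (simp add: Gt) (simp add: d_def normal_dir_def)
    ultimately show ?thesis
      by (subst w) (simp only: G_linear[OF z])
  qed
  then have "\<forall>w. G (f z) d w = 0" "\<forall>w. G (f z) 0 w = 0"
    by (auto simp: G_eq[OF z])
  moreover have "\<exists>!w. \<forall>v. G (f z) w v = 0"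
    by (rule metric_represents_linear_functional[OF mu dim exterior[OF z]]) (simp add: linear_iff)
  ultimately have "d = 0"
    by blast
  then have eq: "n = snd n *\<^sub>R normal_dir z"
    by (simp add: d_def)
  have pos: "snd n > 0"
    using n V by (simp add: Gt zero_less_mult_iff)
  have "(snd n)\<^sup>2 * \<kappa> = 1"
    using n nnc[of "snd n"] unfolding eq[symmetric] by simp
  then have "(snd n)\<^sup>2 = 1 / \<kappa>"
    using k by (simp add: field_simps)
  then have "snd n = sqrt (1 / \<kappa>)"
    using pos by (metis abs_of_pos real_sqrt_abs)
  then have "snd n = 1 / sqrt \<kappa>"
    by (simp add: real_sqrt_divide)
  then show "n = normal z"
    using eq by (simp add: normal)
qed

lemma normal_orthogonal: "z \<in> \<Omega> \<Longrightarrow> G (f z) (normal z) (D z e) = 0"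
  by (simp add: normal_def G_linear G_normal_dir snd_D)

lemma normal_differentiable:
  assumes z: "z \<in> \<Omega>"
  shows "normal differentiable at z"
proof -
  obtain f' where f': "(f has_derivative f') (at z)"
    using differentiable[OF z] by (auto simp: differentiable_def)
  have y: "(\<lambda>z. fst (f z)) differentiable at z"
    using has_derivative_fst[OF f'] by (auto simp: differentiable_def)
  have y0: "fst (f z) \<noteq> 0"
    using r_pos[OF z] by auto
  have rd: "((\<lambda>z. r z) has_derivative (\<lambda>h. (fst (f z) \<bullet> fst (f' h)) / r z)) (at z)"
    by (rule norm_along_has_derivative[OF has_derivative_fst[OF f'] y0])
  then have r: "(\<lambda>z. r z) differentiable at z"
    by (rule differentiableI)
  have Vd: "(\<lambda>z. V z) differentiable at z"
    by (rule differentiableI)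
      (rule has_derivative_compose[OF rd schw_V_has_derivative[OF r_pos[OF z], unfolded has_field_derivative_def]])
  note p = slope_differentiable[OF z]
  have g: "gradient differentiable at z"
    unfolding gradient_def[abs_def]
    by (intro differentiable_diff differentiable_scaleR differentiable_divide differentiable_mult
        differentiable_inner differentiable_power differentiable_const p y Vd r)
      (use y0 in auto)
  have nd: "normal_dir differentiable at z"
  proof -
    have "(\<lambda>z. V z *\<^sub>R gradient z) differentiable at z"
      by (intro differentiable_scaleR Vd g)
    then obtain g' where "((\<lambda>z. V z *\<^sub>R gradient z) has_derivative g') (at z)"
      by (auto simp: differentiable_def)
    from has_derivative_Pair[OF this has_derivative_const[of 1]]
    show ?thesis
      unfolding normal_dir_def[abs_def] by (rule differentiableI)
  qed
  have kd: "(\<lambda>z. V z - (V z)\<^sup>2 * (slope z \<bullet> gradient z)) differentiable at z"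
    by (intro differentiable_diff differentiable_mult differentiable_inner differentiable_power p g Vd)
  then obtain k' where k': "((\<lambda>z. V z - (V z)\<^sup>2 * (slope z \<bullet> gradient z)) has_derivative k') (at z)"
    by (auto simp: differentiable_def)
  have "(\<lambda>z. sqrt (V z - (V z)\<^sup>2 * (slope z \<bullet> gradient z))) differentiable at z"
    by (rule differentiableI, rule has_derivative_compose[OF k'], rule DERIV_real_sqrt[unfolded has_field_derivative_def])
      (rule normal_dir_timelike[OF z])
  then have "(\<lambda>z. 1 / sqrt (V z - (V z)\<^sup>2 * (slope z \<bullet> gradient z))) differentiable at z"
    using normal_dir_timelike[OF z] by (intro differentiable_divide differentiable_const) auto
  then show ?thesis
    unfolding normal_def[abs_def] by (intro differentiable_scaleR nd)
qed

text \<open>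
  The second fundamental form in terms of \<open>f\<close>: differentiate the identity \<open>G (f z) (normal z) (D z e) = 0\<close>,
  and observe that two of the three Koszul terms cancel when the last argument is the direction of
  differentiation.
\<close>

lemma G_cov_deriv_normal:
  assumes z: "z \<in> \<Omega>"
  shows "G (f z) (cov_deriv_along G f (unit_normal \<mu> f) z e) (D z e) =
    dmetric \<mu> (f z) (normal z) (D z e) (D z e) / 2 - dmetric \<mu> (f z) (D z e) (normal z) (D z e)
    - G (f z) (normal z) (frechet_derivative (\<lambda>z. D z e) (at z) e)"
proof -
  let ?w = "D z e" and ?N = "normal z" and ?X' = "frechet_derivative (unit_normal \<mu> f) (at z)"
  let ?D2 = "frechet_derivative (\<lambda>z. D z e) (at z)"
  have evO: "eventually (\<lambda>z. z \<in> \<Omega>) (at z)"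
    using eventually_nhds_in_open[OF open_dom z] by (simp add: eventually_nhds_conv_at)
  obtain N' where N': "(normal has_derivative N') (at z)"
    using normal_differentiable[OF z] by (auto simp: differentiable_def)
  have "(unit_normal \<mu> f has_derivative N') (at z)"
    by (rule has_derivative_transform_eventually[OF N'])
      (use evO z in \<open>auto simp: unit_normal_eq elim!: eventually_mono\<close>)
  then have X': "?X' = N'"
    using frechet_derivative_at by metis
  have "((\<lambda>z. D z e) has_derivative ?D2) (at z)"
    using twice_differentiable[OF z] frechet_derivative_works by blast
  from metric_along_has_derivative[OF mu dim exterior[OF z] has_derivative_D[OF z] N' this]
  have der: "((\<lambda>z. G (f z) (normal z) (D z e)) has_derivative
     (\<lambda>h. dmetric \<mu> (f z) (D z h) ?N ?w + G (f z) (N' h) ?w + G (f z) ?N (?D2 h))) (at z)" .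
  have "((\<lambda>z. G (f z) (normal z) (D z e)) has_derivative (\<lambda>_. 0)) (at z)"
    by (rule has_derivative_transform_eventually[OF has_derivative_const[of 0]])
      (use evO z in \<open>auto simp: normal_orthogonal elim!: eventually_mono\<close>)
  from has_derivative_unique[OF der this]
  have "dmetric \<mu> (f z) ?w ?N ?w + G (f z) (N' e) ?w + G (f z) ?N (?D2 e) = 0"
    by metis
  moreover have "2 * G (f z) (christoffel G (f z) ?w ?N) ?w =
      dmetric \<mu> (f z) ?w ?N ?w + dmetric \<mu> (f z) ?N ?w ?w - dmetric \<mu> (f z) ?w ?w ?N"
    by (rule metric_christoffel[OF mu dim exterior[OF z]])
  moreover have "dmetric \<mu> (f z) ?w ?w ?N = dmetric \<mu> (f z) ?w ?N ?w"
    by (simp add: dmetric_def Let_def inner_commute algebra_simps)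
  moreover have "G (f z) (cov_deriv_along G f (unit_normal \<mu> f) z e) ?w
      = G (f z) (N' e) ?w + G (f z) (christoffel G (f z) ?w ?N) ?w"
    by (simp add: cov_deriv_along_def X' unit_normal_eq[OF z] G_linear[OF z])
  ultimately show ?thesis
    by simp
qed

end

section \<open>Comparison with a radial graph at a point of contact\<close>

lemma local_max_derivatives:
  fixes h h' :: "real \<Rightarrow> real"
  assumes h: "eventually (\<lambda>x. (h has_real_derivative h' x) (at x)) (nhds a)"
    and h': "(h' has_real_derivative c) (at a)"
    and max: "eventually (\<lambda>x. h x \<le> h a) (nhds a)"
  shows "h' a = 0" "c \<le> 0"
proof -
  obtain d where d: "d > 0" "\<And>x. \<bar>x - a\<bar> < d \<Longrightarrow> (h has_real_derivative h' x) (at x) \<and> h x \<le> h a"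
    using eventually_conj[OF h max] by (auto simp: eventually_nhds_metric dist_real_def)
  show h0: "h' a = 0"
    by (rule DERIV_local_max[of h _ a d]) (use d in \<open>auto simp: abs_minus_commute\<close>)
  show "c \<le> 0"
  proof (rule ccontr)
    assume "\<not> c \<le> 0"
    then obtain d' where d': "d' > 0" "\<And>t. 0 < t \<Longrightarrow> t < d' \<Longrightarrow> h' a < h' (a + t)"
      using DERIV_pos_inc_right[OF h'] by auto
    define t where "t = min d d' / 2"
    have t: "0 < t" "t < d" "t < d'"
      using d d' by (auto simp: t_def)
    have "h a < h (a + t)"
    proof (rule DERIV_pos_imp_increasing_open[of a "a + t" h])
      show "a < a + t"
        using t by simp
      show "\<exists>y. (h has_real_derivative y) (at x) \<and> 0 < y" if "a < x" "x < a + t" for x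
      proof -
        have "(h has_real_derivative h' x) (at x)"
          using d(2)[of x] that t by auto
        moreover have "0 < h' x"
          using d'(2)[of "x - a"] that t h0 by auto
        ultimately show ?thesis
          by blast
      qed
      have "isCont h x" if "\<bar>x - a\<bar> < d" for x
        using d(2)[OF that] DERIV_isCont by blast
      then show "continuous_on {a..a + t} h"
        using t by (intro continuous_at_imp_continuous_on) auto
    qed
    then show False
      using d(2)[of "a + t"] t by simp
  qed
qed

text \<open>The mean curvature is computed in an arbitrary frame; Parseval evaluates the traces in it.\<close>

lemma orthonormal_frame_Parseval:
  fixes g :: "'e::euclidean_space \<Rightarrow> 'e \<Rightarrow> real" and E :: "'e \<Rightarrow> 'e"
  assumes g: "bilinear g"
    and E: "\<And>b c. b \<in> Basis \<Longrightarrow> c \<in> Basis \<Longrightarrow> g (E b) (E c) = (if b = c then 1 else 0)"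
  shows "g v v = (\<Sum>b\<in>Basis. (g (E b) v)\<^sup>2)"
proof -
  define L where "L x = (\<Sum>b\<in>Basis. (x \<bullet> b) *\<^sub>R E b)" for x
  have lin: "linear L"
    unfolding L_def by (intro linearI)
      (simp_all add: inner_add_left scaleR_add_left sum.distrib scaleR_sum_right)
  have gL: "g (E c) (L x) = x \<bullet> c" if "c \<in> Basis" for c x
  proof -
    have "g (E c) (L x) = (\<Sum>b\<in>Basis. (x \<bullet> b) * g (E c) (E b))"
      unfolding L_def using g by (simp add: bilinear_def linear_sum linear_cmul)
    also have "\<dots> = (\<Sum>b\<in>Basis. if b = c then x \<bullet> c else 0)"
      by (rule sum.cong) (use E that in auto)
    finally show ?thesis
      using that by simp
  qed
  have "inj L"
    unfolding linear_injective_0[OF lin]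
  proof (intro allI impI)
    fix x assume "L x = 0"
    then have "x \<bullet> c = 0" if "c \<in> Basis" for c
      using gL[OF that, of x] g by (simp add: bilinear_def linear_0)
    then show "x = 0"
      using euclidean_all_zero_iff[of x] by blast
  qed
  then have "surj L"
    using linear_injective_imp_surjective[OF lin] by simp
  then obtain x where x: "L x = v"
    by (metis surjD)
  have linv: "linear (\<lambda>u. g u v)"
    using g by (simp add: bilinear_def)
  have "g v v = g (L x) v"
    by (simp add: x)
  also have "\<dots> = (\<Sum>b\<in>Basis. (x \<bullet> b) * g (E b) v)"
    unfolding L_def by (simp add: linear_sum[OF linv] linear_cmul[OF linv])
  also have "\<dots> = (\<Sum>b\<in>Basis. (g (E b) v)\<^sup>2)"
    by (rule sum.cong) (use gL in \<open>auto simp: x[symmetric] power2_eq_square\<close>)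
  finally show ?thesis .
qed

text \<open>
  The second fundamental form of the graph of a radial function with derivatives \<open>d1\<close> and \<open>d2\<close>, on a
  tangent vector with radial part \<open>s\<close> and squared angular part \<open>q\<close>, up to the factor
  \<open>1 / sqrt (V - V\<^sup>3 d1\<^sup>2)\<close>. On the left, the first two terms come from the derivatives of the metric
  coefficients and the last one from the second derivative of the radial function.
\<close>

lemma radial_comparison_algebra:
  fixes r V V' A A' d1 d2 s q :: real
  assumes "r > 0" "V > 0" and A: "A = (1 / V - 1) / r\<^sup>2" and A': "A' = - V' / (V\<^sup>2 * r\<^sup>2) - 2 * A / r"
  shows "(A' * V\<^sup>2 * d1 * r\<^sup>2 * s\<^sup>2 + 2 * A * V\<^sup>2 * d1 * r * s\<^sup>2 - V' * V\<^sup>2 * d1 ^ 3 * s\<^sup>2) / 2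
      - (A' * V\<^sup>2 * d1 * r\<^sup>2 * s\<^sup>2 + A * V\<^sup>2 * d1 * r * s\<^sup>2 + A * V\<^sup>2 * d1 * r * (s\<^sup>2 + q) - V' * d1 * s\<^sup>2)
      + V * (d2 * s\<^sup>2 + d1 * q / r)
    = (V * d2 + d1 * V' * (3 / 2 - V\<^sup>2 * d1\<^sup>2 / 2)) * s\<^sup>2 + V\<^sup>2 * d1 / r * q"
proof -
  have 1: "A' * V\<^sup>2 * r\<^sup>2 = - V' - 2 * A * V\<^sup>2 * r"
    using assms(1,2) unfolding A' by (simp add: field_simps power2_eq_square)
  have 2: "A * V\<^sup>2 * r = V / r - V\<^sup>2 / r"
    using assms(1,2) unfolding A by (simp add: field_simps power2_eq_square)
  have "(A' * V\<^sup>2 * d1 * r\<^sup>2 * s\<^sup>2 + 2 * A * V\<^sup>2 * d1 * r * s\<^sup>2 - V' * V\<^sup>2 * d1 ^ 3 * s\<^sup>2) / 2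
      - (A' * V\<^sup>2 * d1 * r\<^sup>2 * s\<^sup>2 + A * V\<^sup>2 * d1 * r * s\<^sup>2 + A * V\<^sup>2 * d1 * r * (s\<^sup>2 + q) - V' * d1 * s\<^sup>2)
      = - ((A' * V\<^sup>2 * r\<^sup>2) * d1 * s\<^sup>2) / 2 - (A * V\<^sup>2 * r) * d1 * s\<^sup>2 - (A * V\<^sup>2 * r) * d1 * q
        + V' * d1 * s\<^sup>2 - V' * V\<^sup>2 * d1 ^ 3 * s\<^sup>2 / 2"
    by (simp add: algebra_simps add_divide_distrib diff_divide_distrib)
  also have "\<dots> = V' * d1 * s\<^sup>2 / 2 - (A * V\<^sup>2 * r) * d1 * q + V' * d1 * s\<^sup>2 - V' * V\<^sup>2 * d1 ^ 3 * s\<^sup>2 / 2"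
    unfolding 1 by (simp add: algebra_simps add_divide_distrib diff_divide_distrib)
  finally show ?thesis
    unfolding 2 by (simp add: algebra_simps power2_eq_square power3_eq_cube)
qed

context spacelike_patch
begin

abbreviation "V' z \<equiv> schw_V' DIM('e) \<mu> (r z)"

lemma bilinear_induced:
  assumes z: "z \<in> \<Omega>"
  shows "bilinear (\<lambda>e e'. G (f z) (D z e) (D z e'))"
  unfolding bilinear_def using linear_D[OF z]
  by (auto intro!: linearI simp: linear_add linear_cmul G_linear[OF z])

text \<open>
  From here on the hypersurface touches at \<open>f z\<close> a vertical translate of the graph of the radial
  function \<open>\<phi>\<close>. It lies below the translate if \<open>\<sigma> > 0\<close>, and above it if \<open>\<sigma> < 0\<close>. The tangent space at the
  point of contact is known explicitly, which makes all metric quantities computable.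
\<close>

context
  fixes z :: 'e and \<phi> \<phi>' :: "real \<Rightarrow> real" and d1 d2 \<sigma> :: real
  assumes z: "z \<in> \<Omega>" and \<sigma>: "\<sigma> \<noteq> 0"
    and \<phi>: "eventually (\<lambda>x. (\<phi> has_real_derivative \<phi>' x) (at x)) (nhds (r z))"
    and \<phi>': "\<phi>' (r z) = d1" "(\<phi>' has_real_derivative d2) (at (r z))"
    and contact: "eventually (\<lambda>x. \<sigma> * (snd (f x) - \<phi> (r x)) \<le> \<sigma> * (snd (f z) - \<phi> (r z))) (nhds z)"
begin

text \<open>First and second derivative test along lines in the parameter domain.\<close>

lemma contact_conditions:
  fixes e :: 'e
  defines "s \<equiv> (fst (f z) \<bullet> fst (D z e)) / r z"
  defines "D2 \<equiv> frechet_derivative (\<lambda>z. D z e) (at z) e"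
  shows "snd (D z e) = d1 * s"
    "\<sigma> * (snd D2 - d1 * ((fst (f z) \<bullet> fst D2) / r z)) \<le>
     \<sigma> * (d2 * s\<^sup>2 + d1 * (fst (D z e) \<bullet> fst (D z e) - s\<^sup>2) / r z)"
proof -
  define \<gamma> where "\<gamma> t = z + t *\<^sub>R e" for t :: real
  define k where "k x = snd (D x e) - \<phi>' (r x) * ((fst (f x) \<bullet> fst (D x e)) / r x)" for x
  have \<gamma>0: "\<gamma> 0 = z"
    by (simp add: \<gamma>_def)
  have d\<gamma>: "(\<gamma> has_derivative (\<lambda>t. t *\<^sub>R e)) (at t)" for t
    unfolding \<gamma>_def by (auto intro!: derivative_eq_intros)
  have "(\<gamma> \<longlongrightarrow> \<gamma> 0) (nhds 0)"
    using has_derivative_continuous[OF d\<gamma>[of 0]]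
    by (simp only: continuous_within tendsto_at_iff_tendsto_nhds)
  then have lim: "(\<gamma> \<longlongrightarrow> z) (nhds 0)"
    by (simp only: \<gamma>0)
  have rdiff: "((\<lambda>x. r x) has_derivative (\<lambda>h. (fst (f x) \<bullet> fst (D x h)) / r x)) (at x)" if "x \<in> \<Omega>" for x
    by (rule norm_along_has_derivative[OF has_derivative_fst[OF has_derivative_D[OF that]]])
      (use r_pos[OF that] in auto)
  have cont_r: "((\<lambda>x. r x) \<longlongrightarrow> r z) (nhds z)"
    using has_derivative_continuous[OF rdiff[OF z]]
    unfolding continuous_within tendsto_at_iff_tendsto_nhds[of "\<lambda>x. r x" z] .
  have ev: "eventually (\<lambda>x. x \<in> \<Omega> \<and> (\<phi> has_real_derivative \<phi>' (r x)) (at (r x))) (nhds z)"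
    using eventually_nhds_in_open[OF open_dom z] filterlim_iff[THEN iffD1, OF cont_r, rule_format, OF \<phi>]
    by eventually_elim blast
  have F: "((\<lambda>x. snd (f x) - \<phi> (r x)) has_derivative
      (\<lambda>h. snd (D x h) - \<phi>' (r x) * ((fst (f x) \<bullet> fst (D x h)) / r x))) (at x)"
    if "x \<in> \<Omega>" "(\<phi> has_real_derivative \<phi>' (r x)) (at (r x))" for x
    by (intro has_derivative_diff has_derivative_snd has_derivative_D that
        has_derivative_compose[OF rdiff that(2)[unfolded has_field_derivative_def], OF that(1)])
  have h: "eventually (\<lambda>t. ((\<lambda>t. \<sigma> * (snd (f (\<gamma> t)) - \<phi> (r (\<gamma> t)))) has_real_derivative \<sigma> * k (\<gamma> t)) (at t)) (nhds 0)"
    using filterlim_iff[THEN iffD1, OF lim, rule_format, OF ev]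
  proof eventually_elim
    case (elim t)
    have "((\<lambda>t. \<sigma> * (snd (f (\<gamma> t)) - \<phi> (r (\<gamma> t)))) has_derivative
      (\<lambda>h. \<sigma> * (snd (D (\<gamma> t) (h *\<^sub>R e)) - \<phi>' (r (\<gamma> t)) * ((fst (f (\<gamma> t)) \<bullet> fst (D (\<gamma> t) (h *\<^sub>R e))) / r (\<gamma> t))))) (at t)"
      by (intro has_derivative_mult_right has_derivative_compose[OF d\<gamma> F]) (use elim in auto)
    then show ?case
      unfolding has_field_derivative_def
      by (rule has_derivative_eq_rhs) (use linear_D elim in \<open>auto simp: fun_eq_iff k_def linear_cmul algebra_simps\<close>)
  qed
  have dD: "((\<lambda>x. D x e) has_derivative frechet_derivative (\<lambda>z. D z e) (at z)) (at z)"
    using twice_differentiable[OF z] frechet_derivative_works by blast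
  note w1 = has_derivative_fst[OF dD] and y1 = has_derivative_fst[OF has_derivative_D[OF z]]
  have inv: "((\<lambda>x. inverse (r x)) has_derivative
      (\<lambda>h. - (inverse (r z) * ((fst (f z) \<bullet> fst (D z h)) / r z) * inverse (r z)))) (at z)"
    by (rule has_derivative_compose[OF rdiff[OF z] has_derivative_inverse']) (use r_pos[OF z] in simp)
  note dk = has_derivative_diff[OF has_derivative_snd[OF dD] has_derivative_mult[OF
        has_derivative_compose[OF rdiff[OF z] \<phi>'(2)[unfolded has_field_derivative_def]]
        has_derivative_mult[OF has_derivative_inner[OF y1 w1] inv]]]
  have s_eq: "fst (f z) \<bullet> fst (D z e) = r z * s"
    using r_pos[OF z] by (simp add: s_def)
  define k2 where "k2 = snd D2 - (d1 * ((fst (f z) \<bullet> fst D2) / r z)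
      + (d2 * s\<^sup>2 + d1 * (fst (D z e) \<bullet> fst (D z e) - s\<^sup>2) / r z))"
  have "((\<lambda>t. \<sigma> * k (\<gamma> t)) has_derivative (\<lambda>t. \<sigma> * k2 * t)) (at 0)"
  proof -
    obtain K where K: "(k has_derivative K) (at z)" and Ke: "K e = k2"
    proof
      show "(k has_derivative (\<lambda>h. snd (frechet_derivative (\<lambda>z. D z e) (at z) h) -
          (\<phi>' (r z) * ((fst (f z) \<bullet> fst (D z e)) * (- (inverse (r z) * ((fst (f z) \<bullet> fst (D z h)) / r z) * inverse (r z))) +
             (fst (f z) \<bullet> fst (frechet_derivative (\<lambda>z. D z e) (at z) h) + fst (D z h) \<bullet> fst (D z e)) * inverse (r z)) +
           d2 * ((fst (f z) \<bullet> fst (D z h)) / r z) * (fst (f z) \<bullet> fst (D z e) * inverse (r z))))) (at z)"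
        unfolding k_def[abs_def] divide_inverse[of "_ \<bullet> _" "norm _"] using dk unfolding divide_inverse[of "_ \<bullet> _" "norm _"] by simp
      show "snd (frechet_derivative (\<lambda>z. D z e) (at z) e) -
          (\<phi>' (r z) * ((fst (f z) \<bullet> fst (D z e)) * (- (inverse (r z) * ((fst (f z) \<bullet> fst (D z e)) / r z) * inverse (r z))) +
             (fst (f z) \<bullet> fst (frechet_derivative (\<lambda>z. D z e) (at z) e) + fst (D z e) \<bullet> fst (D z e)) * inverse (r z)) +
           d2 * ((fst (f z) \<bullet> fst (D z e)) / r z) * (fst (f z) \<bullet> fst (D z e) * inverse (r z))) = k2"
        unfolding D2_def[symmetric] k2_def \<phi>'(1) s_eq using r_pos[OF z]
        by (simp add: field_simps power2_eq_square)
    qed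
    have "((\<lambda>t. \<sigma> * k (\<gamma> t)) has_derivative (\<lambda>t. \<sigma> * K (t *\<^sub>R e))) (at 0)"
      by (intro has_derivative_mult_right has_derivative_compose[OF d\<gamma>]) (simp add: \<gamma>0 K)
    then show ?thesis
      using has_derivative_linear[OF K] Ke by (simp add: linear_cmul mult_ac)
  qed
  then have h2: "((\<lambda>t. \<sigma> * k (\<gamma> t)) has_real_derivative \<sigma> * k2) (at 0)"
    by (simp add: has_field_derivative_def)
  have max: "eventually (\<lambda>t. \<sigma> * (snd (f (\<gamma> t)) - \<phi> (r (\<gamma> t))) \<le> \<sigma> * (snd (f (\<gamma> 0)) - \<phi> (r (\<gamma> 0)))) (nhds 0)"
    unfolding \<gamma>0 using filterlim_iff[THEN iffD1, OF lim, rule_format, OF contact] .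
  have "\<sigma> * k (\<gamma> 0) = 0" "\<sigma> * k2 \<le> 0"
    using local_max_derivatives[OF h h2 max] by auto
  then show "snd (D z e) = d1 * s"
    "\<sigma> * (snd D2 - d1 * ((fst (f z) \<bullet> fst D2) / r z)) \<le>
     \<sigma> * (d2 * s\<^sup>2 + d1 * (fst (D z e) \<bullet> fst (D z e) - s\<^sup>2) / r z)"
    using \<sigma> by (simp_all add: k_def \<gamma>0 \<phi>'(1) s_def[symmetric] k2_def algebra_simps)
qed

lemma slope_contact: "slope z = (d1 / r z) *\<^sub>R fst (f z)"
proof -
  have "slope z \<bullet> w = ((d1 / r z) *\<^sub>R fst (f z)) \<bullet> w" for w
  proof -
    obtain e where e: "fst (D z e) = w"
      using fst_D_surj[OF z] by blast
    show ?thesis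
      using contact_conditions(1)[of e] by (simp add: snd_D[OF z] e)
  qed
  then show ?thesis
    by (intro vector_eq_rdot[THEN iffD1]) blast
qed

lemma gradient_contact: "gradient z = (V z * d1 / r z) *\<^sub>R fst (f z)"
  using r_pos[OF z]
  by (simp add: gradient_def slope_contact dot_square_norm flip: scaleR_diff_left)
    (simp add: field_simps power2_eq_square)

lemma slope_gradient_contact: "slope z \<bullet> gradient z = V z * d1\<^sup>2"
  using r_pos[OF z]
  by (simp add: slope_contact gradient_contact dot_square_norm) (simp add: field_simps power2_eq_square)

lemma contact_slope_bound: "0 < 1 / V z - V z * d1\<^sup>2" "0 < V z - (V z) ^ 3 * d1\<^sup>2"
proof -
  have "0 < V z - (V z)\<^sup>2 * (V z * d1\<^sup>2)"
    using normal_dir_timelike[OF z] by (simp add: slope_gradient_contact)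
  then show *: "0 < V z - (V z) ^ 3 * d1\<^sup>2"
    by (simp add: power2_eq_square power3_eq_cube mult_ac)
  have "1 / V z - V z * d1\<^sup>2 = (V z - (V z) ^ 3 * d1\<^sup>2) / (V z)\<^sup>2"
    using V_bounds[OF z] by (simp add: field_simps power2_eq_square power3_eq_cube)
  then show "0 < 1 / V z - V z * d1\<^sup>2"
    using * V_bounds[OF z] by simp
qed

lemma induced_metric_contact:
  "G (f z) (D z e) (D z e') = fst (D z e) \<bullet> fst (D z e') -
    (1 - (1 / V z - V z * d1\<^sup>2)) * ((fst (f z) \<bullet> fst (D z e)) / r z) * ((fst (f z) \<bullet> fst (D z e')) / r z)"
  using V_bounds[OF z] r_pos[OF z]
  by (simp add: G_eq[OF z] contact_conditions(1) schw_A_def field_simps power2_eq_square)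

text \<open>
  The induced metric is the flat one with the radial direction rescaled by \<open>K\<close>, so rescaling the
  radial part of the standard basis by \<open>1 / sqrt K\<close> gives a frame.
\<close>

lemma orthonormal_frame_exists: "\<exists>E. orthonormal_frame_at \<mu> f z E"
proof -
  define K where "K = 1 / V z - V z * d1\<^sup>2"
  define c where "c = 1 / sqrt K - 1"
  define y where "y = (1 / r z) *\<^sub>R fst (f z)"
  have yy: "y \<bullet> y = 1"
    using r_pos[OF z] by (simp add: y_def dot_square_norm power2_eq_square)
  have "\<forall>b. \<exists>e. fst (D z e) = b + (c * (y \<bullet> b)) *\<^sub>R y"
    using fst_D_surj[OF z] by metis
  then obtain E where E: "\<And>b. fst (D z (E b)) = b + (c * (y \<bullet> b)) *\<^sub>R y"
    by metis
  have cK: "(1 + c)\<^sup>2 * K = 1"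
    using contact_slope_bound(1) by (simp add: c_def power_divide flip: K_def)
  have "orthonormal_frame_at \<mu> f z E"
    unfolding orthonormal_frame_at_def
  proof (intro ballI)
    fix b b' :: 'e assume bb: "b \<in> Basis" "b' \<in> Basis"
    have yb: "(fst (f z) \<bullet> fst (D z (E b))) / r z = (1 + c) * (y \<bullet> b)" for b
    proof -
      have "(fst (f z) \<bullet> fst (D z (E b))) / r z = y \<bullet> fst (D z (E b))"
        by (simp add: y_def)
      then show ?thesis
        by (simp add: E inner_add_right yy algebra_simps)
    qed
    have "G (f z) (D z (E b)) (D z (E b')) = b \<bullet> b' + ((1 + c)\<^sup>2 - 1) * ((y \<bullet> b) * (y \<bullet> b'))
        - (1 - K) * ((1 + c) * (y \<bullet> b)) * ((1 + c) * (y \<bullet> b'))"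
      unfolding induced_metric_contact yb K_def[symmetric]
      by (simp add: E inner_add_left inner_add_right yy inner_commute power2_eq_square algebra_simps)
    also have "\<dots> = b \<bullet> b' + ((1 + c)\<^sup>2 * K - 1) * ((y \<bullet> b) * (y \<bullet> b'))"
      by (simp add: power2_eq_square algebra_simps)
    also have "\<dots> = (if b = b' then 1 else 0)"
      using bb by (simp add: cK inner_Basis)
    finally show "G (f z) (D z (E b)) (D z (E b')) = (if b = b' then 1 else 0)" .
  qed
  then show ?thesis
    by blast
qed

lemma normal_contact:
  "normal z = (1 / sqrt (V z - (V z) ^ 3 * d1\<^sup>2)) *\<^sub>R (((V z)\<^sup>2 * d1 / r z) *\<^sub>R fst (f z), 1)"
  unfolding normal_def normal_dir_def slope_gradient_contact
  unfolding gradient_contact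
  by (simp add: power2_eq_square power3_eq_cube mult_ac)

text \<open>
  In \<open>G_cov_deriv_normal\<close> the second derivative of \<open>f\<close> enters only through its scalar product with the
  normal, that is, with the gradient of \<open>t - \<phi>(\<rho>)\<close>, and that is what the second derivative test
  controls.
\<close>

lemma second_fundamental_form_bound:
  assumes unit: "G (f z) (D z e) (D z e) = 1"
  defines "s \<equiv> (fst (f z) \<bullet> fst (D z e)) / r z"
  shows "\<sigma> * G (f z) (cov_deriv_along G f (unit_normal \<mu> f) z e) (D z e) \<le>
    \<sigma> * (1 / sqrt (V z - (V z) ^ 3 * d1\<^sup>2)) *
      ((V z * d2 + d1 * V' z * (3 / 2 - (V z)\<^sup>2 * d1\<^sup>2 / 2)) * s\<^sup>2
       + (V z)\<^sup>2 * d1 / r z * (1 - (1 / V z - V z * d1\<^sup>2) * s\<^sup>2))"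
proof -
  define l where "l = 1 / sqrt (V z - (V z) ^ 3 * d1\<^sup>2)"
  define n1 where "n1 = fst (D z e) \<bullet> fst (D z e)"
  define D2 where "D2 = frechet_derivative (\<lambda>z. D z e) (at z) e"
  define q where "q = 1 - (1 / V z - V z * d1\<^sup>2) * s\<^sup>2"
  define A A' where "A = schw_A DIM('e) \<mu> (r z)" and "A' = schw_A' DIM('e) \<mu> (r z)"
  have l: "l > 0"
    using contact_slope_bound by (simp add: l_def)
  have N: "normal z = (((l * (V z)\<^sup>2 * d1 / r z)) *\<^sub>R fst (f z), l)"
    by (simp add: normal_contact l_def)
  have s: "fst (f z) \<bullet> fst (D z e) = r z * s" and s2: "snd (D z e) = d1 * s"
    using r_pos[OF z] contact_conditions(1)[of e] by (simp_all add: s_def)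
  have yN: "fst (f z) \<bullet> fst (normal z) = l * (V z)\<^sup>2 * d1 * r z"
    using r_pos[OF z] by (simp add: N dot_square_norm power2_eq_square)
  have wN: "fst (D z e) \<bullet> fst (normal z) = l * (V z)\<^sup>2 * d1 * s" "fst (normal z) \<bullet> fst (D z e) = l * (V z)\<^sup>2 * d1 * s"
    using r_pos[OF z] s by (simp_all add: N inner_commute)
  have N2: "snd (normal z) = l"
    by (simp add: N)
  have n1: "n1 = s\<^sup>2 + q"
    using unit unfolding induced_metric_contact n1_def[symmetric] s_def[symmetric] q_def
    by (simp add: power2_eq_square algebra_simps)
  have rs: "r z * s / r z = s" "l * (V z)\<^sup>2 * d1 * r z / r z = l * (V z)\<^sup>2 * d1"
    using r_pos[OF z] by simp_all
  have 1: "dmetric \<mu> (f z) (normal z) (D z e) (D z e) =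
      l * (A' * (V z)\<^sup>2 * d1 * (r z)\<^sup>2 * s\<^sup>2 + 2 * A * (V z)\<^sup>2 * d1 * r z * s\<^sup>2 - V' z * (V z)\<^sup>2 * d1 ^ 3 * s\<^sup>2)"
    unfolding dmetric_def Let_def A_def[symmetric] A'_def[symmetric] yN wN s s2 rs
    by (simp add: power2_eq_square power3_eq_cube algebra_simps)
  have 2: "dmetric \<mu> (f z) (D z e) (normal z) (D z e) =
      l * (A' * (V z)\<^sup>2 * d1 * (r z)\<^sup>2 * s\<^sup>2 + A * (V z)\<^sup>2 * d1 * r z * s\<^sup>2 + A * (V z)\<^sup>2 * d1 * r z * (s\<^sup>2 + q)
        - V' z * d1 * s\<^sup>2)"
    unfolding dmetric_def Let_def A_def[symmetric] A'_def[symmetric] yN wN s s2 rs N2 n1_def[symmetric] n1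
    by (simp add: power2_eq_square power3_eq_cube algebra_simps)
  have 3: "G (f z) (normal z) D2 = - (l * V z * (snd D2 - d1 * ((fst (f z) \<bullet> fst D2) / r z)))"
  proof -
    have "normal z = l *\<^sub>R normal_dir z"
      by (simp add: normal_def slope_gradient_contact l_def power2_eq_square power3_eq_cube mult.assoc)
    then show ?thesis
      by (simp add: G_linear[OF z] G_normal_dir[OF z] slope_contact algebra_simps)
  qed
  have "\<sigma> * (snd D2 - d1 * ((fst (f z) \<bullet> fst D2) / r z)) \<le> \<sigma> * (d2 * s\<^sup>2 + d1 * q / r z)"
    using contact_conditions(2)[of e] unfolding D2_def[symmetric] s_def[symmetric] n1_def[symmetric] n1 by simp
  then have 4: "l * V z * (\<sigma> * (snd D2 - d1 * ((fst (f z) \<bullet> fst D2) / r z))) \<le> l * V z * (\<sigma> * (d2 * s\<^sup>2 + d1 * q / r z))"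
    by (rule mult_left_mono) (use l V_bounds[OF z] in simp)
  define a1 a2 where
    "a1 = A' * (V z)\<^sup>2 * d1 * (r z)\<^sup>2 * s\<^sup>2 + 2 * A * (V z)\<^sup>2 * d1 * r z * s\<^sup>2 - V' z * (V z)\<^sup>2 * d1 ^ 3 * s\<^sup>2"
    and "a2 = A' * (V z)\<^sup>2 * d1 * (r z)\<^sup>2 * s\<^sup>2 + A * (V z)\<^sup>2 * d1 * r z * s\<^sup>2 + A * (V z)\<^sup>2 * d1 * r z * (s\<^sup>2 + q)
        - V' z * d1 * s\<^sup>2"
  have alg: "a1 / 2 - a2 + V z * (d2 * s\<^sup>2 + d1 * q / r z) =
      (V z * d2 + d1 * V' z * (3 / 2 - (V z)\<^sup>2 * d1\<^sup>2 / 2)) * s\<^sup>2 + (V z)\<^sup>2 * d1 / r z * q"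
    unfolding a1_def a2_def
    by (rule radial_comparison_algebra[OF r_pos[OF z] V_bounds(1)[OF z]]) (simp_all add: A_def A'_def schw_A_def schw_A'_def)
  have "\<sigma> * G (f z) (cov_deriv_along G f (unit_normal \<mu> f) z e) (D z e) =
      \<sigma> * l * (a1 / 2 - a2) + l * V z * (\<sigma> * (snd D2 - d1 * ((fst (f z) \<bullet> fst D2) / r z)))"
    unfolding G_cov_deriv_normal[OF z] D2_def[symmetric] 1 2 3 a1_def[symmetric] a2_def[symmetric]
    by (simp add: algebra_simps)
  also have "\<dots> \<le> \<sigma> * l * (a1 / 2 - a2) + l * V z * (\<sigma> * (d2 * s\<^sup>2 + d1 * q / r z))"
    using 4 by simp
  also have "\<dots> = \<sigma> * l * (a1 / 2 - a2 + V z * (d2 * s\<^sup>2 + d1 * q / r z))"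
    by (simp add: algebra_simps)
  finally show ?thesis
    unfolding alg unfolding l_def q_def .
qed

text \<open>
  The comparison principle for mean curvature: the right-hand side is \<open>\<sigma>\<close> times \<open>m\<close> times the mean
  curvature of the graph of \<open>\<phi>\<close>. By the previous bound each summand of the trace depends only on the
  radial part \<open>s\<close> of its frame vector, and Parseval, applied to the radial tangent vector, gives the
  sum of all \<open>s\<^sup>2\<close>.
\<close>

theorem mean_curvature_contact:
  "\<sigma> * (real DIM('e) * mean_curvature_param \<mu> f z) \<le>
    \<sigma> * (1 / sqrt (V z - (V z) ^ 3 * d1\<^sup>2)) *
      ((real DIM('e) - 1) * ((V z)\<^sup>2 * d1 / r z)
       + (V z * d2 + d1 * V' z * (3 / 2 - (V z)\<^sup>2 * d1\<^sup>2 / 2)) / (1 / V z - V z * d1\<^sup>2))"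
proof -
  define l where "l = 1 / sqrt (V z - (V z) ^ 3 * d1\<^sup>2)"
  define K where "K = 1 / V z - V z * d1\<^sup>2"
  define a where "a = V z * d2 + d1 * V' z * (3 / 2 - (V z)\<^sup>2 * d1\<^sup>2 / 2)"
  define b where "b = (V z)\<^sup>2 * d1 / r z"
  define E where "E = (SOME E. orthonormal_frame_at \<mu> f z E)"
  have K: "K > 0"
    using contact_slope_bound by (simp add: K_def)
  have "orthonormal_frame_at \<mu> f z E"
    unfolding E_def by (rule someI_ex[OF orthonormal_frame_exists])
  then have E: "G (f z) (D z (E i)) (D z (E j)) = (if i = j then 1 else 0)" if "i \<in> Basis" "j \<in> Basis" for i j
    using that by (simp add: orthonormal_frame_at_def)
  define s where "s i = (fst (f z) \<bullet> fst (D z (E i))) / r z" for i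
  obtain e where e: "fst (D z e) = (1 / r z) *\<^sub>R fst (f z)"
    using fst_D_surj[OF z] by blast
  have ye: "(fst (f z) \<bullet> fst (D z e)) / r z = 1" and ww: "fst (D z e) \<bullet> fst (D z e) = 1"
    using r_pos[OF z] by (simp_all add: e dot_square_norm power2_eq_square)
  have ee: "G (f z) (D z e) (D z e) = K"
    unfolding induced_metric_contact ye ww by (simp add: K_def)
  have "G (f z) (D z (E i)) (D z e) = K * s i" for i
  proof -
    have "fst (D z (E i)) \<bullet> fst (D z e) = s i"
      by (simp add: e s_def inner_commute)
    then show ?thesis
      unfolding induced_metric_contact ye s_def[symmetric] K_def[symmetric] by (simp add: algebra_simps)
  qed
  then have "K = (\<Sum>i\<in>Basis. (K * s i)\<^sup>2)"
    using orthonormal_frame_Parseval[OF bilinear_induced[OF z], of E e] E ee by simp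
  then have "K = K * (K * (\<Sum>i\<in>Basis. (s i)\<^sup>2))"
    by (simp add: power_mult_distrib sum_distrib_left power2_eq_square mult_ac)
  then have sum_s: "(\<Sum>i\<in>Basis. (s i)\<^sup>2) = 1 / K"
    using K by (simp add: field_simps)
  have "\<sigma> * (real DIM('e) * mean_curvature_param \<mu> f z) =
      (\<Sum>i\<in>Basis. \<sigma> * G (f z) (cov_deriv_along G f (unit_normal \<mu> f) z (E i)) (D z (E i)))"
  proof -
    have "real DIM('e) * mean_curvature_param \<mu> f z =
        (\<Sum>i\<in>Basis. G (f z) (cov_deriv_along G f (unit_normal \<mu> f) z (E i)) (D z (E i)))"
      using dim unfolding mean_curvature_param_def E_def[symmetric] Let_def by simp
    then show ?thesis
      by (simp only: sum_distrib_left)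
  qed
  also have "\<dots> \<le> (\<Sum>i\<in>Basis. \<sigma> * l * (a * (s i)\<^sup>2 + b * (1 - K * (s i)\<^sup>2)))"
    unfolding l_def a_def b_def K_def s_def
    by (intro sum_mono second_fundamental_form_bound) (simp add: E)
  also have "\<dots> = \<sigma> * l * (a * (\<Sum>i\<in>Basis. (s i)\<^sup>2) + b * (real DIM('e) - K * (\<Sum>i\<in>Basis. (s i)\<^sup>2)))"
    by (simp add: sum_distrib_left[symmetric] sum.distrib sum_subtractf)
  also have "\<dots> = \<sigma> * l * ((real DIM('e) - 1) * b + a / K)"
    using K by (simp add: sum_s algebra_simps)
  finally show ?thesis
    unfolding l_def a_def b_def K_def .
qed

end

end

section \<open>Barriers\<close>

text \<open>
  In the variable \<open>S = V\<^sup>2\<phi>' / sqrt (V - V\<^sup>3\<phi>'\<^sup>2)\<close>, that is \<open>\<phi>' = S / (V sqrt (V + S\<^sup>2))\<close>, the curvature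
  expression of a radial graph becomes the first-order linear expression \<open>S' + (m - 1) S / \<rho>\<close>.
  Every real \<open>S\<close> gives a spacelike graph, and the graph becomes lightlike as \<open>S\<close> tends to \<open>\<plusminus>\<infinity>\<close>.
\<close>

lemma radial_profile_algebra:
  fixes V V' S S' W x k :: real
  assumes "V > 0" "W > 0" "x > 0" and W: "W\<^sup>2 = V + S\<^sup>2"
  defines "d1 \<equiv> S / (V * W)"
    and "d2 \<equiv> (S' * (V * W) - S * (V' * W + V * ((V' + 2 * S * S') / (2 * W)))) / (V * W)\<^sup>2"
  shows "1 / sqrt (V - V ^ 3 * d1\<^sup>2) * (k * (V\<^sup>2 * d1 / x)
      + (V * d2 + d1 * V' * (3 / 2 - V\<^sup>2 * d1\<^sup>2 / 2)) / (1 / V - V * d1\<^sup>2)) = k * S / x + S'"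
proof -
  have Vd: "V\<^sup>2 * d1\<^sup>2 = S\<^sup>2 / W\<^sup>2"
    using assms(1,2) by (simp add: d1_def power_mult_distrib power_divide)
  have K: "1 / V - V * d1\<^sup>2 = 1 / W\<^sup>2"
  proof -
    have "1 / V - V * d1\<^sup>2 = (1 - V\<^sup>2 * d1\<^sup>2) / V"
      using assms(1) by (simp add: field_simps power2_eq_square)
    also have "1 - V\<^sup>2 * d1\<^sup>2 = V / W\<^sup>2"
    proof -
      have "S\<^sup>2 = W\<^sup>2 - V"
        using W by simp
      then show ?thesis
        unfolding Vd using assms(2) by (simp add: diff_divide_distrib)
    qed
    finally show ?thesis
      using assms(1) by simp
  qed
  have "V - V ^ 3 * d1\<^sup>2 = V\<^sup>2 * (1 / V - V * d1\<^sup>2)"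
    using assms(1) by (simp add: field_simps power2_eq_square power3_eq_cube)
  then have "V - V ^ 3 * d1\<^sup>2 = (V / W)\<^sup>2"
    unfolding K by (simp add: power_divide)
  then have l: "1 / sqrt (V - V ^ 3 * d1\<^sup>2) = W / V"
    using assms(1,2) by simp
  have d2: "V * d2 = S' / W - S * V' / (V * W) - S * (V' + 2 * S * S') / (2 * W ^ 3)"
    using assms(1,2) unfolding d2_def by (simp add: field_simps power2_eq_square power3_eq_cube)
  have "W / V * ((V * d2 + d1 * V' * (3 / 2 - V\<^sup>2 * d1\<^sup>2 / 2)) / (1 / V - V * d1\<^sup>2))
      = W ^ 3 / V * (V * d2 + d1 * V' * (3 / 2 - S\<^sup>2 / W\<^sup>2 / 2))"
    unfolding K Vd by (simp add: power2_eq_square power3_eq_cube)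
  also have "\<dots> = (S' * W\<^sup>2 - S * V' * W\<^sup>2 / V - S * (V' + 2 * S * S') / 2) / V
      + S * V' * (3 / 2 * W\<^sup>2 - S\<^sup>2 / 2) / V\<^sup>2"
    unfolding d2 d1_def using assms(1,2)
    by (simp add: field_simps power2_eq_square power3_eq_cube)
  also have "\<dots> = S'"
    unfolding W using assms(1) by (simp add: field_simps power2_eq_square)
  finally have 1: "W / V * ((V * d2 + d1 * V' * (3 / 2 - V\<^sup>2 * d1\<^sup>2 / 2)) / (1 / V - V * d1\<^sup>2)) = S'" .
  have 2: "W / V * (k * (V\<^sup>2 * d1 / x)) = k * S / x"
    using assms(1-3) by (simp add: d1_def field_simps power2_eq_square)
  show ?thesis
    unfolding l distrib_left 1 2 ..
qed

text \<open>
  The barrier has \<open>S = \<epsilon> (\<rho> - s) - Q\<close>. Its curvature is at most \<open>\<epsilon>\<close>, since \<open>S \<le> \<epsilon> \<rho>\<close> for \<open>Q \<ge> 0\<close>. It grows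
  at least linearly at infinity because \<open>S\<close> is eventually positive and increasing. The function \<open>B\<close>
  is the height of a radial light ray, and a large \<open>Q\<close> makes the barrier fall almost as steeply as a
  light ray between the radii \<open>s\<close> and \<open>s + 1\<close>: any drop \<open>\<Delta>\<close> less than that of the light ray is
  exceeded.
\<close>

lemma radial_barrier_exists:
  fixes \<mu> s \<epsilon> \<Delta> :: real and B :: "real \<Rightarrow> real"
  assumes mu: "\<mu> > 0" and m: "m \<ge> 3" and s: "schw_radius m \<mu> < s" and \<epsilon>: "\<epsilon> > 0"
    and B: "\<And>x. schw_radius m \<mu> < x \<Longrightarrow> (B has_real_derivative 1 / schw_V m \<mu> x) (at x)"
    and \<Delta>: "\<Delta> < B (s + 1) - B s"
  obtains \<phi> \<phi>' \<phi>'' where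
    "\<And>x. schw_radius m \<mu> < x \<Longrightarrow> (\<phi> has_real_derivative \<phi>' x) (at x)"
    "\<And>x. schw_radius m \<mu> < x \<Longrightarrow> (\<phi>' has_real_derivative \<phi>'' x) (at x)"
    "\<Delta> < \<phi> s - \<phi> (s + 1)" "filterlim \<phi> at_top at_top"
    "\<And>x V V'. s \<le> x \<Longrightarrow> V = schw_V m \<mu> x \<Longrightarrow> V' = schw_V' m \<mu> x \<Longrightarrow>
      1 / sqrt (V - V ^ 3 * (\<phi>' x)\<^sup>2) * ((real m - 1) * (V\<^sup>2 * \<phi>' x / x)
        + (V * \<phi>'' x + \<phi>' x * V' * (3 / 2 - V\<^sup>2 * (\<phi>' x)\<^sup>2 / 2)) / (1 / V - V * (\<phi>' x)\<^sup>2))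
      \<le> real m * \<epsilon>"
proof -
  let ?R = "schw_radius m \<mu>"
  define J where "J = B (s + 1) - B s"
  \<comment> \<open>On \<open>[s, s + 1]\<close> this ensures \<open>S \<le> - A\<close>, so that the slope is at least the
    fraction \<open>A / (1 + A)\<close> of the light slope; \<open>A\<close> is chosen so that \<open>A / (1 + A) * J > \<Delta>\<close>.\<close>
  define A where "A = \<bar>J\<bar> / (J - \<Delta>)"
  define Q where "Q = A + \<epsilon>"
  have A: "A \<ge> 0"
    using \<Delta> by (simp add: A_def J_def)
  define V where "V = schw_V m \<mu>"
  define S where "S x = \<epsilon> * (x - s) - Q" for x
  define W where "W x = sqrt (V x + (S x)\<^sup>2)" for x
  define \<phi>' where "\<phi>' x = S x / (V x * W x)" for x
  define \<phi>'' where "\<phi>'' x = (\<epsilon> * (V x * W x) - S x * (schw_V' m \<mu> x * W x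
      + V x * ((schw_V' m \<mu> x + 2 * S x * \<epsilon>) / (2 * W x)))) / (V x * W x)\<^sup>2" for x
  have R: "?R > 0"
    using schw_radius_pos[OF mu] .
  have V: "0 < V x" "V x < 1" if "?R < x" for x
    using schw_V_bounds[OF mu m that] by (auto simp: V_def)
  have W2: "(W x)\<^sup>2 = V x + (S x)\<^sup>2" and W: "W x > 0" if "?R < x" for x
  proof -
    have "V x + (S x)\<^sup>2 > 0"
      using V[OF that] by (simp add: add_pos_nonneg)
    then show "(W x)\<^sup>2 = V x + (S x)\<^sup>2" "W x > 0"
      by (simp_all add: W_def)
  qed
  have Wle: "W x \<le> 1 + \<bar>S x\<bar>" if "?R < x" for x
  proof -
    have "(W x)\<^sup>2 \<le> (1 + \<bar>S x\<bar>)\<^sup>2"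
      using V[OF that] by (simp add: W2[OF that] power2_sum)
    then show ?thesis
      by (rule power2_le_imp_le) simp
  qed
  have dV: "(V has_real_derivative schw_V' m \<mu> x) (at x)" if "?R < x" for x
    unfolding V_def using schw_V_has_derivative[of x m \<mu>] that R by simp
  have dS: "(S has_real_derivative \<epsilon>) (at x)" for x
    unfolding S_def[abs_def] by (auto intro!: derivative_eq_intros)
  have dW: "(W has_real_derivative (schw_V' m \<mu> x + 2 * S x * \<epsilon>) / (2 * W x)) (at x)" if "?R < x" for x
  proof -
    have "((\<lambda>x. V x + (S x)\<^sup>2) has_real_derivative schw_V' m \<mu> x + 2 * S x * \<epsilon>) (at x)"
      using DERIV_add[OF dV[OF that] DERIV_power[OF dS[of x], of 2]] by (simp add: mult_ac)
    from DERIV_chain2[OF DERIV_real_sqrt this]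
    show ?thesis
      using W[OF that] unfolding W_def[abs_def] by (simp add: field_simps)
  qed
  have d\<phi>': "(\<phi>' has_real_derivative \<phi>'' x) (at x)" if "?R < x" for x
  proof -
    have "(\<phi>' has_real_derivative (\<epsilon> * (V x * W x) - S x * (schw_V' m \<mu> x * W x
      + (schw_V' m \<mu> x + 2 * S x * \<epsilon>) / (2 * W x) * V x)) / (V x * W x * (V x * W x))) (at x)"
      unfolding \<phi>'_def[abs_def]
      by (intro DERIV_divide DERIV_mult dS dV dW that) (use V[OF that] W[OF that] in simp)
    then show ?thesis
      by (simp add: \<phi>''_def power2_eq_square mult.commute)
  qed
  have "\<exists>F. \<forall>x :: real. ereal ?R < x \<longrightarrow> x < \<infinity> \<longrightarrow> (F has_vector_derivative \<phi>' x) (at x)"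
    by (rule einterval_antiderivative) (use d\<phi>' DERIV_isCont in auto)
  then obtain \<phi> where "\<forall>x :: real. ereal ?R < x \<longrightarrow> x < \<infinity> \<longrightarrow> (\<phi> has_vector_derivative \<phi>' x) (at x)"
    by blast
  then have d\<phi>: "(\<phi> has_real_derivative \<phi>' x) (at x)" if "?R < x" for x
    using that by (simp add: has_real_derivative_iff_has_vector_derivative)
  show ?thesis
  proof
    show "(\<phi> has_real_derivative \<phi>' x) (at x)" "(\<phi>' has_real_derivative \<phi>'' x) (at x)" if "?R < x" for x
      using d\<phi> d\<phi>' that by auto
    show "\<Delta> < \<phi> s - \<phi> (s + 1)"
    proof -
      define \<kappa> where "\<kappa> = A / (1 + A)"
      have "\<phi> (s + 1) + \<kappa> * B (s + 1) \<le> \<phi> s + \<kappa> * B s"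
      proof (rule DERIV_nonpos_imp_nonincreasing[of s "s + 1" "\<lambda>x. \<phi> x + \<kappa> * B x"])
        fix x assume x: "s \<le> x" "x \<le> s + 1"
        then have Rx: "?R < x"
          using s by simp
        have "\<epsilon> * (x - s) \<le> \<epsilon> * 1"
          using x \<epsilon> by (intro mult_left_mono) auto
        then have SA: "S x \<le> - A"
          by (simp add: S_def Q_def)
        have "\<kappa> \<le> - S x / (1 - S x)"
          using SA A by (simp add: \<kappa>_def field_simps)
        also have "\<dots> \<le> - S x / W x"
          using Wle[OF Rx] W[OF Rx] SA A by (intro divide_left_mono) auto
        finally have "\<kappa> / V x \<le> - S x / W x / V x"
          using V[OF Rx] by (intro divide_right_mono) auto
        then have "\<phi>' x + \<kappa> * (1 / V x) \<le> 0"
          by (simp add: \<phi>'_def mult.commute)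
        moreover have "((\<lambda>x. \<phi> x + \<kappa> * B x) has_real_derivative \<phi>' x + \<kappa> * (1 / V x)) (at x)"
          unfolding V_def by (intro DERIV_add d\<phi> DERIV_cmult B Rx)
        ultimately show "\<exists>y. ((\<lambda>x. \<phi> x + \<kappa> * B x) has_real_derivative y) (at x) \<and> y \<le> 0"
          by blast
      qed simp
      then have "\<kappa> * J \<le> \<phi> s - \<phi> (s + 1)"
        by (simp add: J_def algebra_simps)
      moreover have "\<Delta> < \<kappa> * J"
      proof -
        have pos: "J - \<Delta> > 0"
          using \<Delta> by (simp add: J_def)
        have "(J - \<Delta>) * A = \<bar>J\<bar>"
          using pos by (simp add: A_def)
        then have "\<Delta> * (1 + A) < A * J"
          using pos by (simp add: algebra_simps)
        then show ?thesis
          using A by (simp add: \<kappa>_def field_simps)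
      qed
      ultimately show ?thesis
        by simp
    qed
    show "filterlim \<phi> at_top at_top"
    proof -
      define x1 where "x1 = s + (1 + Q) / \<epsilon>"
      have Q: "Q \<ge> 0"
        using A \<epsilon> by (simp add: Q_def)
      have x1: "?R < x1"
        using s Q \<epsilon> divide_nonneg_pos[of "1 + Q" \<epsilon>] unfolding x1_def by linarith
      have le: "\<phi> x1 + (x - x1) / 2 \<le> \<phi> x" if "x1 \<le> x" for x
      proof -
        have "\<phi> x1 - x1 / 2 \<le> \<phi> x - x / 2"
        proof (rule DERIV_nonneg_imp_nondecreasing[OF that, of "\<lambda>x. \<phi> x - x / 2"])
          fix y assume y: "x1 \<le> y" "y \<le> x"
          then have Ry: "?R < y"
            using x1 by simp
          have "\<epsilon> * ((1 + Q) / \<epsilon>) \<le> \<epsilon> * (y - s)"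
            using y \<epsilon> by (intro mult_left_mono) (auto simp: x1_def)
          then have S1: "1 \<le> S y"
            using \<epsilon> by (simp add: S_def)
          have "W y \<le> 2 * S y"
            using Wle[OF Ry] S1 by simp
          then have "1 / 2 \<le> S y / W y"
            using W[OF Ry] by (simp add: field_simps)
          also have "\<dots> \<le> S y / W y / V y"
            using V[OF Ry] S1 W[OF Ry] by (simp add: field_simps mult_left_le)
          finally have "0 \<le> \<phi>' y - 1 / 2"
            by (simp add: \<phi>'_def mult.commute)
          moreover have "((\<lambda>x. \<phi> x - x / 2) has_real_derivative \<phi>' y - 1 / 2) (at y)"
            by (intro DERIV_diff d\<phi> Ry DERIV_cdivide DERIV_ident)
          ultimately show "\<exists>d. ((\<lambda>x. \<phi> x - x / 2) has_real_derivative d) (at y) \<and> 0 \<le> d"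
            by blast
        qed
        then show ?thesis
          by (simp add: field_simps)
      qed
      have "filterlim (\<lambda>x. \<phi> x1 - x1 / 2 + 1 / 2 * x) at_top at_top"
        by (intro filterlim_tendsto_add_at_top[OF tendsto_const]
            filterlim_tendsto_pos_mult_at_top[OF tendsto_const _ filterlim_ident]) simp
      then show ?thesis
      proof (rule filterlim_at_top_mono)
        show "eventually (\<lambda>x. \<phi> x1 - x1 / 2 + 1 / 2 * x \<le> \<phi> x) at_top"
          using eventually_ge_at_top[of x1]
        proof eventually_elim
          case (elim x)
          then show ?case
            using le[OF elim] by (simp add: diff_divide_distrib)
        qed
      qed
    qed
    fix x Vx V'x assume x: "s \<le> x" and Vx: "Vx = schw_V m \<mu> x" and V'x: "V'x = schw_V' m \<mu> x"
    then have Rx: "?R < x" and x0: "x > 0"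
      using s R by auto
    have "1 / sqrt (Vx - Vx ^ 3 * (\<phi>' x)\<^sup>2) * ((real m - 1) * (Vx\<^sup>2 * \<phi>' x / x)
        + (Vx * \<phi>'' x + \<phi>' x * V'x * (3 / 2 - Vx\<^sup>2 * (\<phi>' x)\<^sup>2 / 2)) / (1 / Vx - Vx * (\<phi>' x)\<^sup>2))
      = (real m - 1) * S x / x + \<epsilon>"
      unfolding Vx V'x V_def[symmetric] \<phi>'_def \<phi>''_def
      by (rule radial_profile_algebra[OF V(1)[OF Rx] W[OF Rx] x0 W2[OF Rx]])
    also have "\<dots> \<le> (real m - 1) * \<epsilon> + \<epsilon>"
    proof -
      have "S x \<le> \<epsilon> * x"
        using \<epsilon> s R A by (simp add: S_def Q_def algebra_simps add_increasing)
      then have "S x / x \<le> \<epsilon>"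
        using x0 by (simp add: divide_le_eq)
      then have "(real m - 1) * (S x / x) \<le> (real m - 1) * \<epsilon>"
        using m by (intro mult_left_mono) auto
      then show ?thesis
        by simp
    qed
    finally show "1 / sqrt (Vx - Vx ^ 3 * (\<phi>' x)\<^sup>2) * ((real m - 1) * (Vx\<^sup>2 * \<phi>' x / x)
        + (Vx * \<phi>'' x + \<phi>' x * V'x * (3 / 2 - Vx\<^sup>2 * (\<phi>' x)\<^sup>2 / 2)) / (1 / Vx - Vx * (\<phi>' x)\<^sup>2))
      \<le> real m * \<epsilon>"
      by (simp add: algebra_simps)
  qed
qed

section \<open>Charts of a hypersurface as graphs\<close>

lemma smooth_on_twice_differentiable:
  assumes "smooth_on X k" "x \<in> X"
  shows "k differentiable at x" "(\<lambda>x. frechet_derivative k (at x) v) differentiable at x"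
proof -
  have "Ck_on (Suc (Suc 0)) X k"
    using assms(1) by (simp only: smooth_on_def)
  then show "k differentiable at x" "(\<lambda>x. frechet_derivative k (at x) v) differentiable at x"
    using assms(2) by auto
qed

lemma schw_chart_exterior:
  fixes p :: "(real \<times> 'e::euclidean_space) \<times> real"
  assumes "p \<in> schw_base \<mu> \<times> UNIV" "\<mu> > 0"
  shows "norm (fst (schw_chart p)) = fst (fst p)" "schw_radius DIM('e) \<mu> < fst (fst p)"
proof -
  show *: "schw_radius DIM('e) \<mu> < fst (fst p)"
    using assms by (auto simp: schw_base_def)
  then show "norm (fst (schw_chart p)) = fst (fst p)"
    using assms schw_radius_pos[of \<mu> "DIM('e)"] by (auto simp: schw_base_def schw_chart_def)
qed

lemma chart_of_spacelike_hypersurface: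
  fixes \<psi> :: "'a::topological_space \<Rightarrow> (real \<times> 'e::euclidean_space) \<times> real"
  assumes mu: "\<mu> > 0" and dim: "DIM('e) \<ge> 3" and hyp: "spacelike_hypersurface \<mu> M \<A> \<psi>"
    and chart: "(U, \<kappa>) \<in> \<A>"
  shows "spacelike_patch \<mu> (schw_chart \<circ> \<psi> \<circ> inv_into U \<kappa>) (\<kappa> ` U)"
proof -
  define k where "k = \<psi> \<circ> inv_into U \<kappa>"
  define f where "f = schw_chart \<circ> k"
  let ?\<Omega> = "\<kappa> ` U"
  have op: "open ?\<Omega>" and UM: "U \<subseteq> M" and im: "\<psi> ` M \<subseteq> schw_base \<mu> \<times> UNIV"
    and sm: "smooth_on ?\<Omega> k"
    and pos: "\<And>y e. y \<in> ?\<Omega> \<Longrightarrow> e \<noteq> 0 \<Longrightarrow>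
      schw_metric \<mu> (k y) (frechet_derivative k (at y) e) (frechet_derivative k (at y) e) > 0"
    using hyp chart by (auto simp: spacelike_hypersurface_def smooth_manifold_def Let_def k_def)
  have kin: "k y \<in> schw_base \<mu> \<times> UNIV" if "y \<in> ?\<Omega>" for y
    using that im UM inv_into_into[OF that] by (auto simp: k_def)
  have dk: "(k has_derivative frechet_derivative k (at y)) (at y)" if "y \<in> ?\<Omega>" for y
    using smooth_on_twice_differentiable(1)[OF sm that] frechet_derivative_works by blast
  define Df where "Df y e = (fst (fst (k y)) *\<^sub>R snd (fst (frechet_derivative k (at y) e))
      + fst (fst (frechet_derivative k (at y) e)) *\<^sub>R snd (fst (k y)), snd (frechet_derivative k (at y) e))" for y e
  have df: "(f has_derivative Df y) (at y)" if "y \<in> ?\<Omega>" for y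
    unfolding f_def o_def schw_chart_def Df_def
    by (intro has_derivative_Pair has_derivative_scaleR has_derivative_fst has_derivative_snd dk that)
  have fdf: "frechet_derivative f (at y) = Df y" if "y \<in> ?\<Omega>" for y
    using frechet_derivative_at[OF df[OF that]] by simp
  have "spacelike_patch \<mu> f ?\<Omega>"
  proof
    show "f differentiable at y" if "y \<in> ?\<Omega>" for y
      using df[OF that] by (rule differentiableI)
    show ext: "schw_radius DIM('e) \<mu> < norm (fst (f y))" if "y \<in> ?\<Omega>" for y
      using schw_chart_exterior[OF kin[OF that] mu] by (simp add: f_def)
    show "(\<lambda>y. frechet_derivative f (at y) e) differentiable at y" if y: "y \<in> ?\<Omega>" for y e
    proof -
      obtain k2 where k2: "((\<lambda>y. frechet_derivative k (at y) e) has_derivative k2) (at y)"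
        using smooth_on_twice_differentiable(2)[OF sm y] by (auto simp: differentiable_def)
      note k1 = dk[OF y]
      have "\<exists>F. ((\<lambda>y. Df y e) has_derivative F) (at y)"
        unfolding Df_def
        by (rule exI, rule has_derivative_Pair[OF has_derivative_add[OF
              has_derivative_scaleR[OF has_derivative_fst[OF has_derivative_fst[OF k1]]
                has_derivative_snd[OF has_derivative_fst[OF k2]]]
              has_derivative_scaleR[OF has_derivative_fst[OF has_derivative_fst[OF k2]]
                has_derivative_snd[OF has_derivative_fst[OF k1]]]] has_derivative_snd[OF k2]])
      then obtain F where F: "((\<lambda>y. Df y e) has_derivative F) (at y)"
        by blast
      have "((\<lambda>y. frechet_derivative f (at y) e) has_derivative F) (at y)"
        by (rule has_derivative_transform_within_open[OF F op y]) (simp add: fdf)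
      then show ?thesis
        by (rule differentiableI)
    qed
    show "0 < schw_metric_coord \<mu> (f y) (frechet_derivative f (at y) e) (frechet_derivative f (at y) e)"
      if y: "y \<in> ?\<Omega>" and e: "e \<noteq> 0" for y e
    proof -
      have "norm (fst (f y)) > 0"
        using ext[OF y] schw_radius_pos[OF mu, of "DIM('e)"] by linarith
      then have "fst (f y) \<noteq> 0"
        by auto
      from differentiableI[OF schw_param_has_derivative[OF this]]
      have dp: "(schw_param has_derivative frechet_derivative schw_param (at (f y))) (at (f y))"
        by (rule frechet_derivative_works[THEN iffD1])
      have pf: "schw_param (f y) = k y" if "y \<in> ?\<Omega>" for y
        using schw_param_chart[OF kin[OF that] mu] by (simp add: f_def)
      have "(k has_derivative (\<lambda>e. frechet_derivative schw_param (at (f y)) (Df y e))) (at y)"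
        by (rule has_derivative_transform_within_open[OF has_derivative_compose[OF df[OF y] dp] op y])
          (simp add: pf)
      then have "(\<lambda>e. frechet_derivative schw_param (at (f y)) (Df y e)) = frechet_derivative k (at y)"
        by (rule frechet_derivative_at)
      then have "frechet_derivative k (at y) e = frechet_derivative schw_param (at (f y)) (Df y e)"
        by (metis (no_types))
      then show ?thesis
        using pos[OF y e] by (simp add: schw_metric_coord_def fdf[OF y] pf[OF y])
    qed
  qed (use mu dim op in auto)
  then show ?thesis
    by (simp add: f_def k_def comp_assoc)
qed

context spacelike_patch
begin

lemma radial_slope_bound:
  assumes z: "z \<in> \<Omega>" and e: "fst (D z e) = fst (f z) /\<^sub>R r z"
  shows "\<bar>snd (D z e)\<bar> < 1 / V z"
proof -
  note V = V_bounds[OF z] and r = r_pos[OF z]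
  have "fst (D z e) \<noteq> 0"
    using r by (auto simp: e)
  then have "e \<noteq> 0"
    using linear_0[OF linear_fst_D[OF z]] by auto
  then have "0 < G (f z) (D z e) (D z e)"
    using spacelike z by blast
  also have "\<dots> = 1 / V z - V z * (snd (D z e))\<^sup>2"
    using r by (simp add: G_eq[OF z] e dot_square_norm schw_A_def power2_eq_square field_simps)
  finally have "(V z * snd (D z e))\<^sup>2 < 1\<^sup>2"
    using V by (simp add: field_simps power2_eq_square)
  then have "\<bar>V z * snd (D z e)\<bar> < 1"
    by (metis abs_1 power2_less_imp_less abs_ge_zero power2_abs zero_le_one)
  then show ?thesis
    using V by (simp add: abs_mult field_simps)
qed

text \<open>
  By the inverse function theorem, a continuous local inverse of the projection to the base is
  differentiable.
\<close>

lemma graph_has_derivative: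
  assumes z: "\<zeta> y \<in> \<Omega>" and cont: "continuous (at y) \<zeta>" and T: "open T" "y \<in> T"
    and inv: "\<And>y. y \<in> T \<Longrightarrow> fst (f (\<zeta> y)) = y"
  obtains \<zeta>' where "(\<zeta> has_derivative \<zeta>') (at y)" "\<And>h. fst (D (\<zeta> y) (\<zeta>' h)) = h"
proof -
  obtain g where g: "linear g" "\<And>e. g (fst (D (\<zeta> y) e)) = e" "\<And>h. fst (D (\<zeta> y) (g h)) = h"
    using linear_injective_isomorphism[OF linear_fst_D[OF z] inj_fst_D[OF z]] by metis
  have "(\<zeta> has_derivative g) (at y)"
  proof (rule has_derivative_inverse_basic[of "\<lambda>x. fst (f x)" "\<lambda>e. fst (D (\<zeta> y) e)" \<zeta> y g T])
    show "((\<lambda>x. fst (f x)) has_derivative (\<lambda>e. fst (D (\<zeta> y) e))) (at (\<zeta> y))"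
      by (rule has_derivative_fst[OF has_derivative_D[OF z]])
    show "bounded_linear g"
      using g(1) linear_conv_bounded_linear by blast
  qed (use g cont T inv in auto)
  then show ?thesis
    using that g(3) by blast
qed

end

section \<open>Limits at infinity\<close>

lemma liminf_end_pos_imp_eventually_ge:
  assumes "liminf_end M r H > 0"
  obtains c s where "c > 0" "\<And>x. x \<in> M \<Longrightarrow> s \<le> r x \<Longrightarrow> c \<le> H x"
proof -
  define I where "I s = (INF x\<in>{x\<in>M. s \<le> r x}. ereal (H x))" for s
  have mono: "I s \<le> I s'" if "s \<le> s'" for s s'
    unfolding I_def by (rule INF_superset_mono) (use that in auto)
  have "(I \<longlongrightarrow> (SUP s. I s)) at_top"
  proof (rule order_tendstoI)
    show "eventually (\<lambda>s. a < I s) at_top" if a: "a < (SUP s. I s)" for a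
    proof -
      obtain s0 where s0: "a < I s0"
        using a by (auto simp: less_SUP_iff)
      have "a < I s" if "s0 \<le> s" for s
        by (rule less_le_trans[OF s0 mono[OF that]])
      then show ?thesis
        by (rule eventually_mono[OF eventually_ge_at_top[of s0]])
    qed
    show "eventually (\<lambda>s. I s < a) at_top" if "(SUP s. I s) < a" for a
      using that by (intro always_eventually allI) (meson SUP_upper UNIV_I le_less_trans)
  qed
  then have "liminf_end M r H = (SUP s. I s)"
    unfolding liminf_end_def I_def[symmetric] by (intro tendsto_Lim) auto
  then obtain s where "0 < I s"
    using assms by (auto simp: less_SUP_iff)
  then obtain c where c: "0 < ereal c" "ereal c < I s"
    using ereal_dense2 by blast
  show ?thesis
  proof
    show "c > 0"
      using c(1) by simp
    fix x assume "x \<in> M" "s \<le> r x"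
    then have "I s \<le> ereal (H x)"
      unfolding I_def by (intro INF_lower) auto
    with c(2) have "ereal c < ereal (H x)"
      by (rule less_le_trans)
    then show "c \<le> H x"
      by simp
  qed
qed

lemma limsup_end_neg_imp_eventually_le:
  assumes "limsup_end M r H < 0"
  obtains c s where "c > 0" "\<And>x. x \<in> M \<Longrightarrow> s \<le> r x \<Longrightarrow> H x \<le> - c"
proof -
  define I where "I s = (SUP x\<in>{x\<in>M. s \<le> r x}. ereal (H x))" for s
  have mono: "I s' \<le> I s" if "s \<le> s'" for s s'
    unfolding I_def by (rule SUP_subset_mono) (use that in auto)
  have "(I \<longlongrightarrow> (INF s. I s)) at_top"
  proof (rule order_tendstoI)
    show "eventually (\<lambda>s. I s < a) at_top" if a: "(INF s. I s) < a" for a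
    proof -
      obtain s0 where s0: "I s0 < a"
        using a by (auto simp: INF_less_iff)
      have "I s < a" if "s0 \<le> s" for s
        by (rule le_less_trans[OF mono[OF that] s0])
      then show ?thesis
        by (rule eventually_mono[OF eventually_ge_at_top[of s0]])
    qed
    show "eventually (\<lambda>s. a < I s) at_top" if "a < (INF s. I s)" for a
      using that by (intro always_eventually allI) (meson INF_lower UNIV_I less_le_trans)
  qed
  then have "limsup_end M r H = (INF s. I s)"
    unfolding limsup_end_def I_def[symmetric] by (intro tendsto_Lim) auto
  then obtain s where "I s < 0"
    using assms by (auto simp: INF_less_iff)
  then obtain c where c: "I s < ereal c" "ereal c < 0"
    using ereal_dense2 by blast
  show ?thesis
  proof
    show "- c > 0"
      using c(2) by simp
    fix x assume "x \<in> M" "s \<le> r x"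
    then have "ereal (H x) \<le> I s"
      unfolding I_def by (intro SUP_upper) auto
    then have "ereal (H x) < ereal c"
      using c(1) by (rule le_less_trans)
    then show "H x \<le> - (- c)"
      by simp
  qed
qed

section \<open>The hypersurface as an entire graph\<close>

definition exterior_region :: "real \<Rightarrow> 'e::euclidean_space set" where
  "exterior_region \<mu> = {y. schw_radius DIM('e) \<mu> < norm y}"

lemma open_exterior_region: "open (exterior_region \<mu>)"
  unfolding exterior_region_def by (intro open_Collect_less continuous_intros)

lemma base_polar_homeomorphism:
  assumes "\<mu> > 0"
  shows "homeomorphism (schw_base \<mu>) (exterior_region \<mu> :: 'e::euclidean_space set)
    (\<lambda>q. fst q *\<^sub>R snd q) (\<lambda>y. (norm y, y /\<^sub>R norm y))"
proof (rule homeomorphismI)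
  let ?R = "schw_radius DIM('e) \<mu>"
  have R: "?R > 0"
    using assms by (rule schw_radius_pos)
  have n0: "y \<noteq> 0" if "?R < norm y" for y :: 'e
    using R that by auto
  show "continuous_on (schw_base \<mu>) (\<lambda>q :: real \<times> 'e. fst q *\<^sub>R snd q)"
    by (intro continuous_intros)
  show "continuous_on (exterior_region \<mu>) (\<lambda>y :: 'e. (norm y, y /\<^sub>R norm y))"
    using R by (intro continuous_intros) (auto simp: exterior_region_def)
  show "(\<lambda>q. fst q *\<^sub>R snd q) ` schw_base \<mu> \<subseteq> (exterior_region \<mu> :: 'e set)"
    using R by (auto simp: schw_base_def exterior_region_def)
  show "(\<lambda>y :: 'e. (norm y, y /\<^sub>R norm y)) ` exterior_region \<mu> \<subseteq> schw_base \<mu>"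
    using n0 by (auto simp: schw_base_def exterior_region_def)
  show "(norm (fst q *\<^sub>R snd q), (fst q *\<^sub>R snd q) /\<^sub>R norm (fst q *\<^sub>R snd q)) = q"
    if "q \<in> schw_base \<mu>" for q :: "real \<times> 'e"
    using that R by (auto simp: schw_base_def prod_eq_iff)
  show "fst (norm y, y /\<^sub>R norm y) *\<^sub>R snd (norm y, y /\<^sub>R norm y) = y" if "y \<in> exterior_region \<mu>" for y :: 'e
    using that n0 by (auto simp: exterior_region_def)
qed

lemma simply_connected_exterior_region:
  assumes "\<mu> > 0" "DIM('e) \<ge> 3"
  shows "simply_connected (exterior_region \<mu> :: 'e::euclidean_space set)"
proof -
  have "simply_connected (schw_base \<mu> :: (real \<times> 'e) set)"
    unfolding schw_base_def
    by (intro simply_connected_Times convex_imp_simply_connected simply_connected_sphere assms) auto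
  then show ?thesis
    using base_polar_homeomorphism[OF assms(1), where 'e = 'e] homeomorphic_simply_connected
    unfolding homeomorphic_def by blast
qed

text \<open>
  The base is simply connected for \<open>m \<ge> 3\<close>, so the covering has a section \<open>sec\<close> over it, and the
  image of the section is the graph of \<open>height\<close>. The section replaces compactness arguments in \<open>M\<close> by such in the
  Euclidean space of the chart.
\<close>

locale covering_hypersurface =
  fixes \<mu> :: real and M :: "'a::topological_space set"
    and \<A> :: "('a set \<times> ('a \<Rightarrow> 'e::euclidean_space)) set"
    and \<psi> :: "'a \<Rightarrow> (real \<times> 'e) \<times> real"
  assumes dim: "DIM('e) \<ge> 3" and mu: "\<mu> > 0"
    and hyp: "spacelike_hypersurface \<mu> M \<A> \<psi>"
    and cov: "covering_space M (fst \<circ> \<psi>) (schw_base \<mu>)"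
begin

definition proj :: "'a \<Rightarrow> 'e" where
  "proj x = fst (schw_chart (\<psi> x))"

lemma covering_proj: "covering_space M proj (exterior_region \<mu>)"
proof -
  have "(\<lambda>q. fst q *\<^sub>R snd q) \<circ> (fst \<circ> \<psi>) = proj"
    by (auto simp: proj_def schw_chart_def)
  then show ?thesis
    using covering_space_homeomorphic_base[OF cov base_polar_homeomorphism[OF mu]] by simp
qed

lemma Hausdorff_M: "Hausdorff_space (top_of_set M)"
  using hyp by (simp add: spacelike_hypersurface_def smooth_manifold_def)

lemma norm_proj: "x \<in> M \<Longrightarrow> norm (proj x) = fst (fst (\<psi> x))"
  unfolding proj_def using hyp by (intro schw_chart_exterior(1)[OF _ mu]) (auto simp: spacelike_hypersurface_def)

definition sec :: "'e \<Rightarrow> 'a" where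
  "sec = (SOME g. continuous_on (exterior_region \<mu>) g \<and> g \<in> exterior_region \<mu> \<rightarrow> M \<and>
    (\<forall>y\<in>exterior_region \<mu>. proj (g y) = y))"

lemma sec:
  "continuous_on (exterior_region \<mu>) sec" "y \<in> exterior_region \<mu> \<Longrightarrow> sec y \<in> M"
  "y \<in> exterior_region \<mu> \<Longrightarrow> proj (sec y) = y"
proof -
  have "(0::'e) \<notin> exterior_region \<mu>"
    using schw_radius_pos[OF mu, of "DIM('e)"] by (auto simp: exterior_region_def)
  then have "exterior_region \<mu> \<noteq> (UNIV :: 'e set)"
    by blast
  then obtain g where "continuous_on (exterior_region \<mu>) g" "g \<in> exterior_region \<mu> \<rightarrow> M"
    "\<And>y. y \<in> exterior_region \<mu> \<Longrightarrow> proj (g y) = y"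
    using covering_space_section[OF covering_proj open_exterior_region _
        simply_connected_exterior_region[OF mu dim] Hausdorff_M] by blast
  then have "\<exists>g. continuous_on (exterior_region \<mu>) g \<and> g \<in> exterior_region \<mu> \<rightarrow> M \<and>
    (\<forall>y\<in>exterior_region \<mu>. proj (g y) = y)"
    by blast
  from someI_ex[OF this]
  have s: "continuous_on (exterior_region \<mu>) sec \<and> sec \<in> exterior_region \<mu> \<rightarrow> M \<and>
    (\<forall>y\<in>exterior_region \<mu>. proj (sec y) = y)"
    unfolding sec_def .
  then show "continuous_on (exterior_region \<mu>) sec" "y \<in> exterior_region \<mu> \<Longrightarrow> sec y \<in> M"
    "y \<in> exterior_region \<mu> \<Longrightarrow> proj (sec y) = y"
    by auto
qed

definition height :: "'e \<Rightarrow> real" where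
  "height y = snd (\<psi> (sec y))"

lemma open_sec_preimage:
  assumes "openin (top_of_set M) T"
  shows "open (exterior_region \<mu> \<inter> sec -` T)"
proof -
  have "openin (top_of_set (exterior_region \<mu>)) (exterior_region \<mu> \<inter> sec -` T)"
    using sec by (intro continuous_openin_preimage[OF _ _ assms]) auto
  then show ?thesis
    using open_exterior_region openin_open_eq by blast
qed

text \<open>
  Around each of its points the graph coincides with a local parametrization of the hypersurface, in
  both directions: \<open>\<zeta>\<close> parametrizes it by points of the base, and conversely all values of \<open>f\<close> near
  \<open>z\<close> lie on the graph. The latter holds since, near \<open>sec y\<close>, the projection is injective and \<open>sec\<close>
  is continuous.
\<close>

lemma graph_patch:
  assumes y: "y \<in> exterior_region \<mu>"
  obtains f \<Omega> z \<zeta> T where "spacelike_patch \<mu> f \<Omega>" "z \<in> \<Omega>" "f z = (y, height y)"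
    "mean_curvature \<mu> \<A> \<psi> (sec y) = mean_curvature_param \<mu> f z"
    "eventually (\<lambda>v. snd (f v) = height (fst (f v))) (nhds z)"
    "open T" "y \<in> T" "\<zeta> y = z" "continuous (at y) \<zeta>" "\<And>y. y \<in> T \<Longrightarrow> f (\<zeta> y) = (y, height y)"
proof -
  have xM: "sec y \<in> M"
    by (rule sec(2)[OF y])
  have "\<exists>c. c \<in> \<A> \<and> sec y \<in> fst c"
  proof -
    have "sec y \<in> (\<Union>(U, \<phi>)\<in>\<A>. U)"
      using xM hyp by (auto simp: spacelike_hypersurface_def smooth_manifold_def)
    then show ?thesis
      by force
  qed
  note c = someI_ex[OF this]
  obtain U \<kappa> where U\<kappa>: "(SOME c. c \<in> \<A> \<and> sec y \<in> fst c) = (U, \<kappa>)"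
    by (rule prod.exhaust)
  have chart: "(U, \<kappa>) \<in> \<A>" and xU: "sec y \<in> U"
    using c[unfolded U\<kappa>] by simp_all
  define i where "i = inv_into U \<kappa>"
  define f where "f = schw_chart \<circ> \<psi> \<circ> i"
  define z where "z = \<kappa> (sec y)"
  have mc: "mean_curvature \<mu> \<A> \<psi> (sec y) = mean_curvature_param \<mu> f z"
    unfolding mean_curvature_def U\<kappa> f_def i_def z_def by simp
  have oU: "openin (top_of_set M) U" and oO: "open (\<kappa> ` U)" and hom: "homeomorphism U (\<kappa> ` U) \<kappa> i"
    using hyp chart unfolding i_def by (auto simp: spacelike_hypersurface_def smooth_manifold_def)
  have UM: "U \<subseteq> M"
    using oU openin_imp_subset by blast
  have i\<kappa>: "i (\<kappa> x) = x" if "x \<in> U" for x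
    using hom that by (simp add: homeomorphism_def)
  have iU: "i v \<in> U" if "v \<in> \<kappa> ` U" for v
    using hom that by (auto simp: homeomorphism_def)
  have f_sec: "f (\<kappa> (sec y)) = (y, height y)" if "y \<in> exterior_region \<mu>" "sec y \<in> U" for y
    using sec(3)[OF that(1)] i\<kappa>[OF that(2)] by (simp add: f_def height_def proj_def schw_chart_def)
  have contp: "continuous_on M proj"
    using covering_proj covering_space_imp_continuous by blast
  have ff: "fst (f v) = proj (i v)" "snd (f v) = snd (\<psi> (i v))" for v
    by (simp_all add: f_def proj_def schw_chart_def)
  obtain W q u where W: "sec y \<in> W" "openin (top_of_set M) W" "homeomorphism W u proj q"
    using covering_space_local_homeomorphism[OF covering_proj xM] by metis
  have inj: "inj_on proj W"
    using homeomorphism_apply1[OF W(3)] by (rule inj_on_inverseI)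
  have conti: "continuous_on (\<kappa> ` U) i"
    using hom by (simp add: homeomorphism_def)
  have conti2: "continuous_on (\<kappa> ` U) (proj \<circ> i)"
    by (rule continuous_on_compose[OF conti continuous_on_subset[OF contp]]) (use iU UM in auto)
  have "eventually (\<lambda>v. snd (f v) = height (fst (f v))) (nhds z)"
  proof -
    define N where "N = (\<kappa> ` U \<inter> i -` W) \<inter> (\<kappa> ` U \<inter> (proj \<circ> i) -` (exterior_region \<mu> \<inter> sec -` W))"
    have "openin (top_of_set (\<kappa> ` U)) (\<kappa> ` U \<inter> i -` W)"
      by (rule continuous_openin_preimage[OF conti _ W(2)]) (use iU UM in auto)
    moreover have "openin (top_of_set (\<kappa> ` U)) (\<kappa> ` U \<inter> (proj \<circ> i) -` (exterior_region \<mu> \<inter> sec -` W))"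
      by (rule continuous_openin_preimage_gen[OF conti2 open_sec_preimage[OF W(2)]])
    ultimately have "openin (top_of_set (\<kappa> ` U)) N"
      unfolding N_def by (rule openin_Int)
    then have "open N"
      using oO openin_open_eq by blast
    moreover have "z \<in> N"
      using xU W(1) y by (auto simp: N_def z_def i\<kappa> sec(3))
    moreover have "snd (f v) = height (fst (f v))" if v: "v \<in> N" for v
    proof -
      have "proj (i v) \<in> exterior_region \<mu>" "sec (proj (i v)) \<in> W" "i v \<in> W"
        using v by (auto simp: N_def)
      then have "sec (proj (i v)) = i v"
        using inj sec(3) by (auto simp: inj_on_def)
      then show ?thesis
        by (simp add: ff height_def)
    qed
    ultimately show ?thesis
      by (auto simp: eventually_nhds)
  qed
  moreover have "continuous (at y) (\<lambda>y. \<kappa> (sec y))"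
  proof -
    have "continuous_on (exterior_region \<mu> \<inter> sec -` U) (\<lambda>y. \<kappa> (sec y))"
      by (rule continuous_on_compose2[OF homeomorphism_cont1[OF hom] continuous_on_subset[OF sec(1)]]) auto
    then show ?thesis
      using open_sec_preimage[OF oU] y xU by (simp add: continuous_on_eq_continuous_at)
  qed
  moreover have "spacelike_patch \<mu> f (\<kappa> ` U)"
    unfolding f_def i_def by (rule chart_of_spacelike_hypersurface[OF mu dim hyp chart])
  moreover have "z \<in> \<kappa> ` U" "f z = (y, height y)"
    using xU f_sec[OF y xU] by (auto simp: z_def)
  moreover have "open (exterior_region \<mu> \<inter> sec -` U)" "y \<in> exterior_region \<mu> \<inter> sec -` U"
    using open_sec_preimage[OF oU] y xU by auto
  ultimately show ?thesis
    using mc f_sec by (intro that[of f "\<kappa> ` U" z _ "\<lambda>y. \<kappa> (sec y)"]) (auto simp: z_def)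
qed

text \<open>A spacelike graph is nowhere as steep as a radial light ray.\<close>

lemma height_radial_derivative:
  assumes \<theta>: "norm \<theta> = 1" and t: "schw_radius DIM('e) \<mu> < t"
  shows "\<exists>a. ((\<lambda>t. height (t *\<^sub>R \<theta>)) has_real_derivative a) (at t) \<and> \<bar>a\<bar> < 1 / schw_V DIM('e) \<mu> t"
proof -
  have t0: "t > 0"
    using t schw_radius_pos[OF mu, of "DIM('e)"] by linarith
  then have "t *\<^sub>R \<theta> \<in> exterior_region \<mu>"
    using t \<theta> by (simp add: exterior_region_def)
  then obtain f \<Omega> z \<zeta> T where "spacelike_patch \<mu> f \<Omega>" and z: "z \<in> \<Omega>" and fz: "f z = (t *\<^sub>R \<theta>, height (t *\<^sub>R \<theta>))"
    and T: "open T" "t *\<^sub>R \<theta> \<in> T" and \<zeta>: "\<zeta> (t *\<^sub>R \<theta>) = z" "continuous (at (t *\<^sub>R \<theta>)) \<zeta>"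
    and f\<zeta>: "\<And>y. y \<in> T \<Longrightarrow> f (\<zeta> y) = (y, height y)"
    by (rule graph_patch) (rule that, assumption+)
  then interpret spacelike_patch \<mu> f \<Omega>
    by simp
  obtain \<zeta>' where \<zeta>': "(\<zeta> has_derivative \<zeta>') (at (t *\<^sub>R \<theta>))" "\<And>h. fst (D z (\<zeta>' h)) = h"
    using graph_has_derivative[of \<zeta> "t *\<^sub>R \<theta>" T] z T \<zeta> f\<zeta> by auto
  define a where "a = snd (D z (\<zeta>' \<theta>))"
  have ray: "((\<lambda>t. t *\<^sub>R \<theta>) has_derivative (\<lambda>h. h *\<^sub>R \<theta>)) (at t)"
    by (auto intro!: derivative_eq_intros)
  have "((\<lambda>t. snd (f (\<zeta> (t *\<^sub>R \<theta>)))) has_derivative (\<lambda>h. snd (D z (\<zeta>' (h *\<^sub>R \<theta>))))) (at t)"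
    by (intro has_derivative_snd has_derivative_compose[OF ray] has_derivative_compose[OF \<zeta>'(1)])
      (use has_derivative_D[OF z] \<zeta>(1) in simp)
  moreover have "snd (D z (\<zeta>' (h *\<^sub>R \<theta>))) = a * h" for h
    using has_derivative_linear[OF \<zeta>'(1)] linear_D[OF z] by (simp add: linear_cmul a_def mult.commute)
  ultimately have d: "((\<lambda>t. snd (f (\<zeta> (t *\<^sub>R \<theta>)))) has_derivative (\<lambda>h. a * h)) (at t)"
    by simp
  have "open ((\<lambda>t. t *\<^sub>R \<theta>) -` T)"
    by (intro open_vimage T continuous_intros)
  then have "((\<lambda>t. height (t *\<^sub>R \<theta>)) has_derivative (\<lambda>h. a * h)) (at t)"
    by (rule has_derivative_transform_within_open[OF d]) (use T f\<zeta> in auto)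
  moreover have "\<bar>a\<bar> < 1 / V z"
    unfolding a_def by (rule radial_slope_bound[OF z]) (use t0 \<theta> in \<open>simp add: \<zeta>'(2) fz\<close>)
  moreover have "V z = schw_V DIM('e) \<mu> t"
    using t0 \<theta> by (simp add: fz)
  ultimately show ?thesis
    unfolding has_field_derivative_def by (intro exI[of _ a]) simp
qed

lemma continuous_height: "continuous_on (exterior_region \<mu>) height"
proof (intro continuous_at_imp_continuous_on ballI)
  fix y :: 'e assume "y \<in> exterior_region \<mu>"
  then obtain f \<Omega> z \<zeta> T where "spacelike_patch \<mu> f \<Omega>" and z: "z \<in> \<Omega>"
    and T: "open T" "y \<in> T" and \<zeta>: "\<zeta> y = z" "continuous (at y) \<zeta>"
    and f\<zeta>: "\<And>y. y \<in> T \<Longrightarrow> f (\<zeta> y) = (y, height y)"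
    by (rule graph_patch) (rule that, assumption+)
  then interpret spacelike_patch \<mu> f \<Omega>
    by simp
  have "continuous (at (\<zeta> y)) f"
    using has_derivative_continuous[OF has_derivative_D[OF z]] \<zeta>(1) by simp
  from continuous_at_compose[OF \<zeta>(2) this] have "continuous (at y) (\<lambda>y. snd (f (\<zeta> y)))"
    by (intro continuous_intros) (simp add: o_def)
  moreover have "eventually (\<lambda>y. snd (f (\<zeta> y)) = height y) (nhds y)"
    using eventually_nhds_in_open[OF T] by eventually_elim (simp add: f\<zeta>)
  ultimately show "isCont height y"
    using isCont_cong[of "\<lambda>y. snd (f (\<zeta> y))" height y] by blast
qed

text \<open>
  Replacing \<open>t\<close> by \<open>- t\<close> exchanges the two cases; the sign \<open>\<sigma>\<close> treats them together. If the signed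
  height \<open>w\<close> were bounded above, its difference \<open>v\<close> from the barrier would attain a maximum over
  \<open>norm y \<ge> s\<close>, because the barrier tends to infinity. The maximum is not on the inner sphere: along the
  ray through the highest point \<open>y1\<close> of the graph over that sphere, the graph falls less than a light
  ray, and by choice of the barrier it falls less than the barrier, so \<open>v\<close> is larger one unit further
  out, at \<open>y2\<close>. At an interior maximum the comparison principle contradicts the curvature assumption.
\<close>

theorem signed_height_unbounded:
  assumes \<sigma>: "\<sigma> = 1 \<or> \<sigma> = - 1" and c: "c > 0"
    and H: "\<And>x. x \<in> M \<Longrightarrow> s\<^sub>0 \<le> fst (fst (\<psi> x)) \<Longrightarrow> c \<le> \<sigma> * mean_curvature \<mu> \<A> \<psi> x"
    and bound: "\<And>x. x \<in> M \<Longrightarrow> \<sigma> * snd (\<psi> x) \<le> t\<^sub>0"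
  shows False
proof -
  let ?m = "DIM('e)"
  let ?R = "schw_radius ?m \<mu>"
  define w where "w y = \<sigma> * height y" for y
  have R: "?R > 0"
    using mu by (rule schw_radius_pos)
  \<comment> \<open>Adding 1 keeps the sphere of radius \<open>s\<close> away from the horizon, where \<open>V\<close> vanishes.\<close>
  define s where "s = max s\<^sub>0 ?R + 1"
  have s: "?R < s" "s\<^sub>0 \<le> s" "0 < s"
    using R by (auto simp: s_def)
  have ext: "y \<in> exterior_region \<mu>" if "s \<le> norm y" for y :: 'e
    using that s by (simp add: exterior_region_def)
  have contw: "continuous_on (exterior_region \<mu>) w"
    unfolding w_def by (intro continuous_intros continuous_height)
  obtain y1 where y1: "y1 \<in> sphere 0 s" "\<And>y. y \<in> sphere 0 s \<Longrightarrow> w y \<le> w y1"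
  proof -
    have "sphere (0::'e) s \<noteq> {}"
      using s by simp
    moreover have "continuous_on (sphere 0 s) w"
      by (rule continuous_on_subset[OF contw]) (use ext in auto)
    ultimately show ?thesis
      using continuous_attains_sup[of "sphere 0 s" w] that by auto
  qed
  define \<theta> where "\<theta> = y1 /\<^sub>R s"
  have \<theta>: "norm \<theta> = 1" and y1\<theta>: "y1 = s *\<^sub>R \<theta>"
    using y1 s by (auto simp: \<theta>_def)
  define y2 where "y2 = (s + 1) *\<^sub>R \<theta>"
  have ny2: "norm y2 = s + 1"
    using \<theta> s by (simp add: y2_def)
  have "\<exists>F. \<forall>x :: real. ereal ?R < x \<longrightarrow> x < \<infinity> \<longrightarrow> (F has_vector_derivative 1 / schw_V ?m \<mu> x) (at x)"
  proof (rule einterval_antiderivative)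
    fix x assume x: "ereal ?R < ereal x" "ereal x < \<infinity>"
    then have "schw_V ?m \<mu> x \<noteq> 0" "x > 0"
      using schw_V_bounds(1)[OF mu dim, of x] R by auto
    then show "isCont (\<lambda>x. 1 / schw_V ?m \<mu> x) x"
      using DERIV_isCont[OF schw_V_has_derivative[of x ?m \<mu>]] by (intro continuous_intros) auto
  qed simp
  then obtain B where "\<forall>x :: real. ereal ?R < x \<longrightarrow> x < \<infinity> \<longrightarrow> (B has_vector_derivative 1 / schw_V ?m \<mu> x) (at x)"
    by blast
  then have B: "(B has_real_derivative 1 / schw_V ?m \<mu> x) (at x)" if "?R < x" for x
    using that by (simp add: has_real_derivative_iff_has_vector_derivative)
  have "w (s *\<^sub>R \<theta>) + B s < w ((s + 1) *\<^sub>R \<theta>) + B (s + 1)"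
  proof (rule DERIV_pos_imp_increasing[of s "s + 1" "\<lambda>t. w (t *\<^sub>R \<theta>) + B t"])
    fix t assume "s \<le> t" "t \<le> s + 1"
    then have t: "?R < t"
      using s by simp
    obtain a where a: "((\<lambda>t. height (t *\<^sub>R \<theta>)) has_real_derivative a) (at t)" "\<bar>a\<bar> < 1 / schw_V ?m \<mu> t"
      using height_radial_derivative[OF \<theta> t] by blast
    have "((\<lambda>t. w (t *\<^sub>R \<theta>) + B t) has_real_derivative \<sigma> * a + 1 / schw_V ?m \<mu> t) (at t)"
      unfolding w_def by (intro DERIV_add DERIV_cmult a(1) B t)
    moreover have "0 < \<sigma> * a + 1 / schw_V ?m \<mu> t"
      using \<sigma> a(2) by (auto simp: abs_less_iff)
    ultimately show "\<exists>y. ((\<lambda>t. w (t *\<^sub>R \<theta>) + B t) has_real_derivative y) (at t) \<and> 0 < y"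
      by blast
  qed simp
  then have gap: "w y1 - w y2 < B (s + 1) - B s"
    by (simp add: y1\<theta> y2_def)
  have c2: "c / 2 > 0"
    using c by simp
  obtain \<phi> \<phi>' \<phi>'' where \<phi>: "\<And>x. ?R < x \<Longrightarrow> (\<phi> has_real_derivative \<phi>' x) (at x)"
    and \<phi>': "\<And>x. ?R < x \<Longrightarrow> (\<phi>' has_real_derivative \<phi>'' x) (at x)"
    and drop: "w y1 - w y2 < \<phi> s - \<phi> (s + 1)" and inf: "filterlim \<phi> at_top at_top"
    and curv: "\<And>x V V'. s \<le> x \<Longrightarrow> V = schw_V ?m \<mu> x \<Longrightarrow> V' = schw_V' ?m \<mu> x \<Longrightarrow>
      1 / sqrt (V - V ^ 3 * (\<phi>' x)\<^sup>2) * ((real ?m - 1) * (V\<^sup>2 * \<phi>' x / x)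
        + (V * \<phi>'' x + \<phi>' x * V' * (3 / 2 - V\<^sup>2 * (\<phi>' x)\<^sup>2 / 2)) / (1 / V - V * (\<phi>' x)\<^sup>2))
      \<le> real ?m * (c / 2)"
    using radial_barrier_exists[OF mu dim s(1) c2 B gap] by metis
  define v where "v y = w y - \<phi> (norm y)" for y
  have wle: "w y \<le> t\<^sub>0" if "s \<le> norm y" for y
    using bound[OF sec(2)[OF ext[OF that]]] by (simp add: w_def height_def)
  obtain L where L: "\<And>x. L \<le> x \<Longrightarrow> t\<^sub>0 - v y2 < \<phi> x"
    using inf by (auto simp: filterlim_at_top_dense eventually_at_top_linorder)
  define L' where "L' = max L (s + 1)"
  define K where "K = {y :: 'e. s \<le> norm y \<and> norm y \<le> L'}"
  have "compact K"
  proof -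
    have "K = cball 0 L' - ball 0 s"
      by (auto simp: K_def)
    then show ?thesis
      by (simp add: compact_diff)
  qed
  moreover have y2K: "y2 \<in> K"
    using ny2 by (simp add: K_def L'_def)
  moreover have "continuous_on K v"
  proof -
    have "continuous_on {?R<..} \<phi>"
      using \<phi> DERIV_isCont by (intro continuous_at_imp_continuous_on) auto
    then have "continuous_on K (\<lambda>y. \<phi> (norm y))"
      by (rule continuous_on_compose2) (use s in \<open>auto simp: K_def intro: continuous_intros\<close>)
    then show ?thesis
      unfolding v_def using contw ext by (intro continuous_on_diff continuous_on_subset[OF contw]) (auto simp: K_def)
  qed
  ultimately obtain y0 where y0: "y0 \<in> K" "\<And>y. y \<in> K \<Longrightarrow> v y \<le> v y0"
    using continuous_attains_sup[of K v] by blast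
  have v02: "v y2 \<le> v y0"
    by (rule y0(2)[OF y2K])
  have "norm y0 \<noteq> s"
  proof
    assume e: "norm y0 = s"
    then have "v y0 \<le> w y1 - \<phi> s"
      using y1(2)[of y0] by (simp add: v_def)
    also have "\<dots> < v y2"
      using drop by (simp add: v_def ny2)
    finally show False
      using v02 by simp
  qed
  moreover have "norm y0 < L"
  proof (rule ccontr)
    assume "\<not> norm y0 < L"
    then have "t\<^sub>0 - v y2 < \<phi> (norm y0)"
      using L by simp
    then have "v y0 < v y2"
      using wle[of y0] y0(1) by (simp add: v_def K_def)
    then show False
      using v02 by simp
  qed
  ultimately have in0: "s < norm y0" "norm y0 < L'"
    using y0(1) by (auto simp: K_def L'_def)
  have y0e: "y0 \<in> exterior_region \<mu>"
    using ext in0 by simp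
  then obtain f \<Omega> z \<zeta> T where patch: "spacelike_patch \<mu> f \<Omega>" and z: "z \<in> \<Omega>" and fz: "f z = (y0, height y0)"
    and mc: "mean_curvature \<mu> \<A> \<psi> (sec y0) = mean_curvature_param \<mu> f z"
    and graph: "eventually (\<lambda>v. snd (f v) = height (fst (f v))) (nhds z)"
    by (rule graph_patch) (rule that, assumption+)
  interpret spacelike_patch \<mu> f \<Omega>
    by (rule patch)
  have rz: "norm (fst (f z)) = norm y0"
    by (simp add: fz)
  have Rr: "?R < norm y0"
    using in0 s by simp
  have \<sigma>2: "\<sigma> * (\<sigma> * x) = x" "(\<sigma> * x)\<^sup>2 = x\<^sup>2" "\<sigma> \<noteq> 0" for x
    using \<sigma> by auto
  have contact: "eventually (\<lambda>x. \<sigma> * (snd (f x) - \<sigma> * \<phi> (norm (fst (f x))))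
      \<le> \<sigma> * (snd (f z) - \<sigma> * \<phi> (norm (fst (f z))))) (nhds z)"
  proof -
    have "isCont (\<lambda>x. norm (fst (f x))) z"
      using has_derivative_continuous[OF has_derivative_D[OF z]] by (intro continuous_intros)
    then have lim: "((\<lambda>x. norm (fst (f x))) \<longlongrightarrow> norm y0) (nhds z)"
      using tendsto_at_iff_tendsto_nhds[of "\<lambda>x. norm (fst (f x))" z] by (simp add: isCont_def fz)
    have "eventually (\<lambda>x. s < norm (fst (f x))) (nhds z)" "eventually (\<lambda>x. norm (fst (f x)) < L') (nhds z)"
      using order_tendstoD[OF lim] in0 by auto
    then show ?thesis
      using graph
    proof eventually_elim
      case (elim x)
      then have "v (fst (f x)) \<le> v y0"
        by (intro y0(2)) (simp add: K_def)
      then show ?case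
        using elim by (simp add: v_def w_def fz right_diff_distrib \<sigma>2)
    qed
  qed
  have ev\<phi>: "eventually (\<lambda>x. ((\<lambda>x. \<sigma> * \<phi> x) has_real_derivative \<sigma> * \<phi>' x) (at x)) (nhds (norm (fst (f z))))"
    unfolding rz using eventually_nhds_in_open[OF open_greaterThan, of "norm y0" ?R] Rr
    by (auto elim!: eventually_mono intro: DERIV_cmult \<phi>)
  have d2: "((\<lambda>x. \<sigma> * \<phi>' x) has_real_derivative \<sigma> * \<phi>'' (norm y0)) (at (norm (fst (f z))))"
    unfolding rz by (intro DERIV_cmult \<phi>' Rr)
  let ?V = "schw_V ?m \<mu> (norm y0)" and ?V' = "schw_V' ?m \<mu> (norm y0)" and ?x = "norm y0"
  have d1: "\<sigma> * \<phi>' (norm (fst (f z))) = \<sigma> * \<phi>' ?x"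
    by (simp add: rz)
  have "\<sigma> * (real ?m * mean_curvature_param \<mu> f z) \<le>
    \<sigma> * (1 / sqrt (?V - ?V ^ 3 * (\<sigma> * \<phi>' ?x)\<^sup>2)) * ((real ?m - 1) * (?V\<^sup>2 * (\<sigma> * \<phi>' ?x) / ?x)
      + (?V * (\<sigma> * \<phi>'' ?x) + \<sigma> * \<phi>' ?x * ?V' * (3 / 2 - ?V\<^sup>2 * (\<sigma> * \<phi>' ?x)\<^sup>2 / 2)) / (1 / ?V - ?V * (\<sigma> * \<phi>' ?x)\<^sup>2))"
    using mean_curvature_contact[OF z \<sigma>2(3) ev\<phi> d1 d2 contact] unfolding rz .
  also have "\<dots> = 1 / sqrt (?V - ?V ^ 3 * (\<phi>' ?x)\<^sup>2) * ((real ?m - 1) * (?V\<^sup>2 * \<phi>' ?x / ?x)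
      + (?V * \<phi>'' ?x + \<phi>' ?x * ?V' * (3 / 2 - ?V\<^sup>2 * (\<phi>' ?x)\<^sup>2 / 2)) / (1 / ?V - ?V * (\<phi>' ?x)\<^sup>2))"
  proof -
    have "\<sigma> * l * (k * (u * (\<sigma> * a) / x) + (b * (\<sigma> * d) + \<sigma> * a * e * g) / h)
        = l * (k * (u * a / x) + (b * d + a * e * g) / h)" for l k u a x b d e g h :: real
      using \<sigma> by (auto simp: algebra_simps add_divide_distrib diff_divide_distrib)
    then show ?thesis
      unfolding \<sigma>2(2) .
  qed
  also have "\<dots> \<le> real ?m * (c / 2)"
    using in0 by (intro curv) auto
  finally have "real ?m * (\<sigma> * mean_curvature_param \<mu> f z) \<le> real ?m * (c / 2)"
    by (simp add: mult_ac)
  then have "\<sigma> * mean_curvature_param \<mu> f z \<le> c / 2"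
    using dim by simp
  moreover have "c \<le> \<sigma> * mean_curvature_param \<mu> f z"
    unfolding mc[symmetric]
  proof (rule H[OF sec(2)[OF y0e]])
    have "fst (fst (\<psi> (sec y0))) = norm y0"
      using norm_proj[OF sec(2)[OF y0e]] sec(3)[OF y0e] by simp
    then show "s\<^sub>0 \<le> fst (fst (\<psi> (sec y0)))"
      using in0 s by simp
  qed
  ultimately show False
    using c by simp
qed

end

theorem theorem4:
  fixes \<mu> :: real
    and M :: "'a::topological_space set"
    and \<A> :: "('a set \<times> ('a \<Rightarrow> 'e::euclidean_space)) set"
    and \<psi> :: "'a \<Rightarrow> (real \<times> 'e) \<times> real"
  assumes "DIM('e) \<ge> 3"
    and "\<mu> > 0"
    and "spacelike_hypersurface \<mu> M \<A> \<psi>"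
    and "covering_space M (fst \<circ> \<psi>) (schw_base \<mu>)"
  shows "(liminf_end M (\<lambda>x. fst (fst (\<psi> x))) (mean_curvature \<mu> \<A> \<psi>) > 0 \<longrightarrow>
            (\<forall>t\<^sub>0. \<not> \<psi> ` M \<subseteq> schw_base \<mu> \<times> {..t\<^sub>0})) \<and>
         (limsup_end M (\<lambda>x. fst (fst (\<psi> x))) (mean_curvature \<mu> \<A> \<psi>) < 0 \<longrightarrow>
            (\<forall>t\<^sub>0. \<not> \<psi> ` M \<subseteq> schw_base \<mu> \<times> {t\<^sub>0..}))"
proof -
  interpret covering_hypersurface \<mu> M \<A> \<psi>
    using assms by unfold_locales
  show ?thesis
  proof (intro conjI impI allI notI)
    fix t0 assume H: "liminf_end M (\<lambda>x. fst (fst (\<psi> x))) (mean_curvature \<mu> \<A> \<psi>) > 0"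
      and sub: "\<psi> ` M \<subseteq> schw_base \<mu> \<times> {..t0}"
    obtain c s where c: "c > 0"
      "\<And>x. x \<in> M \<Longrightarrow> s \<le> fst (fst (\<psi> x)) \<Longrightarrow> c \<le> mean_curvature \<mu> \<A> \<psi> x"
      using liminf_end_pos_imp_eventually_ge[OF H] by metis
    show False
      by (rule signed_height_unbounded[of 1 c s t0]) (use c sub in \<open>auto simp: mem_Times_iff\<close>)
  next
    fix t0 assume H: "limsup_end M (\<lambda>x. fst (fst (\<psi> x))) (mean_curvature \<mu> \<A> \<psi>) < 0"
      and sub: "\<psi> ` M \<subseteq> schw_base \<mu> \<times> {t0..}"
    obtain c s where c: "c > 0"
      "\<And>x. x \<in> M \<Longrightarrow> s \<le> fst (fst (\<psi> x)) \<Longrightarrow> mean_curvature \<mu> \<A> \<psi> x \<le> - c"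
      using limsup_end_neg_imp_eventually_le[OF H] by metis
    show False
    proof (rule signed_height_unbounded[of "- 1" c s "- t0"])
      show "c \<le> - 1 * mean_curvature \<mu> \<A> \<psi> x" if "x \<in> M" "s \<le> fst (fst (\<psi> x))" for x
        using c(2)[OF that] by simp
      show "- 1 * snd (\<psi> x) \<le> - t0" if "x \<in> M" for x
        using sub that by (auto simp: mem_Times_iff)
    qed (use c in auto)
  qed
qed

end
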